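(* Let $f(t,s,r)=\gamma(t)+sX(t)+rY(t)$ be a pseudo-non-degenerate two-ruled hypersurface with associated functions $a,b_1,b_2,b_3,b_4$, and let $p=(0,s,r)$ be a singular point of $f$. Then the germ of $f$ at $p$ is a Whitney umbrella $\times$ interval if and only if $b_4$ is not identically zero near $t=0$ and $b_4'(0)\neq 0$.
   Context: All maps are $C^\infty$; "for all $t\in(\mathbb{R},0)$" means for all $t$ in some open neighbourhood of $0$; primes denote $d/dt$. A two-ruled hypersurface is a map $f(t,s,r)=\gamma(t)+sX(t)+rY(t)\in\mathbb{R}^4$, $t\in(\mathbb{R},0)$, $s,r\in\mathbb{R}$, where $\gamma$ is a curve-germ with $\gamma(0)=0$ and $X(t),Y(t)$ are linearly independent. The director curves are taken constrictively adapted: $|X|=|Y|=1$, $\langle X,Y\rangle=0$, $\langle X,Y'\rangle=0$ for all $t$. It is pseudo-non-degenerate if $\dim\langle X,Y,X',Y'\rangle_{\mathbb{R}}=3$ for all $t$; for such $f$ one always assumes (after possibly interchanging $X,Y$ and changing the parameter) that $X,Y,X'$ are linearly independent and $|X'|=1$. Put $Z=X\wedge Y\wedge X'$ (formal determinant with first row the standard basis of $\mathbb{R}^4$ and next rows $X,Y,X'$), so that $\{X,Y,X',Z\}$ is orthonormal. The functions $a,b_1,\dots,b_4$ are defined by $Y'=aX'$, $\gamma'=b_1X+b_2Y+b_3X'+b_4Z$. A singular point of $f$ is a point where $\operatorname{rank} df<3$. Two germs $f,g$ are $\mathcal{A}$-equivalent if $\Phi\circ f\circ\varphi^{-1}=g$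 for diffeomorphism-germs $\varphi$ of the source and $\Phi$ of the target (base points being moved to the origin). A germ is a Whitney umbrella $\times$ interval if it is $\mathcal{A}$-equivalent at the origin to $(t,s,r)\mapsto(t,s,r^2,tr)$. *)

theory Defs
  imports "HOL-Analysis.Analysis"
begin

text \<open>\<open>C\<^sup>k\<close> and \<open>C\<^sup>\<infinity>\<close> maps, for use on open sets: a map is of class \<open>C\<^sup>k\<^sup>+\<^sup>1\<close> if it is
  differentiable and all its directional derivatives are of class \<open>C\<^sup>k\<close>.\<close>

primrec Ck_on :: "nat \<Rightarrow> 'a::real_normed_vector set \<Rightarrow> ('a \<Rightarrow> 'b::real_normed_vector) \<Rightarrow> bool" where
  "Ck_on 0 S f \<longleftrightarrow> continuous_on S f"
| "Ck_on (Suc k) S f \<longleftrightarrow>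
     (\<forall>x\<in>S. f differentiable (at x)) \<and>
     (\<forall>v. Ck_on k S (\<lambda>x. frechet_derivative f (at x) v))"

definition smooth_on :: "'a::real_normed_vector set \<Rightarrow> ('a \<Rightarrow> 'b::real_normed_vector) \<Rightarrow> bool" where
  "smooth_on S f \<longleftrightarrow> (\<forall>k. Ck_on k S f)"

definition diffeomorphism ::
    "'a::real_normed_vector set \<Rightarrow> 'b::real_normed_vector set \<Rightarrow> ('a \<Rightarrow> 'b) \<Rightarrow> ('b \<Rightarrow> 'a) \<Rightarrow> bool" where
  "diffeomorphism U V \<phi> \<psi> \<longleftrightarrow>
     open U \<and> open V \<and> homeomorphism U V \<phi> \<psi> \<and> smooth_on U \<phi> \<and> smooth_on V \<psi>"

text \<open>The germ of \<open>f\<close> at \<open>p\<close> is A-equivalent to the germ of \<open>g\<close> at \<open>q\<close>. The diffeomorphism germs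
  \<open>\<phi>\<close> (inverse \<open>\<phi>'\<close>) and \<open>\<Phi>\<close> (inverse \<open>\<Phi>'\<close>) carry \<open>p\<close> to \<open>q\<close> and \<open>f p\<close> to \<open>g q\<close>, so
  that no separate translation of the base points is needed.\<close>

definition A_equivalent ::
    "('a::real_normed_vector \<Rightarrow> 'b::real_normed_vector) \<Rightarrow> 'a \<Rightarrow>
     ('c::real_normed_vector \<Rightarrow> 'd::real_normed_vector) \<Rightarrow> 'c \<Rightarrow> bool" where
  "A_equivalent f p g q \<longleftrightarrow>
     (\<exists>U V \<phi> \<phi>' U' V' \<Phi> \<Phi>'.
        diffeomorphism U V \<phi> \<phi>' \<and> p \<in> U \<and> \<phi> p = q \<and>
        diffeomorphism U' V' \<Phi> \<Phi>' \<and> f p \<in> U' \<and> \<Phi> (f p) = g q \<and>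
        (\<forall>\<^sub>F y in nhds q. f (\<phi>' y) \<in> U' \<and> \<Phi> (f (\<phi>' y)) = g y))"

definition whitney_umbrella_interval :: "(real \<times> real \<times> real \<Rightarrow> real^4) \<Rightarrow> real \<times> real \<times> real \<Rightarrow> bool" where
  "whitney_umbrella_interval f p \<longleftrightarrow>
     A_equivalent f p (\<lambda>(t, s, r). vector [t, s, r^2, t * r] :: real^4) (0, 0, 0)"

definition singular_point :: "(real \<times> real \<times> real \<Rightarrow> real^4) \<Rightarrow> real \<times> real \<times> real \<Rightarrow> bool" where
  "singular_point f p \<longleftrightarrow> dim (range (frechet_derivative f (at p))) < 3"

text \<open>Linear independence of a family; \<open>independent\<close> of the underlying set alone would not see
  repetitions.\<close>

definition lin_indep :: "'a::real_vector list \<Rightarrow> bool" where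
  "lin_indep vs \<longleftrightarrow> distinct vs \<and> independent (set vs)"

text \<open>The formal determinant with first row the standard basis of \<open>\<real>\<^sup>4\<close> and next rows \<open>u\<close>, \<open>v\<close>, \<open>w\<close>:
  its \<open>i\<close>-th component is obtained by putting the \<open>i\<close>-th unit vector in the first row.\<close>

definition wedge3 :: "real^4 \<Rightarrow> real^4 \<Rightarrow> real^4 \<Rightarrow> real^4" where
  "wedge3 u v w = (\<chi> i. det (vector [axis i 1, u, v, w] :: real^4^4))"

definition two_ruled ::
    "(real \<Rightarrow> real^4) \<Rightarrow> (real \<Rightarrow> real^4) \<Rightarrow> (real \<Rightarrow> real^4) \<Rightarrow> real \<times> real \<times> real \<Rightarrow> real^4" where
  "two_ruled \<gamma> X Y = (\<lambda>(t, s, r). \<gamma> t + s *\<^sub>R X t + r *\<^sub>R Y t)"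

abbreviation curve_deriv :: "(real \<Rightarrow> real^4) \<Rightarrow> real \<Rightarrow> real^4" where
  "curve_deriv c t \<equiv> vector_derivative c (at t)"

text \<open>In the following, \<open>I\<close> is an open neighbourhood of \<open>0\<close> on which representatives of the
  curve germs are considered.\<close>

definition two_ruled_data ::
    "real set \<Rightarrow> (real \<Rightarrow> real^4) \<Rightarrow> (real \<Rightarrow> real^4) \<Rightarrow> (real \<Rightarrow> real^4) \<Rightarrow> bool" where
  "two_ruled_data I \<gamma> X Y \<longleftrightarrow>
     open I \<and> 0 \<in> I \<and> smooth_on I \<gamma> \<and> smooth_on I X \<and> smooth_on I Y \<and> \<gamma> 0 = 0 \<and>
     (\<forall>t\<in>I. lin_indep [X t, Y t])"

definition constrictively_adapted ::
    "real set \<Rightarrow> (real \<Rightarrow> real^4) \<Rightarrow> (real \<Rightarrow> real^4) \<Rightarrow> bool" where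
  "constrictively_adapted I X Y \<longleftrightarrow>
     (\<forall>t\<in>I. norm (X t) = 1 \<and> norm (Y t) = 1 \<and> X t \<bullet> Y t = 0 \<and> X t \<bullet> curve_deriv Y t = 0)"

definition pseudo_nondegenerate ::
    "real set \<Rightarrow> (real \<Rightarrow> real^4) \<Rightarrow> (real \<Rightarrow> real^4) \<Rightarrow> bool" where
  "pseudo_nondegenerate I X Y \<longleftrightarrow>
     (\<forall>t\<in>I. dim (span {X t, Y t, curve_deriv X t, curve_deriv Y t}) = 3)"

text \<open>The standing normalisation of pseudo-non-degenerate data.\<close>

definition normalised ::
    "real set \<Rightarrow> (real \<Rightarrow> real^4) \<Rightarrow> (real \<Rightarrow> real^4) \<Rightarrow> bool" where
  "normalised I X Y \<longleftrightarrow>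
     (\<forall>t\<in>I. lin_indep [X t, Y t, curve_deriv X t] \<and> norm (curve_deriv X t) = 1)"

text \<open>Since \<open>X\<close>, \<open>Y\<close>, \<open>X'\<close> and their wedge form an orthonormal frame and \<open>Y'\<close> is orthogonal
  to \<open>X\<close> and \<open>Y\<close> and lies in the span of \<open>X\<close>, \<open>Y\<close>, \<open>X'\<close>, these equations have exactly one
  solution on \<open>I\<close>.\<close>

definition associated_functions ::
    "real set \<Rightarrow> (real \<Rightarrow> real^4) \<Rightarrow> (real \<Rightarrow> real^4) \<Rightarrow> (real \<Rightarrow> real^4) \<Rightarrow>
     (real \<Rightarrow> real) \<Rightarrow> (real \<Rightarrow> real) \<Rightarrow> (real \<Rightarrow> real) \<Rightarrow> (real \<Rightarrow> real) \<Rightarrow> (real \<Rightarrow> real) \<Rightarrow> bool" where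
  "associated_functions I \<gamma> X Y a b1 b2 b3 b4 \<longleftrightarrow>
     (\<forall>t\<in>I. let X' = curve_deriv X t; Z = wedge3 (X t) (Y t) X' in
        curve_deriv Y t = a t *\<^sub>R X' \<and>
        curve_deriv \<gamma> t = b1 t *\<^sub>R X t + b2 t *\<^sub>R Y t + b3 t *\<^sub>R X' + b4 t *\<^sub>R Z)"

end

theory Submission
  imports Defs
begin

text \<open>At a singular point the tangent direction transversal to the ruling is degenerate, and the
  second intrinsic derivative of \<open>f\<close> has rank two iff \<open>b4' \<noteq> 0\<close>; being invariant under changes of
  coordinates, this rank condition is necessary.

  Conversely, put \<open>u = X 0 \<bullet> f\<close> and \<open>v = Y 0 \<bullet> f\<close>. Since every ruling is a plane, the other two
  components of \<open>f\<close> in the frame at \<open>0\<close> are affine in \<open>(u, v)\<close>; Hadamard's lemma turns them into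
  \<open>Z 0 \<bullet> f = t\<^sup>2 h(u, v, t)\<close> with \<open>h \<noteq> 0\<close> at the singular point iff \<open>b4' \<noteq> 0\<close>, and
  \<open>X' 0 \<bullet> f = t L(u, v, t)\<close>. With \<open>T = t \<surd>\<bar>h\<bar>\<close> the first is \<open>\<plusminus> T\<^sup>2\<close>. Splitting \<open>L / \<surd>\<bar>h\<bar>\<close> into
  its even and odd part with respect to \<open>T\<close>, it becomes \<open>B(u, v, T\<^sup>2) + T A(u, v, T\<^sup>2)\<close> with
  smooth \<open>A\<close>, \<open>B\<close> (Whitney). Then \<open>(B, v, T)\<close> are source coordinates, and \<open>f\<close> takes the form
  \<open>(B, v, T\<^sup>2, T B)\<close> after subtracting \<open>T\<^sup>2 A\<close>, a function on the target.\<close>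

section \<open>Smooth maps\<close>

text \<open>The obstacle lies on the target side. \<open>\<Phi>\<close> must be a diffeomorphism
  between open sets, and there \<open>T\<^sup>2\<close> is replaced by a linear coordinate that
  takes both signs, while an even function of \<open>T\<close> determines \<open>A\<close> and
  \<open>B\<close> for nonnegative values only. They are continued to negative values by Seeley's
  reflection, an infinite combination of dilates whose coefficients match the derivatives of all
  orders at the seam, smoothly in the parameters \<open>(u, v)\<close>. Cut-off functions provide
  global functions of bounded support, for which these series and all their derivatives converge
  uniformly.

  Choosing \<open>u\<close> and \<open>v\<close> as linear functions on the target makes every
  smooth function of \<open>(u, v, T\<^sup>2)\<close> a function on the target. Division of
  \<open>L\<close> by \<open>\<surd>|h|\<close> is forced by
  \<open>t L = T (L / \<surd>|h|)\<close>.

  Necessity is tested on one covector: \<open>Z 0\<close> annihilates the image of the derivative at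
  the singular point, so the rank condition can be stated without quotient spaces.\<close>

lemma Ck_on_cong:
  assumes "open S" "\<And>x. x \<in> S \<Longrightarrow> f x = g x" "Ck_on k S f"
  shows "Ck_on k S g"
  using assms(2,3)
proof (induction k arbitrary: f g)
  case 0
  then show ?case by (simp cong: continuous_on_cong_simp)
next
  case (Suc k)
  have d: "(f has_derivative frechet_derivative f (at x)) (at x)" if "x \<in> S" for x
    using Suc.prems(2) that by (simp add: frechet_derivative_works)
  have g: "(g has_derivative frechet_derivative f (at x)) (at x)" if "x \<in> S" for x
    using has_derivative_transform_within_open[OF d[OF that] assms(1) that] Suc.prems(1) by auto
  have e: "frechet_derivative f (at x) v = frechet_derivative g (at x) v" if "x \<in> S" for x v
    using frechet_derivative_at[OF g[OF that]] by simp
  have "Ck_on k S (\<lambda>x. frechet_derivative g (at x) v)" for v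
    using Suc.IH[of "\<lambda>x. frechet_derivative f (at x) v"] e Suc.prems(2) by auto
  then show ?case using g by (auto simp: differentiable_def)
qed

lemma Ck_on_subset: "Ck_on k S f \<Longrightarrow> T \<subseteq> S \<Longrightarrow> Ck_on k T f"
  by (induction k arbitrary: f) (auto intro: continuous_on_subset)

text \<open>Derivatives are unique, so an explicit formula may replace
  \<open>frechet_derivative\<close>; the later inductions on the order go through this rule.\<close>

lemma Ck_on_SucI:
  assumes "open S" "\<And>x. x \<in> S \<Longrightarrow> (f has_derivative f' x) (at x)"
    and "\<And>v. Ck_on k S (\<lambda>x. f' x v)"
  shows "Ck_on (Suc k) S f"
proof -
  have "Ck_on k S (\<lambda>x. frechet_derivative f (at x) v)" for v
    by (rule Ck_on_cong[OF assms(1) _ assms(3)[of v]])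
      (use frechet_derivative_at[OF assms(2)] in auto)
  then show ?thesis using assms(2) by (auto simp: differentiable_def)
qed

lemma Ck_on_Suc_has_derivative:
  "Ck_on (Suc k) S f \<Longrightarrow> x \<in> S \<Longrightarrow> (f has_derivative frechet_derivative f (at x)) (at x)"
  by (simp add: frechet_derivative_works)

lemma Ck_on_SucD: "Ck_on (Suc k) S f \<Longrightarrow> Ck_on k S f"
proof (induction k arbitrary: f)
  case 0
  then show ?case
    by (auto intro!: continuous_at_imp_continuous_on differentiable_imp_continuous_within)
next
  case (Suc k)
  show ?case using Suc.prems Suc.IH by auto
qed

lemma Ck_on_le: "Ck_on k S f \<Longrightarrow> j \<le> k \<Longrightarrow> Ck_on j S f"
  by (induction k) (auto simp: le_Suc_eq dest: Ck_on_SucD simp del: Ck_on.simps)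

lemma Ck_on_continuous_on: "Ck_on k S f \<Longrightarrow> continuous_on S f"
  using Ck_on_le[of k S f 0] by simp

text \<open>Used to glue a cut-off function times \<open>f\<close> with zero.\<close>

lemma Ck_on_local:
  assumes "\<And>x. x \<in> S \<Longrightarrow> \<exists>U. open U \<and> x \<in> U \<and> Ck_on k U f"
  shows "Ck_on k S f"
  using assms
proof (induction k arbitrary: f)
  case 0
  have "continuous (at x) f" if "x \<in> S" for x
    using 0[OF that] by (auto simp: continuous_on_eq_continuous_at)
  then show ?case by (simp add: continuous_at_imp_continuous_on)
next
  case (Suc k)
  show ?case
  proof (simp, intro conjI ballI allI)
    show "f differentiable (at x)" if "x \<in> S" for x
      using Suc.prems[OF that] by auto
    show "Ck_on k S (\<lambda>x. frechet_derivative f (at x) v)" for v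
      by (rule Suc.IH) (use Suc.prems in force)
  qed
qed

section \<open>Closure properties of \<open>C^k\<close> maps\<close>

lemma Ck_on_const: "open S \<Longrightarrow> Ck_on k S (\<lambda>x. c)"
proof (induction k arbitrary: c)
  case (Suc k)
  show ?case by (rule Ck_on_SucI[where f'="\<lambda>x v. 0"]) (use Suc in auto)
qed simp

lemma Ck_on_bounded_linear_comp:
  assumes "open S" "bounded_linear L" "Ck_on k S f"
  shows "Ck_on k S (\<lambda>x. L (f x))"
  using assms(3)
proof (induction k arbitrary: f)
  case 0
  then show ?case using assms(2) by (simp add: linear_continuous_on_compose bounded_linear.continuous_on)
next
  case (Suc k)
  show ?case
    by (rule Ck_on_SucI[OF assms(1) bounded_linear.has_derivative[OF assms(2)
          Ck_on_Suc_has_derivative[OF Suc.prems]]])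
      (use Suc in auto)
qed

lemma Ck_on_id: "open S \<Longrightarrow> Ck_on k S (\<lambda>x. x)"
proof (cases k)
  case (Suc k)
  then show "open S \<Longrightarrow> ?thesis"
    using Ck_on_SucI[of S "\<lambda>x. x" "\<lambda>x v. v" k] Ck_on_const[of S k] by auto
qed (auto)

lemma Ck_on_add:
  assumes "open S" "Ck_on k S f" "Ck_on k S g"
  shows "Ck_on k S (\<lambda>x. f x + g x)"
  using assms(2,3)
proof (induction k arbitrary: f g)
  case 0
  then show ?case by (simp add: continuous_on_add)
next
  case (Suc k)
  show ?case
    by (rule Ck_on_SucI[OF assms(1) has_derivative_add[OF Ck_on_Suc_has_derivative[OF Suc.prems(1)]
          Ck_on_Suc_has_derivative[OF Suc.prems(2)]]])
      (use Suc in auto)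
qed

text \<open>One Leibniz rule serves products, scalar multiples and inner products: both summands of
  the derivative are again values of \<open>B\<close>, with one argument differentiated.\<close>

lemma Ck_on_bounded_bilinear:
  assumes "open S" "bounded_bilinear B" "Ck_on k S f" "Ck_on k S g"
  shows "Ck_on k S (\<lambda>x. B (f x) (g x))"
  using assms(3,4)
proof (induction k arbitrary: f g)
  case 0
  then show ?case using assms(2) by (simp add: bounded_bilinear.continuous_on)
next
  case (Suc k)
  show ?case
    by (rule Ck_on_SucI[OF assms(1) bounded_bilinear.FDERIV[OF assms(2)
           Ck_on_Suc_has_derivative[OF Suc.prems(1)] Ck_on_Suc_has_derivative[OF Suc.prems(2)]]])
      (use Suc Ck_on_SucD[OF Suc.prems(1)] Ck_on_SucD[OF Suc.prems(2)] assms(1)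
       in \<open>auto intro!: Ck_on_add\<close>)
qed

lemma Ck_on_sum:
  assumes "open S" "\<And>i. i \<in> A \<Longrightarrow> Ck_on k S (f i)"
  shows "Ck_on k S (\<lambda>x. \<Sum>i\<in>A. f i x)"
  using assms(2)
  by (induction A rule: infinite_finite_induct)
    (auto intro: Ck_on_const Ck_on_add simp: assms(1) simp del: Ck_on.simps)

text \<open>In \<open>?Df (g x) (?Dg x v)\<close> the direction moves with \<open>x\<close>, while
  \<open>Ck_on\<close> controls derivatives in fixed directions. Expanding \<open>?Dg x v\<close> in
  the basis of the middle space reduces this to finitely many fixed directions; hence that space is
  Euclidean.\<close>

lemma Ck_on_compose:
  fixes g :: "'a::real_normed_vector \<Rightarrow> 'b::euclidean_space"
  assumes "open S" "open T" "Ck_on k T f" "Ck_on k S g" "\<And>x. x \<in> S \<Longrightarrow> g x \<in> T"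
  shows "Ck_on k S (\<lambda>x. f (g x))"
  using assms(3,4)
proof (induction k arbitrary: f)
  case 0
  then show ?case using assms(5) by (auto intro: continuous_on_compose2)
next
  case (Suc k)
  let ?Df = "\<lambda>y. frechet_derivative f (at y)"
  let ?Dg = "\<lambda>x. frechet_derivative g (at x)"
  note df = Ck_on_Suc_has_derivative[OF Suc.prems(1)]
  note dg = Ck_on_Suc_has_derivative[OF Suc.prems(2)]
  have g: "Ck_on k S g" using Suc.prems(2) by (rule Ck_on_SucD)
  have Dg: "Ck_on k S (\<lambda>x. ?Dg x v)" for v using Suc.prems(2) by simp
  have Df: "Ck_on k T (\<lambda>x. ?Df x v)" for v using Suc.prems(1) by simp
  have "Ck_on k S (\<lambda>x. \<Sum>i\<in>Basis. (?Dg x v \<bullet> i) *\<^sub>R ?Df (g x) i)" for v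
    by (intro Ck_on_sum[OF assms(1)] Ck_on_bounded_bilinear[OF assms(1) bounded_bilinear_scaleR]
        Ck_on_bounded_linear_comp[OF assms(1) bounded_linear_inner_left] Dg)
      (rule Suc.IH[OF Df g])
  moreover have "?Df (g x) (?Dg x v) = (\<Sum>i\<in>Basis. (?Dg x v \<bullet> i) *\<^sub>R ?Df (g x) i)" if "x \<in> S" for x v
  proof -
    interpret linear "?Df (g x)"
      using df[OF assms(5)[OF that]] by (rule has_derivative_linear)
    show ?thesis
      by (subst euclidean_representation[of "?Dg x v", symmetric]) (simp only: sum scale)
  qed
  ultimately have "Ck_on k S (\<lambda>x. ?Df (g x) (?Dg x v))" for v
    by (metis (no_types, lifting) Ck_on_cong[OF assms(1)])
  then show ?case
    by (intro Ck_on_SucI[OF assms(1)])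
      (auto intro: has_derivative_compose[OF dg df] simp: assms(5))
qed

lemma Ck_on_Pair:
  assumes "open S" "Ck_on k S f" "Ck_on k S g"
  shows "Ck_on k S (\<lambda>x. (f x, g x))"
  using assms(2,3)
proof (induction k arbitrary: f g)
  case 0
  then show ?case by (simp add: continuous_on_Pair)
next
  case (Suc k)
  show ?case
    by (rule Ck_on_SucI[OF assms(1) has_derivative_Pair[OF Ck_on_Suc_has_derivative[OF Suc.prems(1)]
          Ck_on_Suc_has_derivative[OF Suc.prems(2)]]])
      (use Suc in auto)
qed

text \<open>The derivative is a polynomial in \<open>inverse x\<close>, so the order rises by one at
  each induction step. For \<open>sqrt\<close> below, the derivative is expressed through
  \<open>inverse (sqrt x)\<close> in the same spirit.\<close>

lemma Ck_on_inverse: "Ck_on k (- {0::real}) inverse"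
proof (induction k)
  case (Suc k)
  have o: "open (- {0::real})" by auto
  show ?case
    by (rule Ck_on_SucI[OF o has_derivative_inverse'])
      (auto intro!: Ck_on_bounded_linear_comp[OF o bounded_linear_minus[OF bounded_linear_ident]]
        Ck_on_bounded_bilinear[OF o bounded_bilinear_mult] Suc Ck_on_const simp: o)
qed (auto intro!: continuous_intros)

lemma Ck_on_sqrt: "Ck_on k {0::real<..} sqrt"
proof (induction k)
  case 0
  show ?case by (simp add: continuous_on_real_sqrt)
next
  case (Suc k)
  have o: "open {0::real<..}" by auto
  have i: "Ck_on k {0<..} (\<lambda>x. inverse (sqrt x))"
    by (rule Ck_on_compose[OF o _ Ck_on_inverse Suc]) auto
  have d: "(sqrt has_derivative (\<lambda>v. v * (inverse (sqrt x) / 2))) (at x)" if "x \<in> {0<..}" for x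
    using DERIV_real_sqrt[of x] that by (simp add: has_field_derivative_def mult.commute[of _ "_ / _"] del: times_divide_eq_right times_divide_eq_left)
  show ?case
    by (rule Ck_on_SucI[OF o d])
      (auto intro!: Ck_on_bounded_bilinear[OF o bounded_bilinear_mult] Ck_on_const[OF o]
        Ck_on_bounded_linear_comp[OF o bounded_linear_divide] i)
qed

lemma smooth_onD: "smooth_on S f \<Longrightarrow> Ck_on k S f"
  by (simp add: smooth_on_def)

lemma smooth_on_cong: "open S \<Longrightarrow> (\<And>x. x \<in> S \<Longrightarrow> f x = g x) \<Longrightarrow> smooth_on S f \<Longrightarrow> smooth_on S g"
  unfolding smooth_on_def by (blast intro: Ck_on_cong)

lemma smooth_on_subset: "smooth_on S f \<Longrightarrow> T \<subseteq> S \<Longrightarrow> smooth_on T f"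
  unfolding smooth_on_def by (blast intro: Ck_on_subset)

lemma smooth_on_local:
  "(\<And>x. x \<in> S \<Longrightarrow> \<exists>U. open U \<and> x \<in> U \<and> smooth_on U f) \<Longrightarrow> smooth_on S f"
  unfolding smooth_on_def by (intro allI Ck_on_local) blast

lemma smooth_on_has_derivative:
  "smooth_on S f \<Longrightarrow> x \<in> S \<Longrightarrow> (f has_derivative frechet_derivative f (at x)) (at x)"
  unfolding smooth_on_def using Ck_on_Suc_has_derivative by blast

lemma smooth_on_derivative: "smooth_on S f \<Longrightarrow> smooth_on S (\<lambda>x. frechet_derivative f (at x) v)"
  unfolding smooth_on_def using Ck_on.simps(2) by blast

lemma smooth_on_continuous_on: "smooth_on S f \<Longrightarrow> continuous_on S f"
  unfolding smooth_on_def using Ck_on_continuous_on by blast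

lemma smooth_on_const: "open S \<Longrightarrow> smooth_on S (\<lambda>x. c)"
  by (simp add: smooth_on_def Ck_on_const)

lemma smooth_on_id: "open S \<Longrightarrow> smooth_on S (\<lambda>x. x)"
  by (simp add: smooth_on_def Ck_on_id)

lemma smooth_on_bounded_linear_comp:
  "bounded_linear L \<Longrightarrow> open S \<Longrightarrow> smooth_on S f \<Longrightarrow> smooth_on S (\<lambda>x. L (f x))"
  by (simp add: smooth_on_def Ck_on_bounded_linear_comp)

lemma smooth_on_bounded_bilinear:
  "bounded_bilinear B \<Longrightarrow> open S \<Longrightarrow> smooth_on S f \<Longrightarrow> smooth_on S g \<Longrightarrow> smooth_on S (\<lambda>x. B (f x) (g x))"
  by (simp add: smooth_on_def Ck_on_bounded_bilinear)

lemma smooth_on_add: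
  "open S \<Longrightarrow> smooth_on S f \<Longrightarrow> smooth_on S g \<Longrightarrow> smooth_on S (\<lambda>x. f x + g x)"
  by (simp add: smooth_on_def Ck_on_add)

lemma smooth_on_sum:
  "open S \<Longrightarrow> (\<And>i. i \<in> A \<Longrightarrow> smooth_on S (f i)) \<Longrightarrow> smooth_on S (\<lambda>x. \<Sum>i\<in>A. f i x)"
  by (simp add: smooth_on_def Ck_on_sum)

lemma smooth_on_Pair:
  "open S \<Longrightarrow> smooth_on S f \<Longrightarrow> smooth_on S g \<Longrightarrow> smooth_on S (\<lambda>x. (f x, g x))"
  by (simp add: smooth_on_def Ck_on_Pair)

lemma smooth_on_compose:
  fixes g :: "'a::real_normed_vector \<Rightarrow> 'b::euclidean_space"
  shows "smooth_on T f \<Longrightarrow> open T \<Longrightarrow> open S \<Longrightarrow> smooth_on S g \<Longrightarrow> (\<And>x. x \<in> S \<Longrightarrow> g x \<in> T)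
    \<Longrightarrow> smooth_on S (\<lambda>x. f (g x))"
  unfolding smooth_on_def using Ck_on_compose by metis

lemmas smooth_on_uminus = smooth_on_bounded_linear_comp[OF bounded_linear_minus[OF bounded_linear_ident]]
lemmas smooth_on_fst = smooth_on_bounded_linear_comp[OF bounded_linear_fst]
lemmas smooth_on_snd = smooth_on_bounded_linear_comp[OF bounded_linear_snd]
lemmas smooth_on_mult = smooth_on_bounded_bilinear[OF bounded_bilinear_mult]
lemmas smooth_on_scaleR = smooth_on_bounded_bilinear[OF bounded_bilinear_scaleR]
lemmas smooth_on_inner = smooth_on_bounded_bilinear[OF bounded_bilinear_inner]

lemma smooth_on_diff:
  "open S \<Longrightarrow> smooth_on S f \<Longrightarrow> smooth_on S g \<Longrightarrow> smooth_on S (\<lambda>x. f x - g x)"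
  using smooth_on_add[of S f "\<lambda>x. - g x"] smooth_on_uminus[of S g] by simp

lemma smooth_on_power:
  fixes f :: "'a::real_normed_vector \<Rightarrow> real"
  shows "open S \<Longrightarrow> smooth_on S f \<Longrightarrow> smooth_on S (\<lambda>x. f x ^ n)"
  by (induction n) (auto intro: smooth_on_const smooth_on_mult)

lemma smooth_on_prod:
  fixes f :: "'i \<Rightarrow> 'a::real_normed_vector \<Rightarrow> real"
  shows "open S \<Longrightarrow> (\<And>i. i \<in> A \<Longrightarrow> smooth_on S (f i)) \<Longrightarrow> smooth_on S (\<lambda>x. \<Prod>i\<in>A. f i x)"
  by (induction A rule: infinite_finite_induct) (auto intro: smooth_on_const smooth_on_mult)

lemma smooth_on_sqrt:
  "open S \<Longrightarrow> smooth_on S f \<Longrightarrow> (\<And>x. x \<in> S \<Longrightarrow> 0 < f x) \<Longrightarrow> smooth_on S (\<lambda>x. sqrt (f x))"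
  by (rule smooth_on_compose[of "{0<..}"]) (auto simp: smooth_on_def[of _ sqrt] Ck_on_sqrt)

lemma smooth_on_divide:
  fixes f g :: "'a::real_normed_vector \<Rightarrow> real"
  assumes "open S" "smooth_on S f" "smooth_on S g" "\<And>x. x \<in> S \<Longrightarrow> g x \<noteq> 0"
  shows "smooth_on S (\<lambda>x. f x / g x)"
proof -
  have "smooth_on S (\<lambda>x. inverse (g x))"
    by (rule smooth_on_compose[of "- {0}"])
      (use assms in \<open>auto simp: smooth_on_def[of _ inverse] Ck_on_inverse\<close>)
  then show ?thesis unfolding divide_inverse by (intro smooth_on_mult assms)
qed

lemmas smooth_intros = smooth_on_const smooth_on_id smooth_on_add smooth_on_diff smooth_on_uminus
  smooth_on_mult smooth_on_scaleR smooth_on_inner smooth_on_power smooth_on_Pair smooth_on_fst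
  smooth_on_snd smooth_on_sum smooth_on_prod

section \<open>The smooth inverse function theorem\<close>

lemma tendsto_linear_family:
  fixes A :: "'t \<Rightarrow> 'a::euclidean_space \<Rightarrow> 'b::real_normed_vector"
  assumes lin: "\<forall>\<^sub>F x in F. linear (A x)" and lin0: "linear A0"
    and A: "\<And>w. ((\<lambda>x. A x w) \<longlongrightarrow> A0 w) F" and w: "(w \<longlongrightarrow> w0) F"
  shows "((\<lambda>x. A x (w x)) \<longlongrightarrow> A0 w0) F"
proof -
  have rep: "B v = (\<Sum>i\<in>Basis. (v \<bullet> i) *\<^sub>R B i)" if "linear B" for B :: "'a \<Rightarrow> 'b" and v
  proof -
    interpret linear B by fact
    show ?thesis
      by (subst euclidean_representation[of v, symmetric]) (simp only: sum scale)
  qed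
  have "((\<lambda>x. \<Sum>i\<in>Basis. (w x \<bullet> i) *\<^sub>R A x i) \<longlongrightarrow> (\<Sum>i\<in>Basis. (w0 \<bullet> i) *\<^sub>R A0 i)) F"
    by (intro tendsto_intros A w)
  then have "((\<lambda>x. \<Sum>i\<in>Basis. (w x \<bullet> i) *\<^sub>R A x i) \<longlongrightarrow> A0 w0) F"
    by (simp add: rep[OF lin0, of w0])
  moreover have "\<forall>\<^sub>F x in F. (\<Sum>i\<in>Basis. (w x \<bullet> i) *\<^sub>R A x i) = A x (w x)"
    using lin by eventually_elim (metis rep)
  ultimately show ?thesis by (rule Lim_transform_eventually)
qed

text \<open>Perturbation: if \<open>norm w \<le> B * norm (A x0 w)\<close> and \<open>A x\<close>
  differs from \<open>A x0\<close> by less than \<open>1 / (2 * B)\<close>, half of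
  \<open>norm w\<close> is absorbed on the left, which leaves the constant
  \<open>2 * B\<close>.\<close>

lemma inv_linear_bounded_near:
  fixes A :: "'a::real_normed_vector \<Rightarrow> 'b::euclidean_space \<Rightarrow> 'b"
  assumes S: "open S" "x0 \<in> S" and lin: "\<And>x. x \<in> S \<Longrightarrow> linear (A x)" and bij: "\<And>x. x \<in> S \<Longrightarrow> bij (A x)"
    and cont: "\<And>w. continuous_on S (\<lambda>x. A x w)"
  obtains c where "c > 0" "\<forall>\<^sub>F x in nhds x0. x \<in> S \<and> (\<forall>v. norm (inv (A x) v) \<le> c * norm v)"
proof -
  have inj0: "inj (A x0)" using bij[OF S(2)] by (rule bij_is_inj)
  obtain B where B: "B > 0" "\<And>w. norm w \<le> B * norm (A x0 w)"
  proof -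
    obtain e where e: "e > 0" "\<And>w. norm (A x0 w) \<ge> e * norm w"
      using linear_inj_bounded_below_pos[OF lin[OF S(2)] inj0] by blast
    then show ?thesis
      using that[of "1/e"] by (simp add: field_simps)
  qed
  define d where "d = (\<lambda>x. \<Sum>i\<in>Basis. norm (A x i - A x0 i))"
  have "continuous_on S d" unfolding d_def by (intro continuous_intros cont)
  then have "(d \<longlongrightarrow> d x0) (nhds x0)"
    using S by (simp add: continuous_on_eq_continuous_at continuous_at tendsto_at_iff_tendsto_nhds)
  moreover have "d x0 = 0" by (simp add: d_def)
  ultimately have "\<forall>\<^sub>F x in nhds x0. d x < 1 / (2 * B)"
    using B(1) by (simp add: order_tendstoD(2))
  moreover have "\<forall>\<^sub>F x in nhds x0. x \<in> S" using S by (rule eventually_nhds_in_open)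
  ultimately have "\<forall>\<^sub>F x in nhds x0. x \<in> S \<and> (\<forall>v. norm (inv (A x) v) \<le> (2 * B) * norm v)"
  proof eventually_elim
    case (elim x)
    have "norm w \<le> (2 * B) * norm (A x w)" for w
    proof -
      interpret D: linear "\<lambda>w. A x w - A x0 w"
        by (intro linear_compose_sub lin elim S)
      have "norm (A x w - A x0 w) \<le> d x * norm w"
      proof -
        have "A x w - A x0 w = (\<Sum>i\<in>Basis. (w \<bullet> i) *\<^sub>R (A x i - A x0 i))"
          by (subst (1 2) euclidean_representation[of w, symmetric]) (simp only: D.sum D.scale)
        also have "norm \<dots> \<le> (\<Sum>i\<in>Basis. norm w * norm (A x i - A x0 i))"
          by (rule sum_norm_le) (simp add: mult_right_mono Basis_le_norm)
        finally show ?thesis by (simp add: d_def sum_distrib_left mult.commute)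
      qed
      also have "\<dots> \<le> (1 / (2 * B)) * norm w"
        using elim by (intro mult_right_mono) auto
      finally have 1: "norm (A x w - A x0 w) \<le> norm w / (2 * B)" by simp
      have "norm (A x0 w) \<le> norm (A x w) + norm (A x w - A x0 w)"
        by (metis norm_minus_commute norm_triangle_sub)
      then have "norm w \<le> B * (norm (A x w) + norm w / (2 * B))"
        using B 1 by (smt (verit) mult_left_mono)
      then show ?thesis using B(1) by (simp add: field_simps)
    qed
    then show ?case
      using elim bij[of x] by (metis bij_inv_eq_iff)
  qed
  then show ?thesis using that[of "2 * B"] B(1) by simp
qed

text \<open>The derivative of the inverse is minus the derivative of the family, composed with the
  inverse on both sides. It involves the inverse only to the order already known, which carries the
  induction.\<close>

lemma Ck_on_inv_linear:
  fixes A :: "'a::euclidean_space \<Rightarrow> 'b::euclidean_space \<Rightarrow> 'b"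
  assumes S: "open S" and lin: "\<And>x. x \<in> S \<Longrightarrow> linear (A x)" and bij: "\<And>x. x \<in> S \<Longrightarrow> bij (A x)"
    and A: "\<And>w. Ck_on k S (\<lambda>x. A x w)"
  shows "Ck_on k S (\<lambda>x. inv (A x) v)"
proof -
  have linv: "linear (inv (A x))" if "x \<in> S" for x
    by (metis that lin bij linear_injective_left_inverse bij_is_inj inv_unique_comp
        linear_inverse_left bij_is_surj surj_iff)
  have AI: "A x (inv (A x) v) = v" "inv (A x) (A x v) = v" if "x \<in> S" for x v
    using bij[OF that] by (simp_all add: bij_is_surj surj_f_inv_f bij_is_inj)
  have cont: "continuous_on S (\<lambda>x. A x w)" for w using A Ck_on_continuous_on by blast
  \<comment> \<open>Resolvent identity: with \<open>u = inv (A x0) v\<close> one has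
    \<open>inv (A x) v - u = inv (A x) (A x0 u - A x u)\<close>, and the inverses are bounded near
    \<open>x0\<close>.\<close>
  have contI: "((\<lambda>x. inv (A x) v) \<longlongrightarrow> inv (A x0) v) (at x0)" if x0: "x0 \<in> S" for v x0
  proof -
    obtain c where c: "c > 0" "\<forall>\<^sub>F x in nhds x0. x \<in> S \<and> (\<forall>v. norm (inv (A x) v) \<le> c * norm v)"
      using inv_linear_bounded_near[OF S x0 lin bij cont] by blast
    let ?u = "inv (A x0) v"
    have "((\<lambda>x. A x ?u - A x0 ?u) \<longlongrightarrow> 0) (at x0)"
      using cont[of ?u] x0 S by (simp add: continuous_on_eq_continuous_at continuous_at LIM_zero)
    then have "((\<lambda>x. c * norm (A x ?u - A x0 ?u)) \<longlongrightarrow> 0) (at x0)"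
      by (simp add: tendsto_mult_right_zero tendsto_norm_zero)
    moreover have "\<forall>\<^sub>F x in at x0. norm (inv (A x) v - ?u) \<le> c * norm (A x ?u - A x0 ?u)"
      using c(2) unfolding eventually_at_filter
    proof eventually_elim
      case (elim x)
      have "inv (A x) v - ?u = inv (A x) (A x0 ?u - A x ?u)"
        using elim x0 by (simp add: AI linear_diff[OF linv])
      then show ?case using elim by (metis norm_minus_commute)
    qed
    ultimately have "((\<lambda>x. inv (A x) v - ?u) \<longlongrightarrow> 0) (at x0)"
      by (rule Lim_null_comparison[rotated])
    then show ?thesis by (rule LIM_zero_cancel)
  qed
  show ?thesis using A
  proof (induction k arbitrary: v)
    case 0
    show ?case using contI S by (auto simp: continuous_on_eq_continuous_at continuous_at)
  next
    case (Suc k)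
    define D where "D = (\<lambda>x w h. frechet_derivative (\<lambda>x. A x w) (at x) h)"
    have dA: "((\<lambda>x. A x w) has_derivative D x w) (at x)" if "x \<in> S" for x w
      using Ck_on_Suc_has_derivative[OF Suc.prems[of w] that] by (simp add: D_def eta_contract_eq)
    have CD: "Ck_on k S (\<lambda>x. D x w h)" for w h using Suc.prems[of w] by (simp add: D_def)
    \<comment> \<open>Linearity in \<open>w\<close> passes from \<open>A y\<close> to its derivative
      in \<open>y\<close> by uniqueness of derivatives.\<close>
    have linD: "D x (\<Sum>i\<in>Basis. c i *\<^sub>R i) h = (\<Sum>i\<in>Basis. c i *\<^sub>R D x i h)" if "x \<in> S" for x c h
    proof -
      have "((\<lambda>x. \<Sum>i\<in>Basis. c i *\<^sub>R A x i) has_derivative (\<lambda>h. \<Sum>i\<in>Basis. c i *\<^sub>R D x i h)) (at x)"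
        by (intro derivative_intros dA that)
      moreover have "(\<Sum>i\<in>Basis. c i *\<^sub>R A y i) = A y (\<Sum>i\<in>Basis. c i *\<^sub>R i)" if "y \<in> S" for y
        by (simp add: linear_sum[OF lin[OF that]] linear_scale[OF lin[OF that]])
      ultimately have "((\<lambda>x. A x (\<Sum>i\<in>Basis. c i *\<^sub>R i)) has_derivative
          (\<lambda>h. \<Sum>i\<in>Basis. c i *\<^sub>R D x i h)) (at x)"
        by (rule has_derivative_transform_within_open[OF _ S \<open>x \<in> S\<close>])
      from has_derivative_unique[OF this dA[OF that]] show ?thesis by metis
    qed
    have IHk: "Ck_on k S (\<lambda>x. inv (A x) v)" for v
      by (rule Suc.IH) (rule Ck_on_SucD[OF Suc.prems])
    have d: "((\<lambda>x. inv (A x) v) has_derivative (\<lambda>h. - inv (A x) (D x (inv (A x) v) h))) (at x)"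
      if x: "x \<in> S" for x v
    proof -
      let ?u = "inv (A x) v" and ?L = "inv (A x)"
      \<comment> \<open>\<open>?R\<close> is the normalised remainder of \<open>A y ?u\<close>, and
        \<open>?E\<close> the unit direction of the increment. The normalised remainder of the
        inverse is \<open>- inv (A y) (?R y)\<close> minus the effect of
        \<open>inv (A y) - ?L\<close> on \<open>D x ?u (?E y)\<close>.\<close>
      let ?R = "\<lambda>y. (A y ?u - A x ?u - D x ?u (y - x)) /\<^sub>R norm (y - x)"
      let ?E = "\<lambda>y. (y - x) /\<^sub>R norm (y - x)"
      have bl: "bounded_linear (D x ?u)" using dA[OF x] by (rule has_derivative_bounded_linear)
      have blL: "bounded_linear ?L" using linv[OF x] by (simp add: linear_conv_bounded_linear)
      have R: "(?R \<longlongrightarrow> 0) (at x)"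
        using dA[OF x, of ?u] by (simp add: has_derivative_at_within)
      have t1: "((\<lambda>y. inv (A y) (?R y)) \<longlongrightarrow> ?L 0) (at x)"
        by (rule tendsto_linear_family[OF eventually_mono[OF eventually_at_in_open'[OF S x] linv]
              linv[OF x] contI[OF x] R])
      \<comment> \<open>The unit directions need not converge as \<open>y\<close> tends to
        \<open>x\<close>; they stay bounded, so convergence of the inverses on the basis
        suffices.\<close>
      have t2: "((\<lambda>y. inv (A y) (D x ?u (?E y)) - ?L (D x ?u (?E y))) \<longlongrightarrow> 0) (at x)"
      proof -
        have rep: "inv (A y) w - ?L w = (\<Sum>i\<in>Basis. (w \<bullet> i) *\<^sub>R (inv (A y) i - ?L i))" if "y \<in> S" for y w
        proof -
          interpret E: linear "\<lambda>w. inv (A y) w - ?L w"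
            by (intro linear_compose_sub linv x that)
          show ?thesis
            by (subst (1 2) euclidean_representation[of w, symmetric]) (simp only: E.sum E.scale)
        qed
        obtain K where K: "K \<ge> 0" "\<And>w. norm (D x ?u w) \<le> K * norm w"
          using bounded_linear.nonneg_bounded[OF bl] by (auto simp: mult.commute)
        have KE: "norm (D x ?u (?E y)) \<le> K" for y
        proof -
          have "norm (?E y) \<le> 1" by (cases "y = x") auto
          then show ?thesis using K by (smt (verit) mult_left_le)
        qed
        have "((\<lambda>y. \<Sum>i\<in>Basis. K * norm (inv (A y) i - ?L i)) \<longlongrightarrow> (\<Sum>i\<in>(Basis::'b set). K * 0)) (at x)"
          by (intro tendsto_intros tendsto_norm_zero LIM_zero contI x)
        then have "((\<lambda>y. \<Sum>i\<in>Basis. K * norm (inv (A y) i - ?L i)) \<longlongrightarrow> 0) (at x)" by simp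
        moreover have "\<forall>\<^sub>F y in at x. norm (inv (A y) (D x ?u (?E y)) - ?L (D x ?u (?E y)))
            \<le> (\<Sum>i\<in>Basis. K * norm (inv (A y) i - ?L i))"
          using eventually_at_in_open'[OF S x]
        proof eventually_elim
          case (elim y)
          have "norm ((D x ?u (?E y) \<bullet> i) *\<^sub>R (inv (A y) i - ?L i)) \<le> K * norm (inv (A y) i - ?L i)"
            if "i \<in> Basis" for i
            using Basis_le_norm[OF that, of "D x ?u (?E y)"] KE[of y]
            by (simp only: norm_scaleR) (intro mult_right_mono, auto)
          then show ?case by (subst rep[OF elim]) (rule sum_norm_le)
        qed
        ultimately show ?thesis by (rule Lim_null_comparison[rotated])
      qed
      have "((\<lambda>y. - inv (A y) (?R y) - (inv (A y) (D x ?u (?E y)) - ?L (D x ?u (?E y)))) \<longlongrightarrow> 0) (at x)"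
        using tendsto_diff[OF tendsto_minus[OF t1] t2] linear_0[OF linv[OF x]] by simp
      moreover have "\<forall>\<^sub>F y in at x. - inv (A y) (?R y) - (inv (A y) (D x ?u (?E y)) - ?L (D x ?u (?E y)))
          = ((inv (A y) v - ?u) - (- ?L (D x ?u (y - x)))) /\<^sub>R norm (y - x)"
        using eventually_at_in_open'[OF S x]
      proof eventually_elim
        case (elim y)
        note ly = linear_diff[OF linv[OF elim]] linear_scale[OF linv[OF elim]]
          and lx = linear_diff[OF linv[OF x]] linear_scale[OF linv[OF x]]
          and lD = linear_scale[OF bounded_linear.linear[OF bl]]
        define d where "d = y - x"
        show ?case unfolding d_def[symmetric]
          by (simp add: ly lx lD AI elim x scaleR_right_diff_distrib scaleR_right_distrib)
      qed
      ultimately have "((\<lambda>y. ((inv (A y) v - ?u) - (- ?L (D x ?u (y - x)))) /\<^sub>R norm (y - x)) \<longlongrightarrow> 0) (at x)"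
        by (rule Lim_transform_eventually)
      then show ?thesis
        unfolding has_derivative_at_within
        using bounded_linear_minus[OF bounded_linear_compose[OF blL bl]] by simp
    qed
    have "Ck_on k S (\<lambda>x. - inv (A x) (D x (inv (A x) v) h))" for h
    proof -
      let ?c = "\<lambda>x. \<Sum>i\<in>Basis. (inv (A x) v \<bullet> i) *\<^sub>R D x i h"
      have c: "Ck_on k S ?c"
        by (intro Ck_on_sum[OF S] Ck_on_bounded_bilinear[OF S bounded_bilinear_scaleR] CD
            Ck_on_bounded_linear_comp[OF S bounded_linear_inner_left] IHk)
      have "Ck_on k S (\<lambda>x. - (\<Sum>j\<in>Basis. (?c x \<bullet> j) *\<^sub>R inv (A x) j))"
        by (intro Ck_on_bounded_linear_comp[OF S bounded_linear_minus[OF bounded_linear_ident]]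
            Ck_on_sum[OF S] Ck_on_bounded_bilinear[OF S bounded_bilinear_scaleR] IHk
            Ck_on_bounded_linear_comp[OF S bounded_linear_inner_left] c)
      moreover have "- (\<Sum>j\<in>Basis. (?c x \<bullet> j) *\<^sub>R inv (A x) j) = - inv (A x) (D x (inv (A x) v) h)"
        if "x \<in> S" for x
      proof -
        have "D x (inv (A x) v) h = ?c x"
          using linD[OF that, of "\<lambda>i. inv (A x) v \<bullet> i" h] by (simp add: euclidean_representation)
        moreover have "inv (A x) (?c x) = (\<Sum>j\<in>Basis. (?c x \<bullet> j) *\<^sub>R inv (A x) j)"
          by (subst euclidean_representation[of "?c x", symmetric])
            (simp only: linear_sum[OF linv[OF that]] linear_scale[OF linv[OF that]])
        ultimately show ?thesis by simp
      qed
      ultimately show ?thesis by (rule Ck_on_cong[OF S, rotated]) 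
    qed
    then show ?case by (rule Ck_on_SucI[OF S, rotated]) (rule d)
  qed
qed

text \<open>The \<open>C^1\<close> theorem yields an inverse \<open>g\<close> with derivative
  \<open>inv (?D (g y))\<close>. Bootstrapping: if \<open>g\<close> is \<open>C^k\<close>, so is
  this derivative by \<open>Ck_on_inv_linear\<close>, and then \<open>g\<close> is
  \<open>C^(k+1)\<close>.\<close>

theorem smooth_inverse_function:
  fixes f :: "'a::euclidean_space \<Rightarrow> 'a"
  assumes U: "open U" "x0 \<in> U" and f: "smooth_on U f"
    and inj: "\<And>v. frechet_derivative f (at x0) v = 0 \<Longrightarrow> v = 0"
  obtains U' V g where "U' \<subseteq> U" "x0 \<in> U'" "diffeomorphism U' V f g"
proof -
  let ?D = "\<lambda>x. frechet_derivative f (at x)"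
  let ?f' = "\<lambda>x. Blinfun (?D x)"
  have bl: "bounded_linear (?D x)" if "x \<in> U" for x
    using smooth_on_has_derivative[OF f that] by (rule has_derivative_bounded_linear)
  have app: "blinfun_apply (?f' x) = ?D x" if "x \<in> U" for x
    using bl[OF that] by (rule bounded_linear_Blinfun_apply)
  have l0: "linear (?D x0)" using bl[OF U(2)] by (rule bounded_linear.linear)
  have "inj (?D x0)" using inj l0 by (simp add: linear_injective_0)
  then obtain g0 where g0: "linear g0" "g0 \<circ> ?D x0 = id"
    using linear_injective_left_inverse[OF l0] by auto
  have blg: "bounded_linear g0" using g0(1) by (simp add: linear_conv_bounded_linear)
  have inv: "Blinfun g0 o\<^sub>L ?f' x0 = id_blinfun"
    by (rule blinfun_eqI) (use g0(2) in \<open>simp add: app U bounded_linear_Blinfun_apply[OF blg] fun_eq_iff\<close>)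
  have cont: "continuous_on U ?f'"
  proof (rule continuous_on_blinfun_componentwise)
    fix i :: 'a
    show "continuous_on U (\<lambda>x. blinfun_apply (?f' x) i)"
      using smooth_on_continuous_on[OF smooth_on_derivative[OF f, of i]]
      by (rule continuous_on_eq) (simp add: app)
  qed
  have der: "(f has_derivative blinfun_apply (?f' x)) (at x)" if "x \<in> U" for x
    using smooth_on_has_derivative[OF f that] app[OF that] by simp
  obtain U' V g g' where g: "open U'" "U' \<subseteq> U" "x0 \<in> U'" "open V" "homeomorphism U' V f g"
    "\<And>y. y \<in> V \<Longrightarrow> (g has_derivative g' y) (at y)"
    "\<And>y. y \<in> V \<Longrightarrow> g' y = inv (blinfun_apply (?f' (g y)))"
    "\<And>y. y \<in> V \<Longrightarrow> bij (blinfun_apply (?f' (g y)))"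
    using inverse_function_theorem[OF U(1) der cont U(2) inv] by metis
  have gU: "g y \<in> U" if "y \<in> V" for y
    using g(2,5) that by (auto simp: homeomorphism_def)
  have "Ck_on k V g" for k
  proof (induction k)
    case 0
    then show ?case using g(5) by (simp add: homeomorphism_def)
  next
    case (Suc k)
    have "Ck_on k V (\<lambda>y. inv (?D (g y)) v)" for v
    proof (rule Ck_on_inv_linear[OF g(4)])
      show "linear (?D (g y))" if "y \<in> V" for y
        using bl[OF gU[OF that]] by (rule bounded_linear.linear)
      show "bij (?D (g y))" if "y \<in> V" for y
        using g(8)[OF that] app[OF gU[OF that]] by simp
      show "Ck_on k V (\<lambda>y. ?D (g y) w)" for w
        by (rule Ck_on_compose[OF g(4) U(1) smooth_onD[OF smooth_on_derivative[OF f]] Suc gU])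
    qed
    then show ?case
      by (intro Ck_on_SucI[OF g(4), where f'="\<lambda>y. inv (?D (g y))"])
        (use g(6,7) app[OF gU] in metis)+
  qed
  then have "diffeomorphism U' V f g"
    using g smooth_on_subset[OF f g(2)] by (simp add: diffeomorphism_def smooth_on_def)
  then show ?thesis using that g by blast
qed

section \<open>Hadamard's lemma\<close>

text \<open>Differentiation under the integral sign returns an integral of the same kind, with
  \<open>F\<close> replaced by its derivative in the direction \<open>(v, 0)\<close>.\<close>

lemma Ck_on_integral_parameter:
  fixes F :: "'a::euclidean_space \<times> real \<Rightarrow> 'b::euclidean_space"
  assumes "Ck_on k UNIV F"
  shows "Ck_on k UNIV (\<lambda>x. integral {0..1} (\<lambda>t. F (x, t)))"
  using assms
proof (induction k arbitrary: F)
  case 0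
  then show ?case
    by (auto intro!: integral_continuous_on_param[where a="0::real" and b=1, simplified]
        continuous_on_subset[of UNIV F] simp: split_def)
next
  case (Suc k)
  let ?D = "\<lambda>x t. frechet_derivative F (at (x, t))"
  let ?f' = "\<lambda>x t. Blinfun (\<lambda>v. ?D x t (v, 0))"
  have F: "(F has_derivative ?D x t) (at (x, t))" for x t
    using Ck_on_Suc_has_derivative[OF Suc.prems, of "(x, t)"] by simp
  have blD: "bounded_linear (?D x t)" for x t using F by (rule has_derivative_bounded_linear)
  have bl: "bounded_linear (\<lambda>v. ?D x t (v, 0))" for x t
    by (rule bounded_linear_compose[OF blD]) (intro bounded_linear_Pair bounded_linear_ident bounded_linear_zero)
  have app: "blinfun_apply (?f' x t) = (\<lambda>v. ?D x t (v, 0))" for x t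
    using bl by (rule bounded_linear_Blinfun_apply)
  have contF: "continuous_on UNIV F" using Suc.prems by (rule Ck_on_continuous_on)
  have CD: "Ck_on k UNIV (\<lambda>z. frechet_derivative F (at z) v)" for v
    using Suc.prems by (simp only: Ck_on.simps)
  have contD: "continuous_on UNIV (\<lambda>z. case z of (x, t) \<Rightarrow> ?f' x t)"
  proof (rule continuous_on_blinfun_componentwise)
    show "continuous_on UNIV (\<lambda>z. blinfun_apply (case z of (x, t) \<Rightarrow> ?f' x t) i)" for i
      using Ck_on_continuous_on[OF CD[of "(i, 0)"]]
      by (rule continuous_on_eq) (auto simp: app)
  qed
  have contDt: "continuous_on {0..1} (?f' x)" for x
    by (rule continuous_on_compose2[OF contD, where f="\<lambda>t. (x, t)", simplified])
      (intro continuous_intros)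
  have "((\<lambda>x. integral (cbox 0 1) (\<lambda>t. F (x, t))) has_derivative
      blinfun_apply (integral (cbox 0 1) (?f' x))) (at x within UNIV)" for x
  proof (rule leibniz_rule)
    fix x and t :: real
    show "((\<lambda>x. F (x, t)) has_derivative blinfun_apply (?f' x t)) (at x within UNIV)"
      unfolding app
      by (rule has_derivative_compose[of "\<lambda>x. (x, t)" "\<lambda>v. (v, 0)"]) (auto intro!: derivative_eq_intros F)
    show "(\<lambda>t. F (x, t)) integrable_on cbox 0 1"
      by (rule integrable_continuous)
        (auto intro!: continuous_on_compose2[OF contF] continuous_intros)
    show "continuous_on (UNIV \<times> cbox 0 1) (\<lambda>(x, t). ?f' x t)"
      using contD by (rule continuous_on_subset) simp
  qed auto
  moreover have "blinfun_apply (integral (cbox 0 1) (?f' x)) = (\<lambda>v. integral {0..1} (\<lambda>t. ?D x t (v, 0)))" for x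
    using blinfun_apply_integral[of "?f' x" "cbox 0 1"] integrable_continuous_interval[OF contDt[of x]]
    by (simp add: app cbox_interval fun_eq_iff)
  ultimately have d: "((\<lambda>x. integral {0..1} (\<lambda>t. F (x, t))) has_derivative
      (\<lambda>v. integral {0..1} (\<lambda>t. ?D x t (v, 0)))) (at x)" for x
    by (simp add: cbox_interval)
  show ?case
    by (rule Ck_on_SucI[OF open_UNIV d]) (rule Suc.IH[OF CD])
qed

lemma smooth_on_imp_has_real_derivative_snd:
  fixes K :: "'p::real_normed_vector \<times> real \<Rightarrow> real"
  assumes "smooth_on S K" "(p, t) \<in> S"
  shows "((\<lambda>t. K (p, t)) has_real_derivative frechet_derivative K (at (p, t)) (0, 1)) (at t)"
proof -
  interpret bounded_linear "frechet_derivative K (at (p, t))"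
    by (rule has_derivative_bounded_linear[OF smooth_on_has_derivative[OF assms]])
  have "((\<lambda>t. K (p, t)) has_derivative (\<lambda>h. frechet_derivative K (at (p, t)) (0, h))) (at t)"
    by (rule has_derivative_compose[of "\<lambda>t. (p, t)" "\<lambda>h. (0, h)"])
      (auto intro!: derivative_eq_intros smooth_on_has_derivative[OF assms])
  moreover have "frechet_derivative K (at (p, t)) (0, h) = frechet_derivative K (at (p, t)) (0, 1) * h" for h
    using scaleR[of h "(0, 1)"] by (simp add: mult.commute)
  then have "(\<lambda>h. frechet_derivative K (at (p, t)) (0, h)) = (*) (frechet_derivative K (at (p, t)) (0, 1))"
    by (rule ext)
  ultimately show ?thesis by (simp only: has_field_derivative_def)
qed

text \<open>\<open>L\<close> averages the last partial derivative of \<open>K\<close> over the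
  segment from \<open>(p, 0)\<close> to \<open>(p, t)\<close>. Its value at \<open>t = 0\<close> is
  recorded because division by \<open>t\<close> says nothing there; it later controls values and
  supports of quotients.\<close>

theorem hadamard:
  fixes K :: "'p::euclidean_space \<times> real \<Rightarrow> real"
  assumes K: "smooth_on UNIV K" and K0: "\<And>p. K (p, 0) = 0"
  obtains L where "smooth_on UNIV L" "\<And>p t. K (p, t) = t * L (p, t)"
    "\<And>p. L (p, 0) = frechet_derivative K (at (p, 0)) (0, 1)"
proof -
  let ?K' = "\<lambda>z. frechet_derivative K (at z) (0, 1)"
  define L where "L = (\<lambda>z. integral {0..1} (\<lambda>x. ?K' (fst z, x * snd z)))"
  have K': "smooth_on UNIV ?K'" using K by (rule smooth_on_derivative)
  have "smooth_on UNIV (\<lambda>w. ?K' (fst (fst w), snd w * snd (fst w)))"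
    by (rule smooth_on_compose[OF K']) (auto intro!: smooth_intros)
  then have "smooth_on UNIV L" unfolding L_def smooth_on_def
    by (intro allI Ck_on_integral_parameter[where F="\<lambda>w. ?K' (fst (fst w), snd w * snd (fst w))", simplified]) simp
  moreover have "K (p, t) = t * L (p, t)" for p t
  proof -
    have "((\<lambda>x. x * t) has_real_derivative t) (at x)" for x
      using DERIV_cmult_right[OF DERIV_ident, of t x UNIV] by simp
    then have "((\<lambda>x. K (p, x * t)) has_real_derivative ?K' (p, x * t) * t) (at x)" for x
      by (rule DERIV_chain2[OF smooth_on_imp_has_real_derivative_snd[OF K UNIV_I]])
    then have "((\<lambda>x. K (p, x * t)) has_vector_derivative t * ?K' (p, x * t)) (at x within {0..1})" for x
      unfolding has_real_derivative_iff_has_vector_derivative mult.commute[of t]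
      by (rule has_vector_derivative_at_within)
    then have "((\<lambda>x. t * ?K' (p, x * t)) has_integral K (p, 1 * t) - K (p, 0 * t)) {0..1}"
      by (intro fundamental_theorem_of_calculus) auto
    then show ?thesis by (simp add: K0 L_def integral_unique flip: integral_mult_right)
  qed
  moreover have "L (p, 0) = ?K' (p, 0)" for p by (simp add: L_def)
  ultimately show ?thesis using that by blast
qed

section \<open>Smooth cut-off functions\<close>

text \<open>Functions flat at \<open>0\<close>. The powers of \<open>inverse x\<close> make the
  family closed under differentiation up to linear combinations, so one induction treats all
  orders.\<close>

definition flat :: "nat \<Rightarrow> real \<Rightarrow> real" where
  "flat m x = (if 0 < x then inverse x ^ m * exp (- inverse x) else 0)"

lemma flat_over_x_tendsto_0: "((\<lambda>h. flat m h / h) \<longlongrightarrow> 0) (at 0)"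
proof -
  have "((\<lambda>h. inverse h ^ Suc m / exp (inverse h)) \<longlongrightarrow> 0) (at_right (0::real))"
    by (rule filterlim_compose[OF tendsto_power_div_exp_0 filterlim_inverse_at_top_right])
  moreover have "\<forall>\<^sub>F h in at_right (0::real). inverse h ^ Suc m / exp (inverse h) = flat m h / h"
    by (rule eventually_at_rightI[of _ 1]) (auto simp: flat_def exp_minus field_simps)
  ultimately have r: "((\<lambda>h. flat m h / h) \<longlongrightarrow> 0) (at_right 0)" by (rule Lim_transform_eventually)
  have "\<forall>\<^sub>F h in at_left (0::real). 0 = flat m h / h"
    by (rule eventually_at_leftI[of "-1"]) (auto simp: flat_def)
  then have "((\<lambda>h. flat m h / h) \<longlongrightarrow> 0) (at_left 0)"
    by (rule Lim_transform_eventually[OF tendsto_const])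
  then show ?thesis using r by (simp add: filterlim_split_at)
qed

lemma flat_has_real_derivative:
  "(flat m has_real_derivative (flat (m + 2) x - m * flat (m + 1) x)) (at x)"
proof -
  consider "x > 0" | "x = 0" | "x < 0" by linarith
  then show ?thesis
  proof cases
    case 1
    have "((\<lambda>x. inverse x ^ m) has_real_derivative
        real m * (- (inverse x ^ Suc (Suc 0)) * inverse x ^ (m - Suc 0))) (at x)"
      using DERIV_power[OF DERIV_inverse[of x UNIV], of m] 1 by simp
    also have "real m * (- (inverse x ^ Suc (Suc 0)) * inverse x ^ (m - Suc 0)) = - (m * inverse x ^ (m + 1))"
      by (cases m) simp_all
    finally have d1: "((\<lambda>x. inverse x ^ m) has_real_derivative - (m * inverse x ^ (m + 1))) (at x)" .
    have d2: "((\<lambda>x. exp (- inverse x)) has_real_derivative exp (- inverse x) * inverse x ^ 2) (at x)"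
      using 1 by (auto intro!: derivative_eq_intros simp: power2_eq_square field_simps)
    have "((\<lambda>x. inverse x ^ m * exp (- inverse x)) has_real_derivative
        (flat (m + 2) x - m * flat (m + 1) x)) (at x)"
      by (rule DERIV_cong[OF DERIV_mult[OF d1 d2]]) (use 1 in \<open>simp add: flat_def power_add algebra_simps\<close>, simp add: power2_eq_square)
    then show ?thesis
      by (rule has_field_derivative_transform_within_open[of _ _ _ "{0<..}"]) (use 1 in \<open>auto simp: flat_def\<close>)
  next
    case 2
    then show ?thesis
      using flat_over_x_tendsto_0[of m] by (simp add: flat_def DERIV_def)
  next
    case 3
    have "((\<lambda>x. 0) has_real_derivative (flat (m + 2) x - m * flat (m + 1) x)) (at x)"
      using 3 by (simp add: flat_def)
    then show ?thesis
      by (rule has_field_derivative_transform_within_open[of _ _ _ "{..<0}"]) (use 3 in \<open>auto simp: flat_def\<close>)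
  qed
qed

lemma smooth_on_flat: "smooth_on UNIV (flat m)"
proof -
  have "Ck_on k UNIV (flat m)" for k
  proof (induction k arbitrary: m)
    case 0
    show ?case
      using flat_has_real_derivative
      by (auto intro!: continuous_at_imp_continuous_on DERIV_isCont)
  next
    case (Suc k)
    have "Ck_on k UNIV (\<lambda>x. (flat (m + 2) x + - real m * flat (m + 1) x) * v)" for v
      by (intro Ck_on_bounded_bilinear[OF open_UNIV bounded_bilinear_mult] Ck_on_add Suc Ck_on_const open_UNIV)
    then show ?case
      using flat_has_real_derivative[of m]
      by (intro Ck_on_SucI[OF open_UNIV, where f'="\<lambda>x v. (flat (m + 2) x + - real m * flat (m + 1) x) * v"])
        (simp_all only: has_field_derivative_def add_uminus_conv_diff mult_minus_left)
  qed
  then show ?thesis by (simp add: smooth_on_def)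
qed

text \<open>\<open>u\<close> is positive exactly inside the ball of radius \<open>e\<close>,
  \<open>w\<close> exactly outside the closed ball of radius \<open>e / 2\<close>. They have no
  common zero, so \<open>u / (u + w)\<close> is smooth.\<close>

lemma bump_function:
  fixes x0 :: "'a::euclidean_space"
  assumes "e > 0"
  obtains h :: "'a \<Rightarrow> real" where "smooth_on UNIV h"
    "\<And>x. dist x0 x < e / 2 \<Longrightarrow> h x = 1" "\<And>x. dist x0 x \<ge> e \<Longrightarrow> h x = 0"
proof -
  let ?q = "\<lambda>x. (x - x0) \<bullet> (x - x0)"
  define u where "u = (\<lambda>x. flat 0 (e\<^sup>2 - ?q x))"
  define w where "w = (\<lambda>x. flat 0 (?q x - e\<^sup>2 / 4))"
  have q: "?q x = (dist x0 x)\<^sup>2" for x by (simp add: dist_norm power2_norm_eq_inner inner_commute algebra_simps)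
  have su: "smooth_on UNIV u" and sw: "smooth_on UNIV w"
    unfolding u_def w_def
    by (rule smooth_on_compose[OF smooth_on_flat open_UNIV]; intro smooth_intros open_UNIV UNIV_I)+
  have p: "u x + w x > 0" for x
  proof (cases "e\<^sup>2 - ?q x > 0")
    case False
    then have "?q x - e\<^sup>2 / 4 > 0" using zero_less_power[OF assms, of 2] by linarith
    then show ?thesis using False by (simp add: u_def w_def flat_def)
  qed (simp add: u_def w_def flat_def add_pos_nonneg)
  show ?thesis
  proof
    show "smooth_on UNIV (\<lambda>x. u x / (u x + w x))"
      by (intro smooth_on_divide smooth_on_add su sw open_UNIV) (simp add: less_imp_neq[OF p, symmetric])
    show "u x / (u x + w x) = 1" if "dist x0 x < e / 2" for x
    proof -
      have "?q x < (e / 2)\<^sup>2" unfolding q using that by (intro power_strict_mono) auto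
      then have "w x = 0" by (simp add: w_def flat_def power_divide)
      then show ?thesis using p[of x] by simp
    qed
    show "u x / (u x + w x) = 0" if "dist x0 x \<ge> e" for x
    proof -
      have "?q x \<ge> e\<^sup>2" unfolding q using that assms by (intro power_mono) auto
      then show ?thesis by (simp add: u_def flat_def)
    qed
  qed
qed

text \<open>Replaces a germ by a global function of bounded support, the setting in which the series
  of dilates below converge.\<close>

lemma smooth_globalisation:
  fixes x0 :: "'a::euclidean_space" and f :: "'a \<Rightarrow> 'b::real_normed_vector"
  assumes "open S" "x0 \<in> S" "smooth_on S f"
  obtains F e where "smooth_on UNIV F" "\<forall>\<^sub>F x in nhds x0. F x = f x"
    "\<And>x. dist x0 x \<ge> e \<Longrightarrow> F x = 0"
proof -
  obtain e where e: "e > 0" "cball x0 e \<subseteq> S"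
    using assms open_contains_cball by blast
  obtain h :: "'a \<Rightarrow> real" where c: "smooth_on UNIV h"
    "\<And>x. dist x0 x < e / 2 \<Longrightarrow> h x = 1" "\<And>x. dist x0 x \<ge> e \<Longrightarrow> h x = 0"
    using bump_function[OF e(1)] by blast
  define F where "F = (\<lambda>x. h x *\<^sub>R f x)"
  have S: "smooth_on S F" unfolding F_def
    by (intro smooth_intros assms smooth_on_subset[OF c(1)]) auto
  have C: "smooth_on (- cball x0 e) F"
    by (rule smooth_on_cong[of _ "\<lambda>x. 0"]) (auto simp: F_def c(3) intro!: smooth_on_const)
  have "smooth_on UNIV F"
  proof (rule smooth_on_local)
    show "\<exists>U. open U \<and> x \<in> U \<and> smooth_on U F" for x
      by (cases "x \<in> cball x0 e") (use S C e assms(1) in \<open>auto intro: exI[of _ S] exI[of _ "- cball x0 e"]\<close>)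
  qed
  moreover have "\<forall>\<^sub>F x in nhds x0. F x = f x"
    unfolding eventually_nhds_metric
    by (rule exI[of _ "e / 2"]) (use e in \<open>auto simp: F_def c(2) dist_commute\<close>)
  moreover have "F x = 0" if "dist x0 x \<ge> e" for x
    using c(3)[OF that] by (simp add: F_def)
  ultimately show ?thesis using that by blast
qed

section \<open>Coefficients for the extension of smooth functions across a hyperplane\<close>

text \<open>Dominating series for the two-sided sums below; each half-line contributes one geometric
  series.\<close>

lemma has_sum_geometric_int:
  fixes q :: real
  assumes "0 < q" "q < 1"
  shows "((\<lambda>j. q ^ nat \<bar>j\<bar>) has_sum (2 * q / (1 - q))) (- {0::int})"
proof -
  have g: "((\<lambda>n. q ^ Suc n) has_sum (q / (1 - q))) UNIV"
    using sums_mult[OF geometric_sums[of q], of q] assms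
    by (intro norm_summable_imp_has_sum) (auto simp: summable_mult norm_mult norm_power)
  have p: "((\<lambda>j. q ^ nat \<bar>j\<bar>) has_sum (q / (1 - q))) (range (\<lambda>n. int (Suc n)))"
    by (subst has_sum_reindex) (use g in \<open>auto simp: inj_on_def o_def nat_add_distrib\<close>)
  have m: "((\<lambda>j. q ^ nat \<bar>j\<bar>) has_sum (q / (1 - q))) (range (\<lambda>n. - int (Suc n)))"
    by (subst has_sum_reindex) (use g in \<open>auto simp: inj_on_def o_def nat_add_distrib\<close>)
  have d: "range (\<lambda>n. int (Suc n)) \<inter> range (\<lambda>n. - int (Suc n)) = {}" by auto
  have u: "range (\<lambda>n. int (Suc n)) \<union> range (\<lambda>n. - int (Suc n)) = - {0}"
  proof (intro subset_antisym subsetI)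
    fix j :: int assume "j \<in> - {0}"
    then have "j = int (Suc (nat (j - 1))) \<or> j = - int (Suc (nat (- j - 1)))" by auto
    then show "j \<in> range (\<lambda>n. int (Suc n)) \<union> range (\<lambda>n. - int (Suc n))" by blast
  qed auto
  show ?thesis
    using has_sum_Un_disjoint[OF p m d] unfolding u by (simp only: mult_2[of q] add_divide_distrib)
qed

text \<open>The coefficients have to satisfy \<open>\<Sum>\<^sub>j c\<^sub>j q\<^sub>j ^ n = (-1) ^ n\<close> for all \<open>n\<close>. With \<open>q\<^sub>j = 16 ^ j\<close>
  for integers \<open>j\<close>, the values \<open>(-1) ^ j 4 ^ (j (1 - j))\<close> have vanishing moments; after division
  by \<open>1 + q\<^sub>j\<close>, two consecutive moments add up to zero.\<close>

definition theta_term :: "nat \<Rightarrow> int \<Rightarrow> real" where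
  "theta_term n j = (if even j then 1 else -1) * 4 powi (j * (2 * int n + 1 - j))"

text \<open>Completing the square: \<open>(n + 1 - |j|)\<^sup>2 \<ge> 0\<close> bounds the quadratic
  exponent by \<open>(n + 1)\<^sup>2 - |j|\<close>, trading Gaussian for geometric decay.\<close>

lemma abs_theta_term_le: "\<bar>theta_term n j\<bar> \<le> 4 ^ (n + 1)\<^sup>2 * (1 / 4) ^ nat \<bar>j\<bar>"
proof -
  have "j * (2 * int n + 1 - j) \<le> (int n + 1)\<^sup>2 - \<bar>j\<bar>"
  proof -
    have "j * (2 * int n + 1) \<le> \<bar>j\<bar> * (2 * int n + 1)" by (intro mult_right_mono) auto
    moreover have "0 \<le> (int n + 1 - \<bar>j\<bar>)\<^sup>2" by simp
    moreover have "\<bar>j\<bar> * \<bar>j\<bar> = j * j" by simp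
    ultimately show ?thesis by (simp add: power2_eq_square algebra_simps)
  qed
  then have "(4::real) powi (j * (2 * int n + 1 - j)) \<le> 4 powi ((int n + 1)\<^sup>2 - \<bar>j\<bar>)"
    by (intro power_int_increasing) auto
  also have "\<dots> = 4 powi (int ((n + 1)\<^sup>2)) / 4 powi (int (nat \<bar>j\<bar>))"
    by (simp add: power_int_diff algebra_simps)
  also have "\<dots> = 4 ^ (n + 1)\<^sup>2 * (1 / 4) ^ nat \<bar>j\<bar>"
    by (simp only: power_int_of_nat) (simp add: power_divide)
  finally show ?thesis by (simp add: theta_term_def abs_mult)
qed

lemma theta_term_Suc: "theta_term (Suc n) j = 16 powi j * theta_term n j"
proof -
  have "(16::real) powi j = 4 powi (2 * j)"
    by (simp add: power_int_mult)
  moreover have "j * (2 * int (Suc n) + 1 - j) = 2 * j + j * (2 * int n + 1 - j)"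
    by (simp add: algebra_simps)
  ultimately show ?thesis by (simp add: theta_term_def power_int_add)
qed

lemma summable_theta_term_weighted:
  assumes "\<And>j. \<bar>w j\<bar> \<le> (1::real)"
  shows "(\<lambda>j. \<bar>theta_term n j * w j\<bar>) summable_on UNIV"
proof -
  have "(\<lambda>j::int. (1 / 4 :: real) ^ nat \<bar>j\<bar>) summable_on {0} \<union> - {0}"
    by (rule summable_on_Un_disjoint[OF summable_on_finite has_sum_imp_summable[OF has_sum_geometric_int]])
      auto
  then have "(\<lambda>j::int. 4 ^ (n + 1)\<^sup>2 * (1 / 4 :: real) ^ nat \<bar>j\<bar>) summable_on UNIV"
    by (intro summable_on_cmult_right) simp
  moreover have "\<bar>theta_term n j * w j\<bar> \<le> 4 ^ (n + 1)\<^sup>2 * (1 / 4) ^ nat \<bar>j\<bar>" for j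
    using mult_mono[OF abs_theta_term_le assms] by (simp add: abs_mult)
  ultimately show ?thesis by (rule summable_on_comparison_test) auto
qed

text \<open>The reflection \<open>j \<mapsto> 2 n + 1 - j\<close> reverses the sign of the summands.\<close>

lemma infsum_theta_term: "infsum (theta_term n) UNIV = 0"
proof -
  have b: "bij_betw (\<lambda>j. 2 * int n + 1 - j) UNIV UNIV"
    by (rule bij_betw_byWitness[where f'="\<lambda>j. 2 * int n + 1 - j"]) auto
  have "theta_term n (2 * int n + 1 - j) = - theta_term n j" for j
    by (simp add: theta_term_def mult.commute)
  then have "infsum (theta_term n) UNIV = infsum (\<lambda>j. - theta_term n j) UNIV"
    using infsum_reindex_bij_betw[OF b, of "theta_term n"] by simp
  then show ?thesis by (simp add: infsum_uminus)
qed

definition seeley_term :: "nat \<Rightarrow> int \<Rightarrow> real" where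
  "seeley_term n j = theta_term n j * inverse (1 + 16 powi j)"

lemma seeley_weight: "\<bar>inverse (1 + 16 powi j)\<bar> \<le> (1::real)"
proof -
  have "\<bar>inverse (1 + p)\<bar> \<le> (1::real)" if "p > 0" for p using that by (simp add: field_simps)
  then show ?thesis using zero_less_power_int[of "16::real" j] by simp
qed

lemma abs_summable_seeley_term: "(\<lambda>j. \<bar>seeley_term n j\<bar>) summable_on UNIV"
  unfolding seeley_term_def by (rule summable_theta_term_weighted) (rule seeley_weight)

lemma summable_seeley_term: "seeley_term n summable_on UNIV"
  using abs_summable_summable[of "seeley_term n"] abs_summable_seeley_term by simp

lemma seeley_term_eq: "seeley_term n j = seeley_term 0 j * (16 powi j) ^ n"
  by (induction n) (simp_all add: seeley_term_def theta_term_Suc)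

lemma infsum_seeley_term_Suc: "infsum (seeley_term (Suc n)) UNIV = - infsum (seeley_term n) UNIV"
proof -
  have "seeley_term n j + seeley_term (Suc n) j = theta_term n j" for j
  proof -
    have "t * inverse (1 + p) + p * t * inverse (1 + p) = t" if "p > 0" for p t :: real
    proof -
      have "t * inverse (1 + p) + p * t * inverse (1 + p) = t * ((1 + p) * inverse (1 + p))"
        by (simp add: algebra_simps)
      then show ?thesis using that by simp
    qed
    then show ?thesis
      using zero_less_power_int[of "16::real" j] by (simp add: seeley_term_def theta_term_Suc)
  qed
  then have "infsum (theta_term n) UNIV = infsum (seeley_term n) UNIV + infsum (seeley_term (Suc n)) UNIV"
    by (simp flip: infsum_add[OF summable_seeley_term summable_seeley_term])
  then show ?thesis by (simp add: infsum_theta_term)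
qed

text \<open>Allows the zeroth moment to be normalised to \<open>1\<close>. The term at
  \<open>j = 0\<close> is \<open>1 / 2\<close>; the others are at most
  \<open>(1 / 16) ^ |j|\<close>, together at most \<open>2 / 15\<close>. For \<open>j > 0\<close>
  this is due to the weight, for \<open>j < 0\<close> to the theta term.\<close>

lemma infsum_seeley_term_nonzero: "infsum (seeley_term 0) UNIV \<noteq> 0"
proof -
  have le: "\<bar>seeley_term 0 j\<bar> \<le> (1 / 16) ^ nat \<bar>j\<bar>" if "j \<in> - {0}" for j
  proof (cases "j > 0")
    case True
    then have "(4::real) powi (j * (1 - j)) \<le> 4 powi 0"
      by (intro power_int_increasing mult_nonneg_nonpos) auto
    then have "\<bar>theta_term 0 j\<bar> \<le> 1" by (simp add: theta_term_def abs_mult)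
    moreover have "\<bar>inverse (1 + 16 powi j)\<bar> \<le> (1 / 16 :: real) ^ nat \<bar>j\<bar>"
    proof -
      have "inverse (1 + 16 powi j) \<le> inverse (16 powi j :: real)"
        by (intro le_imp_inverse_le) auto
      then show ?thesis using True by (simp add: power_int_def power_divide inverse_eq_divide)
    qed
    ultimately show ?thesis unfolding seeley_term_def abs_mult
      using mult_mono[of "\<bar>theta_term 0 j\<bar>" 1] by fastforce
  next
    case False
    define m where "m = nat (- j - 1)"
    then have j: "j = - int (Suc m)" using False that by auto
    have "j * (1 - j) \<le> 2 * j"
      using mult_right_mono_neg[of 2 "1 - j" j] j by (simp add: mult.commute)
    then have "(4::real) powi (j * (1 - j)) \<le> 4 powi (2 * j)"
      by (intro power_int_increasing) auto
    also have "\<dots> = (1 / 16) ^ nat \<bar>j\<bar>"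
    proof -
      have "(4::real) powi (2 * j) = inverse ((4 powi 2) powi int (Suc m))"
        unfolding j by (simp only: mult_minus_right power_int_minus power_int_mult)
      then show ?thesis unfolding j by (simp add: power_divide inverse_eq_divide power_int_of_nat del: of_nat_Suc)
    qed
    finally have "\<bar>theta_term 0 j\<bar> \<le> (1 / 16) ^ nat \<bar>j\<bar>" by (simp add: theta_term_def abs_mult)
    then show ?thesis unfolding seeley_term_def abs_mult
      using mult_mono[OF _ seeley_weight[of j]] by fastforce
  qed
  have s: "seeley_term 0 summable_on - {0}"
    using summable_seeley_term by (rule summable_on_subset_banach) simp
  have "norm (infsum (seeley_term 0) (- {0})) \<le> 2 * (1 / 16) / (1 - 1 / 16)"
    by (rule norm_infsum_le[OF has_sum_infsum[OF s] has_sum_geometric_int]) (auto simp: le)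
  moreover have "infsum (seeley_term 0) ({0} \<union> - {0}) = 1 / 2 + infsum (seeley_term 0) (- {0})"
    by (subst infsum_Un_disjoint) (use s in \<open>auto simp: seeley_term_def theta_term_def\<close>)
  ultimately show ?thesis by auto
qed

text \<open>For a function \<open>F\<close> of \<open>y = t\<^sup>2\<close>, each
  \<open>y\<close>-derivative of the dilate \<open>F (- (\<mu> k)\<^sup>2 * y)\<close> produces a
  factor \<open>- (\<mu> k)\<^sup>2\<close>; moments equal to \<open>1\<close> make all derivatives
  of the combination agree with those of \<open>F\<close> at \<open>y = 0\<close>. Here
  \<open>(\<mu> k)\<^sup>2 = 16 powi j\<close>, with the integers \<open>j\<close> enumerated by
  \<open>int_decode\<close>.\<close>

theorem seeley_coefficients:
  obtains a \<mu> :: "nat \<Rightarrow> real"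
  where "\<And>k. \<mu> k > 0" "\<And>n. summable (\<lambda>k. \<bar>a k\<bar> * \<mu> k ^ n)"
    "\<And>n. (\<Sum>k. a k * (- (\<mu> k)\<^sup>2) ^ n) = 1"
proof -
  let ?S = "infsum (seeley_term 0) UNIV"
  define a where "a = (\<lambda>k. seeley_term 0 (int_decode k) / ?S)"
  define \<mu> where "\<mu> = (\<lambda>k. (4::real) powi int_decode k)"
  have pos: "\<mu> k > 0" for k by (simp add: \<mu>_def)
  have sq: "(\<mu> k)\<^sup>2 = 16 powi int_decode k" for k
    by (simp add: \<mu>_def power2_eq_square flip: power_int_mult_distrib)
  have bij: "bij_betw int_decode UNIV UNIV" by (rule bij_int_decode)
  have a: "a k * ((\<mu> k)\<^sup>2) ^ n = seeley_term n (int_decode k) / ?S" for k n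
    by (simp add: a_def sq seeley_term_eq[of n])
  have abs_eq: "\<bar>a k\<bar> * ((\<mu> k)\<^sup>2) ^ n = \<bar>seeley_term n (int_decode k)\<bar> * (1 / \<bar>?S\<bar>)" for k n
    using arg_cong[OF a[of k n], of abs] pos[of k] by (simp add: abs_mult abs_divide)
  have sum2: "summable (\<lambda>k. \<bar>a k\<bar> * ((\<mu> k)\<^sup>2) ^ n)" for n
  proof -
    have "(\<lambda>k. \<bar>seeley_term n (int_decode k)\<bar>) summable_on UNIV"
      using summable_on_reindex_bij_betw[OF bij, of "\<lambda>j. \<bar>seeley_term n j\<bar>"]
        abs_summable_seeley_term[of n] by simp
    then show ?thesis unfolding abs_eq by (intro summable_mult2 summable_on_imp_summable)
  qed
  have "summable (\<lambda>k. \<bar>a k\<bar> * \<mu> k ^ n)" for n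
  proof (rule summable_comparison_test')
    show "summable (\<lambda>k. \<bar>a k\<bar> * ((\<mu> k)\<^sup>2) ^ 0 + \<bar>a k\<bar> * ((\<mu> k)\<^sup>2) ^ n)"
      by (intro summable_add sum2)
    fix k :: nat
    \<comment> \<open>Arbitrary powers of \<open>\<mu> k\<close> are dominated by even ones, whose
      summability is \<open>sum2\<close>.\<close>
    have "\<mu> k ^ n \<le> 1 + (\<mu> k ^ n)\<^sup>2"
      using zero_le_power2[of "\<mu> k ^ n - 1"] zero_less_power[OF pos, of k n]
      unfolding power2_diff power_one mult_1_right by linarith
    then show "norm (\<bar>a k\<bar> * \<mu> k ^ n) \<le> \<bar>a k\<bar> * ((\<mu> k)\<^sup>2) ^ 0 + \<bar>a k\<bar> * ((\<mu> k)\<^sup>2) ^ n"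
      using mult_left_mono[of "\<mu> k ^ n" "1 + (\<mu> k ^ n)\<^sup>2" "\<bar>a k\<bar>"] pos[of k]
      by (simp add: abs_mult distrib_left power_mult[symmetric] mult.commute[of 2])
  qed
  moreover have "(\<Sum>k. a k * (- (\<mu> k)\<^sup>2) ^ n) = 1" for n
  proof -
    have "infsum (seeley_term n) UNIV = (- 1) ^ n * ?S"
      by (induction n) (simp_all add: infsum_seeley_term_Suc)
    then have "((\<lambda>k. seeley_term n (int_decode k)) has_sum (- 1) ^ n * ?S) UNIV"
      using has_sum_reindex_bij_betw[OF bij, of "seeley_term n"] has_sum_infsum[OF summable_seeley_term[of n]]
      by simp
    then have "(\<lambda>k. (- 1) ^ n / ?S * seeley_term n (int_decode k)) sums ((- 1) ^ n / ?S * ((- 1) ^ n * ?S))"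
      by (intro sums_mult has_sum_imp_sums)
    moreover have "(- 1) ^ n / ?S * seeley_term n (int_decode k) = a k * (- (\<mu> k)\<^sup>2) ^ n" for k
    proof -
      have "a k * (- (\<mu> k)\<^sup>2) ^ n = (- 1) ^ n * (a k * ((\<mu> k)\<^sup>2) ^ n)"
        by (simp add: power_minus[of "(\<mu> k)\<^sup>2"])
      then show ?thesis unfolding a by simp
    qed
    ultimately show ?thesis
      using infsum_seeley_term_nonzero by (simp add: sums_iff flip: power_mult_distrib)
  qed
  ultimately show ?thesis using that pos by blast
qed

section \<open>Smooth even functions as functions of the square\<close>

text \<open>Weierstrass test for the derivatives: the tails of \<open>M\<close> bound the tails of
  \<open>f'\<close> uniformly in \<open>x\<close>.\<close>

lemma has_derivative_suminf:
  fixes f :: "nat \<Rightarrow> 'a::real_normed_vector \<Rightarrow> 'b::banach"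
  assumes f: "\<And>n x. (f n has_derivative f' n x) (at x)"
    and b: "\<And>n x h. norm (f' n x h) \<le> M n * norm h" and M: "summable M"
    and s: "\<And>x. summable (\<lambda>n. f n x)"
  shows "((\<lambda>x. \<Sum>n. f n x) has_derivative (\<lambda>h. \<Sum>n. f' n x h)) (at x)"
proof -
  have sf': "summable (\<lambda>n. f' n x h)" for x h
    by (rule summable_comparison_test'[OF summable_mult2[OF M] b])
  have "\<exists>g. \<forall>x\<in>UNIV. (\<lambda>n. f n x) sums g x \<and> (g has_derivative (\<lambda>h. \<Sum>n. f' n x h)) (at x within UNIV)"
  proof (rule has_derivative_series[where x=x and l="\<Sum>n. f n x"])
    fix e :: real assume "e > 0"
    then obtain N where N: "\<And>n. n \<ge> N \<Longrightarrow> norm (\<Sum>i. M (i + n)) < e"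
      using suminf_exist_split[OF _ M] by blast
    have "norm ((\<Sum>i<n. f' i x h) - (\<Sum>n. f' n x h)) \<le> e * norm h" if "n \<ge> N" for n x h
    proof -
      have sM: "summable (\<lambda>i. M (i + n) * norm h)"
        by (intro summable_mult2 summable_ignore_initial_segment M)
      have "norm ((\<Sum>i<n. f' i x h) - (\<Sum>n. f' n x h)) = norm (\<Sum>i. f' (i + n) x h)"
        by (simp add: suminf_minus_initial_segment[OF sf'] norm_minus_commute)
      also have "\<dots> \<le> (\<Sum>i. M (i + n) * norm h)"
        by (rule norm_suminf_le[OF b sM])
      also have "\<dots> = (\<Sum>i. M (i + n)) * norm h"
        by (rule suminf_mult2[symmetric]) (rule summable_ignore_initial_segment[OF M])
      also have "\<dots> \<le> e * norm h"
        using N[OF that] by (intro mult_right_mono) auto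
      finally show ?thesis .
    qed
    then show "\<forall>\<^sub>F n in sequentially. \<forall>x\<in>UNIV. \<forall>h. norm ((\<Sum>i<n. f' i x h) - (\<Sum>n. f' n x h)) \<le> e * norm h"
      unfolding eventually_sequentially by blast
  qed (use f s in \<open>auto simp: summable_sums\<close>)
  then obtain g where g: "\<And>x. (\<lambda>n. f n x) sums g x" "\<And>x. (g has_derivative (\<lambda>h. \<Sum>n. f' n x h)) (at x)"
    by auto
  then have "g = (\<lambda>x. \<Sum>n. f n x)" by (auto simp: sums_iff)
  then show ?thesis using g(2) by simp
qed

text \<open>On Euclidean spaces this means compact support. A radius is convenient because
  derivatives and the reflection in the last variable vanish outside the same ball.\<close>

definition bounded_support :: "('a::real_normed_vector \<Rightarrow> 'b::real_normed_vector) \<Rightarrow> bool" where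
  "bounded_support f \<longleftrightarrow> (\<exists>R. \<forall>x. norm x > R \<longrightarrow> f x = 0)"

lemma bounded_support_derivative:
  assumes "bounded_support f"
  shows "bounded_support (\<lambda>x. frechet_derivative f (at x) v)"
proof -
  obtain R where R: "\<And>x. norm x > R \<Longrightarrow> f x = 0" using assms by (auto simp: bounded_support_def)
  have o: "open {x::'a. norm x > R}" by (intro open_Collect_less continuous_intros)
  have "frechet_derivative f (at x) v = 0" if "norm x > R" for x
  proof -
    have "(f has_derivative (\<lambda>h. 0)) (at x)"
      by (rule has_derivative_transform_within_open[OF _ o]) (use that R in auto)
    then show ?thesis by (metis frechet_derivative_at)
  qed
  then show ?thesis by (auto simp: bounded_support_def)
qed

lemma bounded_support_imp_bounded:
  fixes f :: "'a::euclidean_space \<Rightarrow> 'b::real_normed_vector"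
  assumes "bounded_support f" "continuous_on UNIV f"
  obtains M where "M \<ge> 0" "\<And>x. norm (f x) \<le> M"
proof -
  obtain R where R: "\<And>x. norm x > R \<Longrightarrow> f x = 0" using assms by (auto simp: bounded_support_def)
  have "bounded (f ` cball 0 R)"
    by (intro compact_imp_bounded compact_continuous_image continuous_on_subset[OF assms(2)]) auto
  then obtain M where M: "\<forall>x\<in>cball 0 R. norm (f x) \<le> M" by (auto simp: bounded_iff)
  have "norm (f x) \<le> max M 0" for x
  proof (cases "norm x > R")
    case False
    then have "norm (f x) \<le> M" using M by simp
    then show ?thesis by simp
  qed (simp add: R)
  then show ?thesis using that[of "max M 0"] by auto
qed

lemma bounded_support_derivative_bounded:
  fixes f :: "'a::euclidean_space \<Rightarrow> 'b::real_normed_vector"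
  assumes "bounded_support f" "smooth_on UNIV f"
  obtains M where "M \<ge> 0" "\<And>x v. norm (frechet_derivative f (at x) v) \<le> M * norm v"
proof -
  let ?D = "\<lambda>x. frechet_derivative f (at x)"
  have "\<exists>M\<ge>0. \<forall>x. norm (?D x i) \<le> M" for i
    using bounded_support_imp_bounded[OF bounded_support_derivative[OF assms(1)]
        smooth_on_continuous_on[OF smooth_on_derivative[OF assms(2)]]] by metis
  then obtain M where M: "\<And>i. M i \<ge> 0" "\<And>i x. norm (?D x i) \<le> M i" by metis
  have "norm (?D x v) \<le> (\<Sum>i\<in>Basis. M i) * norm v" for x v
  proof -
    interpret linear "?D x"
      using smooth_on_has_derivative[OF assms(2), of x] by (auto dest: has_derivative_linear)
    have "?D x v = (\<Sum>i\<in>Basis. (v \<bullet> i) *\<^sub>R ?D x i)"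
      by (subst euclidean_representation[of v, symmetric]) (simp only: sum scale)
    also have "norm \<dots> \<le> (\<Sum>i\<in>Basis. norm v * M i)"
      by (rule sum_norm_le) (use M in \<open>auto intro!: mult_mono Basis_le_norm\<close>)
    finally show ?thesis by (simp only: sum_distrib_right mult.commute[of "norm v"])
  qed
  then show ?thesis using that[of "\<Sum>i\<in>Basis. M i"] M(1) by (auto simp: sum_nonneg)
qed

section \<open>Series of dilates in the last variable\<close>

locale dilations =
  fixes \<mu> :: "nat \<Rightarrow> real"
  assumes mu_pos: "\<mu> k > 0"
begin

text \<open>Every derivative in the last variable brings out a factor \<open>\<mu> k\<close>, so the
  coefficients have to be summable against all powers.\<close>

definition rapid :: "(nat \<Rightarrow> real) \<Rightarrow> bool" where
  "rapid b \<longleftrightarrow> (\<forall>m. summable (\<lambda>k. \<bar>b k\<bar> * \<mu> k ^ m))"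

definition dil_sum :: "(nat \<Rightarrow> real) \<Rightarrow> ('p::euclidean_space \<times> real \<Rightarrow> real) \<Rightarrow> 'p \<times> real \<Rightarrow> real" where
  "dil_sum b G z = (\<Sum>k. b k * G (fst z, \<mu> k * snd z))"

lemma rapid_mult: "rapid b \<Longrightarrow> rapid (\<lambda>k. b k * \<mu> k)"
  unfolding rapid_def
proof
  fix m assume "\<forall>m. summable (\<lambda>k. \<bar>b k\<bar> * \<mu> k ^ m)"
  then have "summable (\<lambda>k. \<bar>b k\<bar> * \<mu> k ^ Suc m)" by blast
  then show "summable (\<lambda>k. \<bar>b k * \<mu> k\<bar> * \<mu> k ^ m)"
    using mu_pos by (simp add: abs_mult abs_of_pos mult_ac)
qed

lemma summable_dil_sum:
  fixes G :: "'p::euclidean_space \<times> real \<Rightarrow> real"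
  assumes "rapid b" "bounded_support G" "smooth_on UNIV G"
  shows "summable (\<lambda>k. b k * G (p k, t k))"
proof -
  obtain M where M: "M \<ge> 0" "\<And>x. norm (G x) \<le> M"
    using bounded_support_imp_bounded[OF assms(2) smooth_on_continuous_on[OF assms(3)]] by blast
  have "summable (\<lambda>k. \<bar>b k\<bar> * \<mu> k ^ 0 * M)"
    using assms(1) unfolding rapid_def by (intro summable_mult2) blast
  then show ?thesis
    by (rule summable_comparison_test') (use M in \<open>auto simp: abs_mult intro!: mult_left_mono\<close>)
qed

text \<open>The derivative consists of series of the same kind: parameter directions keep the
  coefficients, the last direction multiplies them by \<open>\<mu> k\<close>. Termwise
  differentiation is justified by bounds with \<open>\<mu> k ^ 0\<close> and
  \<open>\<mu> k ^ 1\<close>, summable by \<open>rapid\<close>.\<close>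

lemma dil_sum_has_derivative:
  fixes G :: "'p::euclidean_space \<times> real \<Rightarrow> real"
  assumes b: "rapid b" and G: "bounded_support G" "smooth_on UNIV G"
  shows "(dil_sum b G has_derivative (\<lambda>h. dil_sum b (\<lambda>z. frechet_derivative G (at z) (fst h, 0)) z +
    snd h * dil_sum (\<lambda>k. b k * \<mu> k) (\<lambda>z. frechet_derivative G (at z) (0, 1)) z)) (at z)"
proof -
  let ?D = "\<lambda>z. frechet_derivative G (at z)"
  obtain M where M: "M \<ge> 0" "\<And>x v. norm (?D x v) \<le> M * norm v"
    using bounded_support_derivative_bounded[OF G] by blast
  have blD: "bounded_linear (?D z)" for z
    by (rule has_derivative_bounded_linear[OF smooth_on_has_derivative[OF G(2) UNIV_I]])
  have d: "((\<lambda>z. b k * G (fst z, \<mu> k * snd z)) has_derivative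
      (\<lambda>h. b k * ?D (fst z, \<mu> k * snd z) (fst h, \<mu> k * snd h))) (at z)" for k z
  proof -
    have "((\<lambda>z. (fst z, \<mu> k * snd z)) has_derivative (\<lambda>h. (fst h, \<mu> k * snd h))) (at z)"
      by (auto intro!: derivative_eq_intros)
    from has_derivative_compose[OF this smooth_on_has_derivative[OF G(2) UNIV_I]]
    show ?thesis by (rule has_derivative_mult_right)
  qed
  have bound: "norm (b k * ?D (fst z, \<mu> k * snd z) (fst h, \<mu> k * snd h))
      \<le> (\<bar>b k\<bar> * \<mu> k ^ 0 * M + \<bar>b k\<bar> * \<mu> k ^ 1 * M) * norm h" for k z and h :: "'p \<times> real"
  proof -
    have "norm (fst h, \<mu> k * snd h) \<le> norm (fst h) + norm (\<mu> k * snd h)" by (rule norm_Pair_le)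
    also have "\<dots> \<le> norm h + \<mu> k * norm h"
      using mu_pos[of k] norm_fst_le[of "fst h" "snd h"] norm_snd_le[of "snd h" "fst h"]
      by (auto simp: abs_mult intro!: add_mono mult_left_mono)
    finally have "M * norm (fst h, \<mu> k * snd h) \<le> M * (norm h + \<mu> k * norm h)"
      using M(1) by (rule mult_left_mono)
    then have "norm (?D (fst z, \<mu> k * snd z) (fst h, \<mu> k * snd h)) \<le> M * (norm h + \<mu> k * norm h)"
      using M(2) order_trans by blast
    then have "\<bar>b k\<bar> * norm (?D (fst z, \<mu> k * snd z) (fst h, \<mu> k * snd h)) \<le> \<bar>b k\<bar> * (M * (norm h + \<mu> k * norm h))"
      by (rule mult_left_mono) simp
    then show ?thesis by (simp add: abs_mult algebra_simps)
  qed
  have "((\<lambda>z. \<Sum>k. b k * G (fst z, \<mu> k * snd z)) has_derivative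
      (\<lambda>h. \<Sum>k. b k * ?D (fst z, \<mu> k * snd z) (fst h, \<mu> k * snd h))) (at z)"
  proof (rule has_derivative_suminf[OF d bound])
    show "summable (\<lambda>k. \<bar>b k\<bar> * \<mu> k ^ 0 * M + \<bar>b k\<bar> * \<mu> k ^ 1 * M)"
      using b unfolding rapid_def by (intro summable_add summable_mult2) blast+
  qed (rule summable_dil_sum[OF b G])
  moreover have "(\<Sum>k. b k * ?D (fst z, \<mu> k * snd z) (fst h, \<mu> k * snd h)) =
      dil_sum b (\<lambda>z. ?D z (fst h, 0)) z + snd h * dil_sum (\<lambda>k. b k * \<mu> k) (\<lambda>z. ?D z (0, 1)) z" for h
  proof -
    note sD = bounded_support_derivative[OF G(1)] smooth_on_derivative[OF G(2)]
    have eq: "b k * ?D (fst z, \<mu> k * snd z) (fst h, \<mu> k * snd h) =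
        b k * ?D (fst z, \<mu> k * snd z) (fst h, 0) + snd h * (b k * \<mu> k * ?D (fst z, \<mu> k * snd z) (0, 1))" for k
    proof -
      interpret linear "?D (fst z, \<mu> k * snd z)" using blD by (rule bounded_linear.linear)
      have "?D (fst z, \<mu> k * snd z) (fst h, \<mu> k * snd h)
        = ?D (fst z, \<mu> k * snd z) (fst h, 0) + (\<mu> k * snd h) * ?D (fst z, \<mu> k * snd z) (0, 1)"
        using add[of "(fst h, 0)" "(\<mu> k * snd h) *\<^sub>R (0, 1)"] scale[of "\<mu> k * snd h" "(0, 1)"] by simp
      then show ?thesis by (simp add: algebra_simps)
    qed
    show ?thesis
      unfolding eq dil_sum_def
      by (rule sums_unique[symmetric], intro sums_add sums_mult summable_sums)
        (rule summable_dil_sum[OF b sD], rule summable_dil_sum[OF rapid_mult[OF b] sD])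
  qed
  ultimately show ?thesis by (simp add: dil_sum_def[abs_def])
qed

lemma smooth_on_dil_sum:
  assumes "rapid b" "bounded_support G" "smooth_on UNIV G"
  shows "smooth_on UNIV (dil_sum b G)"
proof -
  have "Ck_on k UNIV (dil_sum b G)" for k
    using assms
  proof (induction k arbitrary: b G)
    case 0
    show ?case
      using dil_sum_has_derivative[OF 0]
      by (auto intro!: continuous_at_imp_continuous_on has_derivative_continuous)
  next
    case (Suc k)
    note sD = bounded_support_derivative[OF Suc.prems(2)] smooth_on_derivative[OF Suc.prems(3)]
    show ?case
      by (rule Ck_on_SucI[OF open_UNIV dil_sum_has_derivative[OF Suc.prems]])
        (intro Ck_on_add Ck_on_bounded_bilinear[OF _ bounded_bilinear_mult] Ck_on_const open_UNIV
          Suc.IH rapid_mult Suc.prems sD)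
  qed
  then show ?thesis by (simp add: smooth_on_def)
qed

end

section \<open>Even functions of the last variable\<close>

lemma bounded_supportE:
  assumes "bounded_support f"
  obtains R where "\<And>x. norm x > R \<Longrightarrow> f x = 0"
  using assms by (auto simp: bounded_support_def)

lemma bounded_supportI: "(\<And>x. norm x > R \<Longrightarrow> f x = 0) \<Longrightarrow> bounded_support f"
  by (auto simp: bounded_support_def)

definition even_snd :: "('p \<times> real \<Rightarrow> real) \<Rightarrow> bool" where
  "even_snd G \<longleftrightarrow> (\<forall>p t. G (p, - t) = G (p, t))"

definition even_class :: "('p::euclidean_space \<times> real \<Rightarrow> real) \<Rightarrow> bool" where
  "even_class G \<longleftrightarrow> smooth_on UNIV G \<and> bounded_support G \<and> even_snd G"

lemma frechet_derivative_reflect: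
  fixes G :: "'p::euclidean_space \<times> real \<Rightarrow> real"
  assumes "smooth_on UNIV G" "even_snd G"
  shows "frechet_derivative G (at (p, - t)) (v, h) = frechet_derivative G (at (p, t)) (v, - h)"
proof -
  have "((\<lambda>z. (fst z, - snd z)) has_derivative (\<lambda>h. (fst h, - snd h))) (at (p, t))"
    by (auto intro!: derivative_eq_intros)
  from has_derivative_compose[OF this smooth_on_has_derivative[OF assms(1) UNIV_I]]
  have "((\<lambda>z. G (fst z, - snd z)) has_derivative
      (\<lambda>h. frechet_derivative G (at (p, - t)) (fst h, - snd h))) (at (p, t))" by simp
  moreover have "(\<lambda>z. G (fst z, - snd z)) = G"
    using assms(2) by (auto simp: even_snd_def fun_eq_iff)
  ultimately have "(G has_derivative (\<lambda>h. frechet_derivative G (at (p, - t)) (fst h, - snd h))) (at (p, t))"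
    by simp
  from fun_cong[OF has_derivative_unique[OF this smooth_on_has_derivative[OF assms(1) UNIV_I]], of "(v, - h)"]
  show ?thesis by simp
qed

lemma even_class_derivative_fst:
  assumes "even_class G"
  shows "even_class (\<lambda>z. frechet_derivative G (at z) (v, 0))"
  using assms frechet_derivative_reflect[of G _ _ v 0]
  by (auto simp: even_class_def smooth_on_derivative bounded_support_derivative even_snd_def)

text \<open>The last partial derivative of an even function is odd, hence divisible by
  \<open>t\<close> with even quotient. The factor \<open>2 * t\<close> is \<open>dy/dt\<close> for
  \<open>y = t\<^sup>2\<close>, so \<open>H\<close> represents the \<open>y\<close>-derivative of
  \<open>G\<close> and stays in the class.\<close>

lemma even_class_derivative_snd:
  assumes "even_class G"
  obtains H where "even_class H"
    "\<And>p t. frechet_derivative G (at (p, t)) (0, 1) = 2 * t * H (p, t)"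
proof -
  let ?K = "\<lambda>z. frechet_derivative G (at z) (0, 1)"
  have G: "smooth_on UNIV G" "bounded_support G" "even_snd G"
    using assms by (auto simp: even_class_def)
  have odd: "?K (p, - t) = - ?K (p, t)" for p t
  proof -
    interpret linear "frechet_derivative G (at (p, t))"
      using smooth_on_has_derivative[OF G(1), of "(p, t)"] by (auto dest: has_derivative_linear)
    show ?thesis using frechet_derivative_reflect[OF G(1,3), of p t 0 1] neg[of "(0, 1)"] by simp
  qed
  have K: "smooth_on UNIV ?K" using G(1) by (rule smooth_on_derivative)
  have K0: "?K (p, 0) = 0" for p using odd[of p 0] by simp
  obtain L where L: "smooth_on UNIV L" "\<And>p t. ?K (p, t) = t * L (p, t)"
    "\<And>p. L (p, 0) = frechet_derivative ?K (at (p, 0)) (0, 1)"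
    by (rule hadamard[OF K K0]) blast
  obtain R where R: "\<And>z. norm z > R \<Longrightarrow> ?K z = 0"
    using bounded_supportE[OF bounded_support_derivative[OF G(2)]] by blast
  obtain R' where R': "\<And>z. norm z > R' \<Longrightarrow> frechet_derivative ?K (at z) (0, 1) = 0"
    using bounded_supportE[OF bounded_support_derivative[OF bounded_support_derivative[OF G(2)]]] by blast
  \<comment> \<open>Off \<open>t = 0\<close> the quotient vanishes with its numerator; on
    \<open>t = 0\<close> its value is a second derivative of \<open>G\<close>, which also vanishes
    far out.\<close>
  have "L (p, t) = 0" if "norm (p, t) > max R R'" for p t
    using L(2)[of p t] L(3)[of p] R[of "(p, t)"] R'[of "(p, t)"] that by (cases "t = 0") auto
  then have "bounded_support L" unfolding bounded_support_def split_paired_All by blast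
  moreover have "L (p, - t) = L (p, t)" for p t
    using L(2)[of p t] L(2)[of p "- t"] odd[of p t] by (cases "t = 0") auto
  ultimately have "even_class (\<lambda>z. L z / 2)"
    unfolding even_class_def even_snd_def bounded_support_def
    using smooth_on_bounded_linear_comp[OF bounded_linear_divide open_UNIV L(1)] by auto
  then show ?thesis using L(2) that[of "\<lambda>z. L z / 2"] by simp
qed

text \<open>The fundamental theorem of calculus tolerates one exceptional point: \<open>g\<close> is
  a primitive of the continuous \<open>g'\<close> across \<open>0\<close>.\<close>

lemma has_real_derivative_at_0_from_limit:
  fixes g :: "real \<Rightarrow> real"
  assumes g: "continuous_on UNIV g" and g': "continuous_on UNIV g'"
    and d: "\<And>y. y \<noteq> 0 \<Longrightarrow> (g has_real_derivative g' y) (at y)"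
  shows "(g has_real_derivative g' 0) (at 0)"
proof -
  have ftc: "(g' has_integral (g y - g (- 1))) {- 1..y}" if "- 1 \<le> y" for y
    by (rule fundamental_theorem_of_calculus_interior_strong[of "{0}"])
      (use d that continuous_on_subset[OF g] in \<open>auto simp: has_real_derivative_iff_has_vector_derivative\<close>)
  have "((\<lambda>y. integral {- 1..y} g') has_real_derivative g' 0) (at 0 within {- 1..1})"
    by (intro integral_has_real_derivative continuous_on_subset[OF g']) auto
  then have "((\<lambda>y. g (- 1) + integral {- 1..y} g') has_real_derivative g' 0) (at 0 within {- 1<..<1})"
    by (auto intro!: derivative_eq_intros elim: DERIV_subset)
  then have "((\<lambda>y. g (- 1) + integral {- 1..y} g') has_real_derivative g' 0) (at 0)"
    by (simp add: at_within_open[of 0 "{- 1<..<1}"])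
  then show ?thesis
    by (rule has_field_derivative_transform_within_open[of _ _ _ "{- 1<..<1}"])
      (auto simp: integral_unique[OF ftc])
qed

locale seeley = dilations +
  fixes a :: "nat \<Rightarrow> real"
  assumes a_rapid: "rapid a" and a_moments: "(\<Sum>k. a k * (- (\<mu> k)\<^sup>2) ^ n) = 1"
begin

text \<open>The coefficients of the reflected half after \<open>n\<close> derivatives in
  \<open>y = t\<^sup>2\<close>.\<close>

definition weight :: "nat \<Rightarrow> nat \<Rightarrow> real" where
  "weight n k = a k * (- (\<mu> k)\<^sup>2) ^ n"

lemma rapid_weight: "rapid (weight n)"
proof (induction n)
  case 0
  then show ?case using a_rapid by (simp add: weight_def)
next
  case (Suc n)
  from rapid_mult[OF rapid_mult[OF Suc]]
  show ?case by (simp add: rapid_def weight_def abs_mult power2_eq_square mult_ac)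
qed

text \<open>For \<open>y < 0\<close> this is Seeley's extension of \<open>G (p, \<surd>y)\<close>. The index \<open>n\<close> counts the derivatives in
  \<open>y\<close>: if \<open>\<partial>\<^sub>t G = 2 t H\<close>, then \<open>\<partial>\<^sub>y (fold_sqrt n G) = fold_sqrt (Suc n) H\<close>.\<close>

definition fold_sqrt :: "nat \<Rightarrow> ('p::euclidean_space \<times> real \<Rightarrow> real) \<Rightarrow> 'p \<times> real \<Rightarrow> real" where
  "fold_sqrt n G z = (if 0 \<le> snd z then G (fst z, sqrt (snd z))
     else dil_sum (weight n) G (fst z, sqrt (- snd z)))"

text \<open>All dilates take the same value on the hyperplane, so only the sum of the weights
  counts, and that is a moment of \<open>a\<close>. This joins the two halves of
  \<open>fold_sqrt n\<close> continuously for every \<open>n\<close>.\<close>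

lemma dil_sum_weight_0: "dil_sum (weight n) G (p, 0) = G (p, 0)"
proof -
  have "summable (\<lambda>k. weight n k)"
    using rapid_weight[of n, unfolded rapid_def, rule_format, of 0]
    by (simp add: summable_rabs_cancel)
  then have "(\<Sum>k. weight n k * G (p, 0)) = (\<Sum>k. weight n k) * G (p, 0)"
    by (rule suminf_mult2[symmetric])
  then show ?thesis using a_moments[of n] by (simp add: dil_sum_def weight_def)
qed

lemma continuous_fold_sqrt:
  assumes "even_class G"
  shows "continuous_on UNIV (fold_sqrt n G)"
proof -
  have G: "smooth_on UNIV G" "bounded_support G" using assms by (auto simp: even_class_def)
  have "continuous_on {z. 0 \<le> snd z} (\<lambda>z. G (fst z, sqrt (snd z)))"
    by (rule continuous_on_compose2[OF smooth_on_continuous_on[OF G(1)]]) (auto intro!: continuous_intros)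
  moreover have "continuous_on {z. snd z \<le> 0} (\<lambda>z. dil_sum (weight n) G (fst z, sqrt (- snd z)))"
    by (rule continuous_on_compose2[OF smooth_on_continuous_on[OF smooth_on_dil_sum[OF rapid_weight G(2,1)]]])
      (auto intro!: continuous_intros)
  moreover have "closed {z :: 'a \<times> real. 0 \<le> snd z}" "closed {z :: 'a \<times> real. snd z \<le> 0}"
    by (intro closed_Collect_le continuous_intros)+
  ultimately have "continuous_on ({z. 0 \<le> snd z} \<union> {z. snd z \<le> 0}) (fold_sqrt n G)"
    unfolding fold_sqrt_def[abs_def]
    by (intro continuous_on_If) (auto simp: dil_sum_weight_0)
  moreover have "{z :: 'a \<times> real. 0 \<le> snd z} \<union> {z. snd z \<le> 0} = UNIV" by auto
  ultimately show ?thesis by simp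
qed

text \<open>Off the seam this is the chain rule. On the seam the derivative in \<open>p\<close> is
  read off from the branch \<open>0 \<le> snd z\<close>, the one in \<open>y\<close> is obtained as
  a continuous extension, and its continuity combines both into a total derivative.\<close>

lemma fold_sqrt_has_derivative:
  fixes G :: "'p::euclidean_space \<times> real \<Rightarrow> real"
  assumes G: "even_class G" and H: "even_class H"
    and GH: "\<And>p t. frechet_derivative G (at (p, t)) (0, 1) = 2 * t * H (p, t)"
  shows "(fold_sqrt n G has_derivative (\<lambda>h. fold_sqrt n (\<lambda>z. frechet_derivative G (at z) (fst h, 0)) z
    + snd h * fold_sqrt (Suc n) H z)) (at z)"
proof -
  let ?D = "\<lambda>z. frechet_derivative G (at z)"
  have sG: "smooth_on UNIV G" "bounded_support G" using G by (auto simp: even_class_def)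
  have D: "?D z h = ?D z (fst h, 0) + snd h * ?D z (0, 1)" for z h
  proof -
    interpret linear "?D z"
      using smooth_on_has_derivative[OF sG(1), of z] by (auto dest: has_derivative_linear)
    show ?thesis using add[of "(fst h, 0)" "snd h *\<^sub>R (0, 1)"] scale[of "snd h" "(0, 1)"] by simp
  qed
  have off: "(fold_sqrt n G has_derivative (\<lambda>h. fold_sqrt n (\<lambda>z. ?D z (fst h, 0)) z
    + snd h * fold_sqrt (Suc n) H z)) (at z)" if z: "snd z \<noteq> 0" for z
  proof (cases "snd z > 0")
    case True
    let ?w = "(fst z, sqrt (snd z))"
    have "((\<lambda>z. (fst z, sqrt (snd z))) has_derivative (\<lambda>h. (fst h, snd h * (inverse (sqrt (snd z)) / 2)))) (at z)"
      by (rule has_derivative_Pair[OF has_derivative_fst[OF has_derivative_ident]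
            has_derivative_real_sqrt[OF True has_derivative_snd[OF has_derivative_ident]]])
    from has_derivative_compose[OF this smooth_on_has_derivative[OF sG(1) UNIV_I]]
    have "((\<lambda>z. G (fst z, sqrt (snd z))) has_derivative
        (\<lambda>h. ?D ?w (fst h, snd h * (inverse (sqrt (snd z)) / 2)))) (at z)" .
    moreover have "?D ?w (fst h, snd h * (inverse (sqrt (snd z)) / 2)) =
      fold_sqrt n (\<lambda>z. ?D z (fst h, 0)) z + snd h * fold_sqrt (Suc n) H z" for h
      using True by (subst D) (simp add: GH fold_sqrt_def)
    ultimately have "((\<lambda>z. G (fst z, sqrt (snd z))) has_derivative
      (\<lambda>h. fold_sqrt n (\<lambda>z. ?D z (fst h, 0)) z + snd h * fold_sqrt (Suc n) H z)) (at z)" by simp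
    moreover have "open {z :: 'p \<times> real. 0 < snd z}" by (intro open_Collect_less continuous_intros)
    ultimately show ?thesis
      by (rule has_derivative_transform_within_open) (use True in \<open>auto simp: fold_sqrt_def\<close>)
  next
    case False
    then have neg: "snd z < 0" using z by simp
    let ?w = "(fst z, sqrt (- snd z))"
    have "((\<lambda>z. (fst z, sqrt (- snd z))) has_derivative (\<lambda>h. (fst h, - snd h * (inverse (sqrt (- snd z)) / 2)))) (at z)"
      by (rule has_derivative_Pair[OF has_derivative_fst[OF has_derivative_ident]
            has_derivative_real_sqrt[OF _ has_derivative_minus[OF has_derivative_snd[OF has_derivative_ident]]]])
        (use neg in simp)
    from has_derivative_compose[OF this dil_sum_has_derivative[OF rapid_weight sG(2,1)]]
    have "((\<lambda>z. dil_sum (weight n) G (fst z, sqrt (- snd z))) has_derivative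
        (\<lambda>h. dil_sum (weight n) (\<lambda>z. ?D z (fst h, 0)) ?w + (- snd h * (inverse (sqrt (- snd z)) / 2)) *
          dil_sum (\<lambda>k. weight n k * \<mu> k) (\<lambda>z. ?D z (0, 1)) ?w)) (at z)" by simp
    \<comment> \<open>One \<open>\<mu> k\<close> comes from the chain rule, the other from
      \<open>2 * t\<close> evaluated at the dilated point; their product turns
      \<open>weight n\<close> into \<open>- weight (Suc n)\<close>.\<close>
    moreover have "dil_sum (\<lambda>k. weight n k * \<mu> k) (\<lambda>z. ?D z (0, 1)) ?w
        = - (2 * sqrt (- snd z)) * dil_sum (weight (Suc n)) H ?w"
    proof -
      have "(\<Sum>k. weight n k * \<mu> k * (2 * (\<mu> k * s) * H (p, \<mu> k * s)))
          = (\<Sum>k. - (2 * s) * (weight (Suc n) k * H (p, \<mu> k * s)))" for s p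
        by (simp add: weight_def power2_eq_square mult_ac)
      also have "\<dots> s p = - (2 * s) * (\<Sum>k. weight (Suc n) k * H (p, \<mu> k * s))" for s p
        using H by (intro suminf_mult summable_dil_sum rapid_weight) (auto simp: even_class_def)
      finally show ?thesis by (simp add: dil_sum_def GH)
    qed
    moreover have "inverse (sqrt (- snd z)) * (sqrt (- snd z) * c) = c" for c
      using neg by simp
    ultimately have "((\<lambda>z. dil_sum (weight n) G (fst z, sqrt (- snd z))) has_derivative
      (\<lambda>h. fold_sqrt n (\<lambda>z. ?D z (fst h, 0)) z + snd h * fold_sqrt (Suc n) H z)) (at z)"
      using neg by (simp add: fold_sqrt_def)
    moreover have "open {z :: 'p \<times> real. snd z < 0}" by (intro open_Collect_less continuous_intros)
    ultimately show ?thesis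
      by (rule has_derivative_transform_within_open) (use neg in \<open>auto simp: fold_sqrt_def\<close>)
  qed
  show ?thesis
  proof (cases "snd z = 0")
    case True
    define p0 where "p0 = fst z"
    have z: "z = (p0, 0)" using True by (simp add: p0_def prod_eq_iff)
    have cH: "continuous_on UNIV (fold_sqrt (Suc n) H)" by (rule continuous_fold_sqrt[OF H])
    have dy: "((\<lambda>y. fold_sqrt n G (p, y)) has_real_derivative fold_sqrt (Suc n) H (p, y)) (at y)" for p y
    proof -
      have ne: "((\<lambda>y. fold_sqrt n G (p, y)) has_real_derivative fold_sqrt (Suc n) H (p, y)) (at y)"
        if "y \<noteq> 0" for y
      proof -
        have "((\<lambda>y. (p, y)) has_derivative (\<lambda>h. (0, h))) (at y)" by (auto intro!: derivative_eq_intros)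
        from has_derivative_compose[OF this off] that
        have "((\<lambda>y. fold_sqrt n G (p, y)) has_derivative (\<lambda>h. fold_sqrt n (\<lambda>z. ?D z (0, 0)) (p, y)
          + h * fold_sqrt (Suc n) H (p, y))) (at y)" by simp
        moreover have "?D z (0, 0) = 0" for z
          using linear_0[OF has_derivative_linear[OF smooth_on_has_derivative[OF sG(1) UNIV_I]]]
          by (simp add: zero_prod_def)
        moreover from this have "fold_sqrt n (\<lambda>z. ?D z (0, 0)) w = 0" for w
          by (simp add: fold_sqrt_def dil_sum_def)
        ultimately show ?thesis by (simp add: has_field_derivative_def mult_commute_abs)
      qed
      show ?thesis
      proof (cases "y = 0")
        case y: True
        have "continuous_on UNIV (\<lambda>y. fold_sqrt n G (p, y))"
          by (rule continuous_on_compose2[OF continuous_fold_sqrt[OF G]]) (auto intro!: continuous_intros)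
        moreover have "continuous_on UNIV (\<lambda>y. fold_sqrt (Suc n) H (p, y))"
          by (rule continuous_on_compose2[OF cH]) (auto intro!: continuous_intros)
        ultimately show ?thesis unfolding y by (rule has_real_derivative_at_0_from_limit) (rule ne)
      qed (rule ne)
    qed
    have dp: "((\<lambda>p. fold_sqrt n G (p, 0)) has_derivative (\<lambda>h. ?D (p0, 0) (h, 0))) (at p0 within UNIV)"
    proof -
      have "((\<lambda>p. (p, 0)) has_derivative (\<lambda>h. (h, 0))) (at p0)" by (auto intro!: derivative_eq_intros)
      from has_derivative_compose[OF this smooth_on_has_derivative[OF sG(1) UNIV_I]]
      show ?thesis by (simp add: fold_sqrt_def)
    qed
    have "((\<lambda>(p, y). fold_sqrt n G (p, y)) has_derivative
      (\<lambda>(tp, ty). ?D (p0, 0) (tp, 0) + blinfun_apply (blinfun_scaleR_left (fold_sqrt (Suc n) H (p0, 0))) ty))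
      (at (p0, 0) within UNIV \<times> UNIV)"
    proof (rule has_derivative_partialsI[where f="\<lambda>p y. fold_sqrt n G (p, y)"
            and fy="\<lambda>p y. blinfun_scaleR_left (fold_sqrt (Suc n) H (p, y))" and X=UNIV and Y=UNIV
            and fx="\<lambda>h. ?D (p0, 0) (h, 0)"])
      show "((\<lambda>p. fold_sqrt n G (p, 0)) has_derivative (\<lambda>h. ?D (p0, 0) (h, 0))) (at p0 within UNIV)"
        by (rule dp)
      show "((\<lambda>y. fold_sqrt n G (p, y)) has_derivative
          blinfun_apply (blinfun_scaleR_left (fold_sqrt (Suc n) H (p, y)))) (at y within UNIV)" for p y
        using dy[of p y] by (simp add: has_field_derivative_def mult_commute_abs)
      have "isCont (fold_sqrt (Suc n) H) (p0, 0)"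
        using cH by (simp add: continuous_on_eq_continuous_at)
      then show "continuous (at (p0, 0) within UNIV \<times> UNIV)
          (\<lambda>(p, y). blinfun_scaleR_left (fold_sqrt (Suc n) H (p, y)))"
        using bounded_linear.continuous[OF bounded_linear_blinfun_scaleR_left, of "at (p0, 0)" "fold_sqrt (Suc n) H"]
        by (simp add: split_def)
    qed auto
    moreover have "fold_sqrt m F (p0, 0) = F (p0, 0)" for m F by (simp add: fold_sqrt_def)
    ultimately show ?thesis unfolding z by (simp add: split_def)
  qed (rule off)
qed

text \<open>Both parts of the derivative are again \<open>fold_sqrt\<close> of functions in the even
  class, with index \<open>n\<close> or \<open>Suc n\<close>; hence the induction on the order runs
  over all \<open>n\<close> and \<open>G\<close> at once.\<close>

lemma smooth_on_fold_sqrt: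
  assumes "even_class G"
  shows "smooth_on UNIV (fold_sqrt n G)"
proof -
  have "Ck_on k UNIV (fold_sqrt n G)" for k
    using assms
  proof (induction k arbitrary: n G)
    case 0
    then show ?case using continuous_fold_sqrt by simp
  next
    case (Suc k)
    obtain H where H: "even_class H"
      "\<And>p t. frechet_derivative G (at (p, t)) (0, 1) = 2 * t * H (p, t)"
      using even_class_derivative_snd[OF Suc.prems] by blast
    show ?case
      by (rule Ck_on_SucI[OF open_UNIV fold_sqrt_has_derivative[OF Suc.prems H]])
        (intro Ck_on_add Ck_on_bounded_bilinear[OF _ bounded_bilinear_mult] Ck_on_const open_UNIV
          Suc.IH even_class_derivative_fst Suc.prems H)
  qed
  then show ?thesis by (simp add: smooth_on_def)
qed

end

text \<open>For \<open>y \<ge> 0\<close> the value \<open>A (p, y)\<close> is forced to be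
  \<open>G (p, sqrt y)\<close>; Seeley's extension supplies a smooth choice for
  \<open>y < 0\<close>.\<close>

theorem even_function_of_square:
  fixes G :: "'p::euclidean_space \<times> real \<Rightarrow> real"
  assumes "even_class G"
  obtains A where "smooth_on UNIV A" "\<And>p t. G (p, t) = A (p, t\<^sup>2)"
proof -
  obtain a \<mu> :: "nat \<Rightarrow> real" where c: "\<And>k. \<mu> k > 0" "\<And>n. summable (\<lambda>k. \<bar>a k\<bar> * \<mu> k ^ n)"
    "\<And>n. (\<Sum>k. a k * (- (\<mu> k)\<^sup>2) ^ n) = 1"
    by (rule seeley_coefficients) blast
  interpret dilations \<mu> by unfold_locales (rule c)
  interpret seeley \<mu> a by unfold_locales (use c in \<open>auto simp: rapid_def\<close>)
  have "G (p, t) = fold_sqrt 0 G (p, t\<^sup>2)" for p t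
    using assms by (cases "t \<ge> 0") (auto simp: fold_sqrt_def even_class_def even_snd_def)
  then show ?thesis using smooth_on_fold_sqrt[OF assms] that by blast
qed

theorem even_odd_decomposition:
  fixes G :: "'p::euclidean_space \<times> real \<Rightarrow> real"
  assumes G: "smooth_on UNIV G" "bounded_support G"
  obtains A B where "smooth_on UNIV A" "smooth_on UNIV B"
    "\<And>p t. G (p, t) = B (p, t\<^sup>2) + t * A (p, t\<^sup>2)"
proof -
  define E where "E = (\<lambda>z. (G z + G (fst z, - snd z)) / 2)"
  define K where "K = (\<lambda>z. (G z - G (fst z, - snd z)) / 2)"
  have refl: "smooth_on UNIV (\<lambda>z. G (fst z, - snd z))"
    by (rule smooth_on_compose[OF G(1)]) (auto intro!: smooth_intros)
  have sE: "smooth_on UNIV E" and sK: "smooth_on UNIV K"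
    unfolding E_def K_def
    by (intro smooth_on_bounded_linear_comp[OF bounded_linear_divide] smooth_intros G refl open_UNIV)+
  have norm_refl: "norm (p, - t) = norm (p, t)" for p :: 'p and t :: real by (simp add: norm_prod_def)
  obtain R where R: "\<And>z. norm z > R \<Longrightarrow> G z = 0" using bounded_supportE[OF G(2)] by blast
  have zero: "E z = 0 \<and> K z = 0" if "norm z > R" for z
    using R[of z] R[of "(fst z, - snd z)"] norm_refl[of "fst z" "snd z"] that by (simp add: E_def K_def)
  have E: "even_class E"
    using sE bounded_supportI[of R E] zero by (auto simp: even_class_def even_snd_def E_def)
  have K0: "K (p, 0) = 0" for p by (simp add: K_def)
  obtain L where L: "smooth_on UNIV L" "\<And>p t. K (p, t) = t * L (p, t)"
    "\<And>p. L (p, 0) = frechet_derivative K (at (p, 0)) (0, 1)"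
    by (rule hadamard[OF sK K0]) blast
  have bK: "bounded_support K" using zero by (intro bounded_supportI) blast
  obtain R' where R': "\<And>z. norm z > R' \<Longrightarrow> frechet_derivative K (at z) (0, 1) = 0"
    using bounded_supportE[OF bounded_support_derivative[OF bK]] by blast
  have "L (p, t) = 0" if "norm (p, t) > max R R'" for p t
    using L(2)[of p t] L(3)[of p] zero[of "(p, t)"] R'[of "(p, t)"] that by (cases "t = 0") auto
  then have "bounded_support L" unfolding bounded_support_def split_paired_All by blast
  moreover have "K (p, - t) = - K (p, t)" for p t by (simp add: K_def field_simps)
  then have "L (p, - t) = L (p, t)" for p t
    using L(2)[of p t] L(2)[of p "- t"] by (cases "t = 0") auto
  ultimately have "even_class L" using L(1) by (simp add: even_class_def even_snd_def)
  then obtain A where A: "smooth_on UNIV A" "\<And>p t. L (p, t) = A (p, t\<^sup>2)"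
    using even_function_of_square by blast
  obtain B where B: "smooth_on UNIV B" "\<And>p t. E (p, t) = B (p, t\<^sup>2)"
    using even_function_of_square[OF E] by blast
  have "G (p, t) = B (p, t\<^sup>2) + t * A (p, t\<^sup>2)" for p t
  proof -
    have "G (p, t) = E (p, t) + K (p, t)" by (simp add: E_def K_def add_divide_distrib diff_divide_distrib)
    then show ?thesis by (simp add: B(2) L(2) A(2))
  qed
  then show ?thesis using that A(1) B(1) by blast
qed

section \<open>Recognition of Whitney umbrellas\<close>

lemma diffeomorphism_derivative_inverse:
  assumes d: "diffeomorphism U V f g" and x: "x \<in> U"
  shows "frechet_derivative g (at (f x)) (frechet_derivative f (at x) v) = v"
    and "frechet_derivative f (at x) (frechet_derivative g (at (f x)) w) = w"
proof -
  have o: "open U" "open V" "smooth_on U f" "smooth_on V g" and h: "homeomorphism U V f g"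
    using d by (auto simp: diffeomorphism_def)
  have fx: "f x \<in> V" "g (f x) = x" using h x by (auto simp: homeomorphism_def)
  note df = smooth_on_has_derivative[OF o(3) x] and dg = smooth_on_has_derivative[OF o(4) fx(1)]
  have "((\<lambda>x. g (f x)) has_derivative (\<lambda>v. frechet_derivative g (at (f x)) (frechet_derivative f (at x) v))) (at x)"
    by (rule has_derivative_compose[OF df dg])
  moreover have "((\<lambda>x. g (f x)) has_derivative (\<lambda>v. v)) (at x)"
    by (rule has_derivative_transform_within_open[OF has_derivative_ident o(1) x])
      (use h in \<open>auto simp: homeomorphism_def\<close>)
  ultimately show "frechet_derivative g (at (f x)) (frechet_derivative f (at x) v) = v"
    by (rule fun_cong[OF has_derivative_unique])
  have "((\<lambda>y. f (g y)) has_derivative (\<lambda>w. frechet_derivative f (at x) (frechet_derivative g (at (f x)) w))) (at (f x))"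
    by (rule has_derivative_compose[OF dg]) (use df fx in simp)
  moreover have "((\<lambda>y. f (g y)) has_derivative (\<lambda>v. v)) (at (f x))"
    by (rule has_derivative_transform_within_open[OF has_derivative_ident o(2) fx(1)])
      (use h in \<open>auto simp: homeomorphism_def\<close>)
  ultimately show "frechet_derivative f (at x) (frechet_derivative g (at (f x)) w) = w"
    by (rule fun_cong[OF has_derivative_unique])
qed

lemma vector_4_axis:
  "(vector [a, b, c, d] :: real^4) = a *\<^sub>R axis 1 1 + b *\<^sub>R axis 2 1 + c *\<^sub>R axis 3 1 + d *\<^sub>R axis 4 1"
  by (simp add: vec_eq_iff forall_4 vector_def axis_def)

lemma vector_4_nth [simp]:
  "(vector [a, b, c, d] :: 'a::zero^4) $ 1 = a" "(vector [a, b, c, d] :: 'a^4) $ 2 = b"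
  "(vector [a, b, c, d] :: 'a^4) $ 3 = c" "(vector [a, b, c, d] :: 'a^4) $ 4 = d"
  by (simp_all add: vector_def)

lemma smooth_on_vector_4:
  assumes "open S" "smooth_on S a" "smooth_on S b" "smooth_on S c" "smooth_on S d"
  shows "smooth_on S (\<lambda>x. vector [a x, b x, c x, d x] :: real^4)"
  unfolding vector_4_axis by (intro smooth_intros assms)

lemma has_derivative_vector_4:
  assumes "(a has_derivative a') F" "(b has_derivative b') F" "(c has_derivative c') F" "(d has_derivative d') F"
  shows "((\<lambda>x. vector [a x, b x, c x, d x] :: real^4) has_derivative (\<lambda>v. vector [a' v, b' v, c' v, d' v])) F"
  unfolding vector_4_axis
  by (intro has_derivative_add has_derivative_scaleR_left assms)

text \<open>With \<open>T = t * \<kappa>\<close> one has \<open>t * L = T * (L / \<kappa>)\<close>,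
  so \<open>L / \<kappa>\<close> is the function to split. It is written in the coordinates
  \<open>(p, T)\<close>, valid near \<open>(p0, 0)\<close> since \<open>\<kappa> > 0\<close>, and
  made global before the splitting. Thus \<open>A\<close> and \<open>B\<close> live everywhere,
  \<open>\<kappa>\<close> on \<open>W\<close>.\<close>

lemma folded_normal_form:
  fixes h L :: "'p::euclidean_space \<times> real \<Rightarrow> real"
  assumes h: "smooth_on UNIV h" "h (p0, 0) \<noteq> 0" and L: "smooth_on UNIV L"
  obtains A B \<kappa> \<sigma> W where "\<sigma> = 1 \<or> \<sigma> = -1" "open W" "(p0, 0) \<in> W" "smooth_on W \<kappa>"
    "\<And>z. z \<in> W \<Longrightarrow> \<kappa> z > 0" "\<And>z. z \<in> W \<Longrightarrow> (\<kappa> z)\<^sup>2 = \<sigma> * h z"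
    "smooth_on UNIV A" "smooth_on UNIV B"
    "\<And>p t. (p, t) \<in> W \<Longrightarrow> L (p, t) = \<kappa> (p, t) * (B (p, (t * \<kappa> (p, t))\<^sup>2) + t * \<kappa> (p, t) * A (p, (t * \<kappa> (p, t))\<^sup>2))"
proof -
  \<comment> \<open>With this sign \<open>\<sigma> * h\<close> is positive near the base point and
    has a smooth square root.\<close>
  define \<sigma> where "\<sigma> = sgn (h (p0, 0))"
  define W0 where "W0 = {z. 0 < \<sigma> * h z}"
  define \<kappa> where "\<kappa> = (\<lambda>z. sqrt (\<sigma> * h z))"
  define M where "M = (\<lambda>z. (fst z, snd z * \<kappa> z))"
  have oW0: "open W0" unfolding W0_def
    by (intro open_Collect_less continuous_intros smooth_on_continuous_on h)
  have zW0: "(p0, 0) \<in> W0" using h(2) by (simp add: W0_def \<sigma>_def sgn_mult_self_eq linordered_idom_class.abs_sgn[symmetric] mult.commute)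
  have sk: "smooth_on W0 \<kappa>" unfolding \<kappa>_def
    by (intro smooth_on_sqrt smooth_intros smooth_on_subset[OF h(1)] oW0) (auto simp: W0_def)
  have kpos: "\<kappa> z > 0" if "z \<in> W0" for z using that by (simp add: \<kappa>_def W0_def)
  have ksq: "(\<kappa> z)\<^sup>2 = \<sigma> * h z" if "z \<in> W0" for z using that by (simp add: \<kappa>_def W0_def)
  have sM: "smooth_on W0 M" unfolding M_def by (intro smooth_intros oW0 sk)
  have "(M has_derivative (\<lambda>v. (fst v, snd v * \<kappa> (p0, 0)))) (at (p0, 0))"
    unfolding M_def using has_derivative_mult[OF has_derivative_snd[OF has_derivative_ident]
        smooth_on_has_derivative[OF sk zW0]]
    by (intro has_derivative_Pair has_derivative_fst has_derivative_ident) simp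
  then have dM: "frechet_derivative M (at (p0, 0)) v = (fst v, snd v * \<kappa> (p0, 0))" for v
    by (simp add: frechet_derivative_at[symmetric])
  have "v = 0" if "frechet_derivative M (at (p0, 0)) v = 0" for v
    using that kpos[OF zW0] by (simp add: dM prod_eq_iff)
  from smooth_inverse_function[OF oW0 zW0 sM this]
  obtain U' V g where U': "U' \<subseteq> W0" "(p0, 0) \<in> U'" "diffeomorphism U' V M g" by metis
  then have oU: "open U'" "open V" and hom: "homeomorphism U' V M g" and sg: "smooth_on V g"
    by (auto simp: diffeomorphism_def)
  have gW: "g y \<in> W0" if "y \<in> V" for y using hom U'(1) that by (auto simp: homeomorphism_def)
  have sG: "smooth_on V (\<lambda>y. L (g y) / \<kappa> (g y))"
    by (intro smooth_on_divide oU smooth_on_compose[OF L open_UNIV oU(2) sg]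
        smooth_on_compose[OF sk oW0 oU(2) sg gW] UNIV_I) (assumption, rule less_imp_neq[OF kpos[OF gW], symmetric])
  have M0: "M (p0, 0) = (p0, 0)" by (simp add: M_def)
  have zV: "(p0, 0) \<in> V" using imageI[OF U'(2), of M] hom M0 by (simp add: homeomorphism_def)
  obtain F e where F: "smooth_on UNIV F" "\<forall>\<^sub>F y in nhds (p0, 0). F y = L (g y) / \<kappa> (g y)"
    "\<And>y. dist (p0, 0) y \<ge> e \<Longrightarrow> F y = 0"
    using smooth_globalisation[OF oU(2) zV sG] by blast
  have "bounded_support F"
  proof (rule bounded_supportI)
    show "F y = 0" if "norm y > norm (p0, 0 :: real) + e" for y
      using F(3)[of y] that norm_triangle_ineq2[of y "(p0, 0)"] by (simp add: dist_norm norm_minus_commute)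
  qed
  then obtain A B where AB: "smooth_on UNIV A" "smooth_on UNIV B"
    "\<And>p t. F (p, t) = B (p, t\<^sup>2) + t * A (p, t\<^sup>2)"
    using even_odd_decomposition[OF F(1)] by blast
  have "isCont M (p0, 0)"
    using smooth_on_continuous_on[OF sM] oW0 zW0 by (simp add: continuous_on_eq_continuous_at)
  then have "filterlim M (nhds (p0, 0)) (nhds (p0, 0))"
    using tendsto_at_iff_tendsto_nhds[of M "(p0, 0)"] by (simp add: M0 continuous_at)
  then have "\<forall>\<^sub>F z in nhds (p0, 0). F (M z) = L (g (M z)) / \<kappa> (g (M z))"
    using F(2) by (rule eventually_compose_filterlim[rotated])
  then have "\<forall>\<^sub>F z in nhds (p0, 0). z \<in> U' \<and> F (M z) = L (g (M z)) / \<kappa> (g (M z))"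
    using eventually_nhds_in_open[OF oU(1) U'(2)] by eventually_elim auto
  then obtain W where W: "open W" "(p0, 0) \<in> W"
    "\<And>z. z \<in> W \<Longrightarrow> z \<in> U' \<and> F (M z) = L (g (M z)) / \<kappa> (g (M z))"
    unfolding eventually_nhds by blast
  have WW0: "W \<subseteq> W0" using W(3) U'(1) by blast
  have "L (p, t) = \<kappa> (p, t) * (B (p, (t * \<kappa> (p, t))\<^sup>2) + t * \<kappa> (p, t) * A (p, (t * \<kappa> (p, t))\<^sup>2))"
    if "(p, t) \<in> W" for p t
  proof -
    have "g (M (p, t)) = (p, t)" using W(3)[OF that] hom by (auto simp: homeomorphism_def)
    then have "F (M (p, t)) = L (p, t) / \<kappa> (p, t)" using W(3)[OF that] by simp
    then show ?thesis using kpos[of "(p, t)"] that WW0 by (auto simp: M_def AB(3) field_simps)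
  qed
  moreover have "\<sigma> = 1 \<or> \<sigma> = - 1" using h(2) by (simp add: \<sigma>_def sgn_if)
  ultimately show ?thesis
    using that[of \<sigma> W \<kappa> A B] W(1,2) WW0 kpos ksq smooth_on_subset[OF sk WW0] AB(1,2) by blast
qed

lemma vector_4_eq_0_iff: "(vector [a, b, c, d] :: real^4) = 0 \<longleftrightarrow> a = 0 \<and> b = 0 \<and> c = 0 \<and> d = 0"
  by (simp add: vec_eq_iff forall_4)

text \<open>By \<open>df\<close>, the coordinates \<open>(u, v)\<close> agree to first order with
  the ruling parameters in the directions \<open>fst v = 0\<close>. By \<open>L0\<close>, the slope
  of the third component in \<open>t\<close> vanishes at the base point and has
  \<open>u\<close>-derivative \<open>1\<close>; this allows \<open>B\<close> to replace
  \<open>u\<close> as a coordinate.\<close>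

theorem whitney_umbrella_intervalI:
  fixes f :: "real \<times> real \<times> real \<Rightarrow> real^4" and h L :: "(real \<times> real) \<times> real \<Rightarrow> real"
    and e1 e2 e3 e4 :: "real^4"
  defines "p \<equiv> \<lambda>x. (e1 \<bullet> f x, e2 \<bullet> f x)"
  assumes S: "open S" "x0 \<in> S" "smooth_on S f" "fst x0 = 0"
    and frame: "\<And>y. e1 \<bullet> y = 0 \<Longrightarrow> e2 \<bullet> y = 0 \<Longrightarrow> e3 \<bullet> y = 0 \<Longrightarrow> e4 \<bullet> y = 0 \<Longrightarrow> y = 0"
    and h: "smooth_on UNIV h" "h (p x0, 0) \<noteq> 0" and L: "smooth_on UNIV L"
    and f3: "\<And>x. x \<in> S \<Longrightarrow> e3 \<bullet> f x = fst x * L (p x, fst x)"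
    and f4: "\<And>x. x \<in> S \<Longrightarrow> e4 \<bullet> f x = (fst x)\<^sup>2 * h (p x, fst x)"
    and L0: "\<And>u v. L ((u, v), 0) = (u - fst (p x0)) + \<beta> * (v - snd (p x0))"
    and df: "\<And>v. fst v = 0 \<Longrightarrow> (e1 \<bullet> frechet_derivative f (at x0) v, e2 \<bullet> frechet_derivative f (at x0) v) = snd v"
  shows "whitney_umbrella_interval f x0"
proof -
  define p0 where "p0 = p x0"
  obtain A B \<kappa> \<sigma> W where sg: "\<sigma> = 1 \<or> \<sigma> = -1" and W: "open W" "(p0, 0) \<in> W" and k: "smooth_on W \<kappa>"
    "\<And>z. z \<in> W \<Longrightarrow> \<kappa> z > 0" "\<And>z. z \<in> W \<Longrightarrow> (\<kappa> z)\<^sup>2 = \<sigma> * h z"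
    and AB: "smooth_on UNIV A" "smooth_on UNIV B"
    "\<And>p t. (p, t) \<in> W \<Longrightarrow> L (p, t) = \<kappa> (p, t) * (B (p, (t * \<kappa> (p, t))\<^sup>2) + t * \<kappa> (p, t) * A (p, (t * \<kappa> (p, t))\<^sup>2))"
    by (rule folded_normal_form[OF h(1) h(2)[folded p0_def] L]) (rule that)
  define T where "T = (\<lambda>x. fst x * \<kappa> (p x, fst x))"
  define \<phi> where "\<phi> = (\<lambda>x. (B (p x, (T x)\<^sup>2), snd (p x) - snd p0, T x))"
  \<comment> \<open>On the image \<open>\<sigma> * (e4 \<bullet> y)\<close> equals
    \<open>T\<^sup>2\<close>, so every occurrence of \<open>T\<^sup>2\<close> becomes a linear
    function on the target; the last entry removes \<open>T\<^sup>2 A\<close>.\<close>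
  define \<Phi> where "\<Phi> = (\<lambda>y. vector [B ((e1 \<bullet> y, e2 \<bullet> y), \<sigma> * (e4 \<bullet> y)), e2 \<bullet> y - snd p0, \<sigma> * (e4 \<bullet> y),
      e3 \<bullet> y - \<sigma> * (e4 \<bullet> y) * A ((e1 \<bullet> y, e2 \<bullet> y), \<sigma> * (e4 \<bullet> y))] :: real^4)"
  define k0 where "k0 = \<kappa> (p0, 0)"
  let ?Df = "frechet_derivative f (at x0)"
  let ?DB = "frechet_derivative B (at (p0, 0))"
  have k0: "k0 > 0" using k(2)[OF W(2)] by (simp add: k0_def)
  note sf = S(3)
  have sp: "smooth_on S p" unfolding p_def by (intro smooth_intros S)
  have spx: "smooth_on S (\<lambda>x. (p x, fst x))" by (intro smooth_intros S sp)
  define S' where "S' = S \<inter> (\<lambda>x. (p x, fst x)) -` W"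
  have oS': "open S'" unfolding S'_def Int_commute[of S]
    using continuous_open_preimage[OF smooth_on_continuous_on[OF spx] S(1) W(1)] by (simp add: Int_commute)
  have xS': "x0 \<in> S'" using S(2,4) W(2) by (simp add: S'_def p0_def)
  have SS: "S' \<subseteq> S" by (auto simp: S'_def)
  have sT: "smooth_on S' T" unfolding T_def
    by (intro smooth_intros oS' smooth_on_compose[OF k(1) W(1) oS' smooth_on_subset[OF spx SS]])
      (auto simp: S'_def)
  have sphi: "smooth_on S' \<phi>" unfolding \<phi>_def
    by (intro smooth_intros oS' sT smooth_on_subset[OF sp SS] smooth_on_compose[OF AB(2) open_UNIV oS'] UNIV_I)
  have sPhi: "smooth_on UNIV \<Phi>" unfolding \<Phi>_def
    by (intro smooth_on_vector_4 smooth_intros open_UNIV smooth_on_compose[OF AB(1) open_UNIV open_UNIV]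
        smooth_on_compose[OF AB(2) open_UNIV open_UNIV] UNIV_I)
  have T0: "T x0 = 0" by (simp add: T_def S(4))
  have Tsq: "(T x)\<^sup>2 = \<sigma> * (e4 \<bullet> f x)" if "x \<in> S'" for x
    using that f4[of x] k(3)[of "(p x, fst x)"] by (auto simp: S'_def T_def power_mult_distrib)
  have P: "e3 \<bullet> f x = T x * (B (p x, (T x)\<^sup>2) + T x * A (p x, (T x)\<^sup>2))" if "x \<in> S'" for x
    using that f3[of x] AB(3)[of "p x" "fst x"] by (auto simp: S'_def T_def)
  have conj: "\<Phi> (f x) = (case \<phi> x of (t, s, r) \<Rightarrow> vector [t, s, r^2, t * r])" if "x \<in> S'" for x
  proof -
    have "\<Phi> (f x) = vector [B (p x, (T x)\<^sup>2), snd (p x) - snd p0, (T x)\<^sup>2, e3 \<bullet> f x - (T x)\<^sup>2 * A (p x, (T x)\<^sup>2)]"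
      unfolding \<Phi>_def Tsq[OF that] by (simp add: p_def)
    then show ?thesis by (simp add: \<phi>_def P[OF that] power2_eq_square algebra_simps)
  qed
  \<comment> \<open>At \<open>t = 0\<close> the splitting of \<open>L\<close> reads
    \<open>L = \<kappa> * B\<close>, which ties \<open>B\<close> on the hyperplane to the affine
    function in \<open>L0\<close>.\<close>
  have Bp: "B (q, 0) * \<kappa> (q, 0) = (fst q - fst p0) + \<beta> * (snd q - snd p0)" if "(q, 0) \<in> W" for q
    using AB(3)[OF that] L0[of "fst q" "snd q"] by (simp add: p0_def mult.commute)
  have B0: "B (p0, 0) = 0" using Bp[OF W(2)] k0 by (simp add: k0_def)
  have linB: "linear ?DB"
    using smooth_on_has_derivative[OF AB(2), of "(p0, 0)"] by (auto dest: has_derivative_linear)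
  \<comment> \<open>Product rule for \<open>B * \<kappa>\<close>: since \<open>B\<close> vanishes at
    the base point, the unknown derivative of \<open>\<kappa>\<close> drops out.\<close>
  have DB: "?DB ((u, v), 0) = (u + \<beta> * v) / k0" for u v
  proof -
    have q: "((\<lambda>q. (q, 0 :: real)) has_derivative (\<lambda>w. (w, 0))) (at p0)" for p0 :: "real \<times> real"
      by (intro has_derivative_Pair has_derivative_ident has_derivative_const)
    have "((\<lambda>q. B (q, 0) * \<kappa> (q, 0)) has_derivative
        (\<lambda>w. B (p0, 0) * frechet_derivative \<kappa> (at (p0, 0)) (w, 0) + ?DB (w, 0) * \<kappa> (p0, 0))) (at p0)"
      by (intro has_derivative_mult has_derivative_compose[OF q] smooth_on_has_derivative[OF AB(2) UNIV_I]
          smooth_on_has_derivative[OF k(1) W(2)])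
    then have "((\<lambda>q. B (q, 0) * \<kappa> (q, 0)) has_derivative (\<lambda>w. ?DB (w, 0) * k0)) (at p0)"
      by (simp add: B0 k0_def)
    moreover have "((\<lambda>q. B (q, 0) * \<kappa> (q, 0)) has_derivative (\<lambda>w. fst w + \<beta> * snd w)) (at p0)"
    proof (rule has_derivative_transform_within_open)
      show "((\<lambda>q. (fst q - fst p0) + \<beta> * (snd q - snd p0)) has_derivative (\<lambda>w. fst w + \<beta> * snd w)) (at p0)"
        by (auto intro!: derivative_eq_intros)
      show "open ((\<lambda>q. (q, 0)) -` W)"
        by (intro open_vimage W(1) continuous_intros)
    qed (use W Bp in auto)
    ultimately have "(\<lambda>w. ?DB (w, 0) * k0) = (\<lambda>w. fst w + \<beta> * snd w)"
      by (rule has_derivative_unique)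
    from fun_cong[OF this, of "(u, v)"] have "?DB ((u, v), 0) * k0 = u + \<beta> * v" by simp
    then show ?thesis using k0 by (simp add: field_simps)
  qed
  have dfx: "(f has_derivative ?Df) (at x0)" by (rule smooth_on_has_derivative[OF S(3,2)])
  have dp: "(p has_derivative (\<lambda>v. (e1 \<bullet> ?Df v, e2 \<bullet> ?Df v))) (at x0)"
    unfolding p_def by (intro has_derivative_Pair has_derivative_inner_right dfx)
  have dT: "(T has_derivative (\<lambda>v. fst v * k0)) (at x0)"
  proof -
    have "((\<lambda>x. (p x, fst x)) has_derivative (\<lambda>v. ((e1 \<bullet> ?Df v, e2 \<bullet> ?Df v), fst v))) (at x0)"
      by (intro has_derivative_Pair dp has_derivative_fst has_derivative_ident)
    moreover have "(\<kappa> has_derivative frechet_derivative \<kappa> (at (p0, 0))) (at (p x0, fst x0))"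
      using smooth_on_has_derivative[OF k(1) W(2)] by (simp add: p0_def S(4))
    ultimately have "((\<lambda>x. \<kappa> (p x, fst x)) has_derivative
        (\<lambda>v. frechet_derivative \<kappa> (at (p0, 0)) ((e1 \<bullet> ?Df v, e2 \<bullet> ?Df v), fst v))) (at x0)"
      by (rule has_derivative_compose)
    from has_derivative_mult[OF has_derivative_fst[OF has_derivative_ident] this]
    show ?thesis by (simp add: T_def S(4) k0_def p0_def)
  qed
  have dphi: "(\<phi> has_derivative (\<lambda>v. (?DB ((e1 \<bullet> ?Df v, e2 \<bullet> ?Df v), 0), e2 \<bullet> ?Df v, fst v * k0))) (at x0)"
  proof -
    \<comment> \<open>\<open>T\<close> vanishes at \<open>x0\<close>, so \<open>T\<^sup>2\<close>
      has no first order part and \<open>B\<close> contributes through its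
      \<open>(u, v)\<close>-derivatives alone.\<close>
    have "((\<lambda>x. (T x)\<^sup>2) has_derivative (\<lambda>v. 0)) (at x0)"
      using has_derivative_power[OF dT, of 2] by (simp add: T0)
    then have "((\<lambda>x. (p x, (T x)\<^sup>2)) has_derivative (\<lambda>v. ((e1 \<bullet> ?Df v, e2 \<bullet> ?Df v), 0))) (at x0)"
      by (intro has_derivative_Pair dp)
    moreover have "(B has_derivative ?DB) (at (p x0, (T x0)\<^sup>2))"
      using smooth_on_has_derivative[OF AB(2), of "(p0, 0)"] by (simp add: T0 p0_def)
    ultimately have "((\<lambda>x. B (p x, (T x)\<^sup>2)) has_derivative (\<lambda>v. ?DB ((e1 \<bullet> ?Df v, e2 \<bullet> ?Df v), 0))) (at x0)"
      by (rule has_derivative_compose)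
    moreover have "((\<lambda>x. snd (p x) - snd p0) has_derivative (\<lambda>v. e2 \<bullet> ?Df v)) (at x0)"
      using has_derivative_diff[OF has_derivative_snd[OF dp] has_derivative_const[of "snd p0"]] by simp
    ultimately show ?thesis unfolding \<phi>_def by (intro has_derivative_Pair dT)
  qed
  have inj_phi: "v = 0" if "frechet_derivative \<phi> (at x0) v = 0" for v
  proof -
    have "?DB ((e1 \<bullet> ?Df v, e2 \<bullet> ?Df v), 0) = 0 \<and> e2 \<bullet> ?Df v = 0 \<and> fst v * k0 = 0"
      using that unfolding frechet_derivative_at[OF dphi, symmetric] zero_prod_def prod.inject .
    then have "e1 \<bullet> ?Df v = 0" "e2 \<bullet> ?Df v = 0" "fst v = 0" using k0 by (auto simp: DB)
    then show ?thesis using df[of v] by (simp add: prod_eq_iff)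
  qed
  have E0: "e3 \<bullet> f x0 = 0" "e4 \<bullet> f x0 = 0" using f3[OF S(2)] f4[OF S(2)] S(4) by auto
  \<comment> \<open>A triangular system: the third entry kills \<open>e4 \<bullet> v\<close>, after
    which \<open>DB\<close> applies and the first two kill \<open>e1 \<bullet> v\<close> and
    \<open>e2 \<bullet> v\<close>. In the last entry \<open>e4 \<bullet> f x0 = 0\<close> removes
    the derivative of \<open>A\<close>.\<close>
  have inj_Phi: "v = 0" if "frechet_derivative \<Phi> (at (f x0)) v = 0" for v
  proof -
    have in4: "((\<lambda>y. ((e1 \<bullet> y, e2 \<bullet> y), \<sigma> * (e4 \<bullet> y))) has_derivative (\<lambda>v. ((e1 \<bullet> v, e2 \<bullet> v), \<sigma> * (e4 \<bullet> v)))) (at (f x0))"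
      by (intro has_derivative_Pair has_derivative_mult_right has_derivative_inner_right has_derivative_ident)
    have base: "((e1 \<bullet> f x0, e2 \<bullet> f x0), \<sigma> * (e4 \<bullet> f x0)) = (p0, 0)" by (simp add: p0_def p_def E0)
    have dB: "(B has_derivative ?DB) (at ((e1 \<bullet> f x0, e2 \<bullet> f x0), \<sigma> * (e4 \<bullet> f x0)))"
      unfolding base by (rule smooth_on_has_derivative[OF AB(2) UNIV_I])
    have dA: "(A has_derivative frechet_derivative A (at (p0, 0))) (at ((e1 \<bullet> f x0, e2 \<bullet> f x0), \<sigma> * (e4 \<bullet> f x0)))"
      unfolding base by (rule smooth_on_has_derivative[OF AB(1) UNIV_I])
    have d1: "((\<lambda>y. e2 \<bullet> y - snd p0) has_derivative (\<lambda>v. e2 \<bullet> v)) (at (f x0))"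
      by (auto intro!: derivative_eq_intros)
    have d2: "((\<lambda>y. \<sigma> * (e4 \<bullet> y)) has_derivative (\<lambda>v. \<sigma> * (e4 \<bullet> v))) (at (f x0))"
      by (intro has_derivative_mult_right has_derivative_inner_right has_derivative_ident)
    note d3 = has_derivative_diff[OF has_derivative_inner_right[OF has_derivative_ident, of e3]
        has_derivative_mult[OF d2 has_derivative_compose[OF in4 dA]]]
    note dPhi = has_derivative_vector_4[OF has_derivative_compose[OF in4 dB] d1 d2 d3, folded \<Phi>_def]
    have zc: "?DB ((e1 \<bullet> v, e2 \<bullet> v), \<sigma> * (e4 \<bullet> v)) = 0 \<and> e2 \<bullet> v = 0 \<and> \<sigma> * (e4 \<bullet> v) = 0 \<and>
      e3 \<bullet> v - (\<sigma> * (e4 \<bullet> f x0) * frechet_derivative A (at (p0, 0)) ((e1 \<bullet> v, e2 \<bullet> v), \<sigma> * (e4 \<bullet> v))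
         + \<sigma> * (e4 \<bullet> v) * A ((e1 \<bullet> f x0, e2 \<bullet> f x0), \<sigma> * (e4 \<bullet> f x0))) = 0"
      using that unfolding frechet_derivative_at[OF dPhi, symmetric] vector_4_eq_0_iff .
    note z = conjunct1[OF zc] conjunct1[OF conjunct2[OF zc]] conjunct1[OF conjunct2[OF conjunct2[OF zc]]]
      conjunct2[OF conjunct2[OF conjunct2[OF zc]]]
    have "e4 \<bullet> v = 0" using z(3) sg by auto
    moreover have "e1 \<bullet> v = 0" using z(1,2,3) k0 by (simp add: DB)
    ultimately show ?thesis using z(2,4) E0 by (intro frame) auto
  qed
  obtain U1 V1 g1 where U1: "U1 \<subseteq> S'" "x0 \<in> U1" "diffeomorphism U1 V1 \<phi> g1"
    using smooth_inverse_function[OF oS' xS' sphi inj_phi] by metis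
  obtain U2 V2 g2 where U2: "f x0 \<in> U2" "diffeomorphism U2 V2 \<Phi> g2"
    using smooth_inverse_function[OF open_UNIV UNIV_I sPhi inj_Phi] by metis
  have phi0: "\<phi> x0 = (0, 0, 0)" by (simp add: \<phi>_def T0 p0_def[symmetric] B0)
  have h1: "homeomorphism U1 V1 \<phi> g1" and o1: "open U1" "open V1" and sg1: "smooth_on V1 g1"
    and oU2: "open U2"
    using U1(3) U2(2) by (auto simp: diffeomorphism_def)
  have 0: "(0, 0, 0) \<in> V1" using imageI[OF U1(2), of \<phi>] h1 phi0 by (simp add: homeomorphism_def)
  have g10: "g1 (0, 0, 0) = x0" using h1 U1(2) phi0 by (auto simp: homeomorphism_def)
  have "continuous_on V1 (\<lambda>y. f (g1 y))"
    by (rule continuous_on_compose2[OF smooth_on_continuous_on[OF S(3)] smooth_on_continuous_on[OF sg1]])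
      (use h1 U1(1) SS in \<open>auto simp: homeomorphism_def\<close>)
  then have "open (V1 \<inter> (\<lambda>y. f (g1 y)) -` U2)"
    using o1(2) oU2 by (rule continuous_open_preimage)
  moreover have "(0, 0, 0) \<in> V1 \<inter> (\<lambda>y. f (g1 y)) -` U2" using 0 U2(1) by (simp add: g10)
  ultimately have "\<forall>\<^sub>F y in nhds (0, 0, 0). y \<in> V1 \<inter> (\<lambda>y. f (g1 y)) -` U2"
    by (rule eventually_nhds_in_open)
  then have ev: "\<forall>\<^sub>F y in nhds (0, 0, 0). f (g1 y) \<in> U2 \<and>
      \<Phi> (f (g1 y)) = (case y of (t, s, r) \<Rightarrow> vector [t, s, r^2, t * r])"
  proof eventually_elim
    case (elim y)
    then have "g1 y \<in> S'" "\<phi> (g1 y) = y" using h1 U1(1) by (auto simp: homeomorphism_def)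
    then show ?case using conj[of "g1 y"] elim by simp
  qed
  show ?thesis
    unfolding whitney_umbrella_interval_def A_equivalent_def
    by (rule exI[of _ U1], rule exI[of _ V1], rule exI[of _ \<phi>], rule exI[of _ g1],
        rule exI[of _ U2], rule exI[of _ V2], rule exI[of _ \<Phi>], rule exI[of _ g2])
      (use U1 U2 phi0 conj[OF xS'] ev in simp)
qed

text \<open>Dual form of the second intrinsic derivative. In the normal form the kernel is the
  \<open>r\<close>-direction and the cokernel is spanned by the last two axes. The
  \<open>r\<close>-derivatives of \<open>r\<^sup>2\<close> and \<open>t * r\<close> are
  \<open>2 * r\<close> and \<open>t\<close>, whose differentials are independent, so a covector that
  kills the image and this first variation is zero.\<close>

theorem whitney_umbrella_interval_second_order:
  fixes f :: "real \<times> real \<times> real \<Rightarrow> real^4"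
  assumes wu: "whitney_umbrella_interval f x0" and S: "open S" "x0 \<in> S" "smooth_on S f"
    and n: "\<And>v. n \<bullet> frechet_derivative f (at x0) v = 0"
    and eta: "frechet_derivative f (at x0) \<eta> = 0" "\<eta> \<noteq> 0"
    and D: "((\<lambda>x. n \<bullet> frechet_derivative f (at x) \<eta>) has_derivative (\<lambda>v. 0)) (at x0)"
  shows "n = 0"
proof -
  let ?g = "\<lambda>(t, s, r). vector [t, s, r^2, t * r] :: real^4"
  obtain U V \<phi> \<phi>' U' V' \<Phi> \<Phi>' where phi: "diffeomorphism U V \<phi> \<phi>'" "x0 \<in> U" "\<phi> x0 = (0, 0, 0)"
    and Phi: "diffeomorphism U' V' \<Phi> \<Phi>'" "f x0 \<in> U'" "\<Phi> (f x0) = ?g (0, 0, 0)"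
    and ev: "\<forall>\<^sub>F y in nhds (0, 0, 0). f (\<phi>' y) \<in> U' \<and> \<Phi> (f (\<phi>' y)) = ?g y"
    using wu unfolding whitney_umbrella_interval_def A_equivalent_def by blast
  have o: "open U" "open V'" and sphi: "smooth_on U \<phi>" and sPhi: "smooth_on V' \<Phi>'"
    and hphi: "homeomorphism U V \<phi> \<phi>'" and hPhi: "homeomorphism U' V' \<Phi> \<Phi>'"
    using phi(1) Phi(1) by (auto simp: diffeomorphism_def)
  define t where "t = (\<lambda>x. fst (\<phi> x))"
  define s where "s = (\<lambda>x. fst (snd (\<phi> x)))"
  define r where "r = (\<lambda>x. snd (snd (\<phi> x)))"
  define G where "G = (\<lambda>x. vector [t x, s x, (r x)\<^sup>2, t x * r x] :: real^4)"
  have G: "G x = ?g (\<phi> x)" for x by (simp add: G_def t_def s_def r_def split_def)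
  have str: "smooth_on U t" "smooth_on U s" "smooth_on U r"
    unfolding t_def s_def r_def by (intro smooth_intros o sphi)+
  have sG: "smooth_on U G" unfolding G_def by (intro smooth_on_vector_4 smooth_intros o str)
  have "isCont \<phi> x0"
    using smooth_on_continuous_on[OF sphi] o(1) phi(2) by (simp add: continuous_on_eq_continuous_at)
  then have "filterlim \<phi> (nhds (0, 0, 0)) (nhds x0)"
    using tendsto_at_iff_tendsto_nhds[of \<phi> x0] by (simp add: phi(3) continuous_at)
  from eventually_compose_filterlim[OF ev this] eventually_nhds_in_open[OF o(1) phi(2)]
  have "\<forall>\<^sub>F x in nhds x0. x \<in> U \<and> f (\<phi>' (\<phi> x)) \<in> U' \<and> \<Phi> (f (\<phi>' (\<phi> x))) = G x"
    by eventually_elim (simp add: G)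
  then obtain N where N: "open N" "x0 \<in> N"
    "\<And>x. x \<in> N \<Longrightarrow> x \<in> U \<and> f (\<phi>' (\<phi> x)) \<in> U' \<and> \<Phi> (f (\<phi>' (\<phi> x))) = G x"
    unfolding eventually_nhds by blast
  have N': "x \<in> U" "G x \<in> V'" "f x = \<Phi>' (G x)" if "x \<in> N" for x
  proof -
    have "\<phi>' (\<phi> x) = x" using N(3)[OF that] hphi by (auto simp: homeomorphism_def)
    then have "x \<in> U" "f x \<in> U'" "\<Phi> (f x) = G x" using N(3)[OF that] by auto
    moreover have "\<Phi> (f x) \<in> V'" "\<Phi>' (\<Phi> (f x)) = f x"
      using hPhi \<open>f x \<in> U'\<close> by (auto simp: homeomorphism_def)
    ultimately show "x \<in> U" "G x \<in> V'" "f x = \<Phi>' (G x)" by auto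
  qed
  let ?D = "\<lambda>F x. frechet_derivative F (at x)"
  have dt: "(t has_derivative ?D t x) (at x)" and ds: "(s has_derivative ?D s x) (at x)"
    and dr: "(r has_derivative ?D r x) (at x)" if "x \<in> U" for x
    using str that by (auto intro: smooth_on_has_derivative)
  have Dphi: "?D \<phi> x v = (?D t x v, ?D s x v, ?D r x v)" if "x \<in> U" for x v
  proof -
    have "((\<lambda>x. (t x, s x, r x)) has_derivative (\<lambda>v. (?D t x v, ?D s x v, ?D r x v))) (at x)"
      by (intro has_derivative_Pair dt ds dr that)
    then have "(\<phi> has_derivative (\<lambda>v. (?D t x v, ?D s x v, ?D r x v))) (at x)"
      by (simp add: t_def s_def r_def)
    from fun_cong[OF frechet_derivative_at[OF this], of v] show ?thesis by (rule sym)
  qed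
  define DG where "DG = (\<lambda>x v. vector [?D t x v, ?D s x v, r x * ?D r x v + ?D r x v * r x, t x * ?D r x v + ?D t x v * r x] :: real^4)"
  have dG: "(G has_derivative DG x) (at x)" if "x \<in> U" for x
    unfolding G_def DG_def power2_eq_square
    by (intro has_derivative_vector_4 has_derivative_mult dt ds dr that)
  \<comment> \<open>The components of the covector \<open>n\<close>, pulled back to the target
    coordinates of the normal form.\<close>
  define m where "m = (\<lambda>i y. n \<bullet> ?D \<Phi>' y (axis i 1))"
  have Df: "?D f x v = ?D \<Phi>' (G x) (DG x v)" if "x \<in> N" for x v
  proof -
    have "((\<lambda>x. \<Phi>' (G x)) has_derivative (\<lambda>v. ?D \<Phi>' (G x) (DG x v))) (at x)"
      by (rule has_derivative_compose[OF dG[OF N'(1)[OF that]] smooth_on_has_derivative[OF sPhi N'(2)[OF that]]])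
    then have "(f has_derivative (\<lambda>v. ?D \<Phi>' (G x) (DG x v))) (at x)"
      by (rule has_derivative_transform_within_open[OF _ N(1) that]) (simp add: N'(3))
    from fun_cong[OF frechet_derivative_at[OF this], of v] show ?thesis by (rule sym)
  qed
  have linP: "linear (?D \<Phi>' y)" if "y \<in> V'" for y
    using smooth_on_has_derivative[OF sPhi that] by (rule has_derivative_linear)
  have nDf: "n \<bullet> ?D f x v = m 1 (G x) * ?D t x v + m 2 (G x) * ?D s x v + m 3 (G x) * (r x * ?D r x v + ?D r x v * r x)
      + m 4 (G x) * (t x * ?D r x v + ?D t x v * r x)" if "x \<in> N" for x v
    unfolding Df[OF that] DG_def vector_4_axis m_def
    by (simp add: linear_add[OF linP[OF N'(2)[OF that]]] linear_scale[OF linP[OF N'(2)[OF that]]] inner_add_right mult.commute)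
  have z0: "t x0 = 0" "s x0 = 0" "r x0 = 0" by (simp_all add: t_def s_def r_def phi(3))
  have ontoD: "\<exists>v. ?D t x0 v = a \<and> ?D s x0 v = b \<and> ?D r x0 v = c" for a b c
  proof -
    have "?D \<phi> x0 (?D \<phi>' (\<phi> x0) (a, b, c)) = (a, b, c)"
      by (rule diffeomorphism_derivative_inverse(2)[OF phi(1,2)])
    then show ?thesis unfolding Dphi[OF phi(2)] by blast
  qed
  have m12: "m 1 (G x0) = 0" "m 2 (G x0) = 0"
  proof -
    obtain v where "?D t x0 v = 1" "?D s x0 v = 0" "?D r x0 v = 0" using ontoD by blast
    then show "m 1 (G x0) = 0" using nDf[OF N(2), of v] n[of v] by (simp add: z0)
    obtain v where "?D t x0 v = 0" "?D s x0 v = 1" "?D r x0 v = 0" using ontoD by blast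
    then show "m 2 (G x0) = 0" using nDf[OF N(2), of v] n[of v] by (simp add: z0)
  qed
  have P0: "\<Phi> (f x0) = G x0" using Phi(3) phi(3) by (simp add: G)
  have "DG x0 \<eta> = 0"
    using diffeomorphism_derivative_inverse(2)[OF Phi(1,2), of "DG x0 \<eta>"] Df[OF N(2), of \<eta>] eta(1)
      linear_0[OF has_derivative_linear[OF smooth_on_has_derivative[of U' \<Phi> "f x0"]]] Phi
    by (simp add: P0 diffeomorphism_def)
  then have w: "?D t x0 \<eta> = 0" "?D s x0 \<eta> = 0" by (simp_all add: DG_def vector_4_eq_0_iff)
  have w3: "?D r x0 \<eta> \<noteq> 0"
  proof
    assume "?D r x0 \<eta> = 0"
    then have "?D \<phi> x0 \<eta> = 0" by (simp add: Dphi[OF phi(2)] w zero_prod_def)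
    then have "\<eta> = ?D \<phi>' (\<phi> x0) 0"
      using diffeomorphism_derivative_inverse(1)[OF phi(1,2), of \<eta>] by simp
    moreover have "linear (?D \<phi>' (\<phi> x0))"
      using phi(1,2) by (intro has_derivative_linear[OF smooth_on_has_derivative])
        (auto simp: diffeomorphism_def homeomorphism_def)
    ultimately show False using eta(2) linear_0 by metis
  qed
  have dm: "((\<lambda>x. m i (G x)) has_derivative ?D (\<lambda>x. m i (G x)) x0) (at x0)" for i
  proof -
    have "smooth_on N (\<lambda>x. ?D \<Phi>' (G x) (axis i 1))"
      by (rule smooth_on_compose[OF smooth_on_derivative[OF sPhi] o(2) N(1) smooth_on_subset[OF sG]])
        (use N' in auto)
    then have "smooth_on N (\<lambda>x. m i (G x))" unfolding m_def by (intro smooth_intros N)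
    then show ?thesis using N(2) by (rule smooth_on_has_derivative)
  qed
  have dw: "((\<lambda>x. ?D F x \<eta>) has_derivative ?D (\<lambda>x. ?D F x \<eta>) x0) (at x0)" if "smooth_on U F" for F :: "_ \<Rightarrow> real"
    using smooth_on_derivative[OF that] phi(2) by (rule smooth_on_has_derivative)
  note dt0 = dt[OF phi(2)] and dr0 = dr[OF phi(2)]
  note dw = dw[OF str(1)] dw[OF str(2)] dw[OF str(3)]
  \<comment> \<open>In the first two products both factors vanish at \<open>x0\<close>, and the
    bracketed factors of the other two vanish there; hence no derivative of any \<open>m i\<close>
    survives.\<close>
  have "((\<lambda>x. m 1 (G x) * ?D t x \<eta> + m 2 (G x) * ?D s x \<eta> + m 3 (G x) * (r x * ?D r x \<eta> + ?D r x \<eta> * r x)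
      + m 4 (G x) * (t x * ?D r x \<eta> + ?D t x \<eta> * r x)) has_derivative
      (\<lambda>v. m 3 (G x0) * (?D r x0 v * ?D r x0 \<eta> + ?D r x0 \<eta> * ?D r x0 v) + m 4 (G x0) * (?D t x0 v * ?D r x0 \<eta>))) (at x0)"
    using has_derivative_add[OF has_derivative_add[OF has_derivative_add[OF
          has_derivative_mult[OF dm[of 1] dw(1)] has_derivative_mult[OF dm[of 2] dw(2)]]
          has_derivative_mult[OF dm[of 3] has_derivative_add[OF
            has_derivative_mult[OF dr0 dw(3)] has_derivative_mult[OF dw(3) dr0]]]]
          has_derivative_mult[OF dm[of 4] has_derivative_add[OF
            has_derivative_mult[OF dt0 dw(3)] has_derivative_mult[OF dw(1) dr0]]]]
    by (simp add: m12 w z0)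
  then have "((\<lambda>x. n \<bullet> ?D f x \<eta>) has_derivative
      (\<lambda>v. m 3 (G x0) * (?D r x0 v * ?D r x0 \<eta> + ?D r x0 \<eta> * ?D r x0 v) + m 4 (G x0) * (?D t x0 v * ?D r x0 \<eta>))) (at x0)"
    by (rule has_derivative_transform_within_open[OF _ N(1,2)]) (simp add: nDf)
  from fun_cong[OF has_derivative_unique[OF this D]]
  have q: "m 3 (G x0) * (?D r x0 v * ?D r x0 \<eta> + ?D r x0 \<eta> * ?D r x0 v) + m 4 (G x0) * (?D t x0 v * ?D r x0 \<eta>) = 0" for v .
  have "m 3 (G x0) = 0"
  proof -
    obtain v where "?D t x0 v = 0" "?D s x0 v = 0" "?D r x0 v = 1" using ontoD by blast
    then show ?thesis using q[of v] w3 by simp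
  qed
  moreover have "m 4 (G x0) = 0"
  proof -
    obtain v where "?D t x0 v = 1" "?D s x0 v = 0" "?D r x0 v = 0" using ontoD by blast
    then show ?thesis using q[of v] w3 by simp
  qed
  ultimately have mi: "m i (G x0) = 0" for i using m12 exhaust_4[of i] by auto
  have "n \<bullet> ?D \<Phi>' (G x0) y = 0" for y
  proof -
    have "y = (\<Sum>i\<in>UNIV. (y $ i) *\<^sub>R axis i 1)" by (simp add: basis_expansion scalar_mult_eq_scaleR[symmetric])
    then have "?D \<Phi>' (G x0) y = (\<Sum>i\<in>UNIV. (y $ i) *\<^sub>R ?D \<Phi>' (G x0) (axis i 1))"
      by (metis (no_types, lifting) linear_sum[OF linP[OF N'(2)[OF N(2)]]] linear_scale[OF linP[OF N'(2)[OF N(2)]]] sum.cong)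
    then show ?thesis using mi by (simp add: inner_sum_right m_def)
  qed
  from this[of "?D \<Phi> (f x0) n"] have "n \<bullet> n = 0"
    using diffeomorphism_derivative_inverse(1)[OF Phi(1,2), of n] by (simp add: P0)
  then show ?thesis by simp
qed

section \<open>Frames of two-ruled hypersurfaces\<close>

lemma orthogonal_four_total:
  fixes e1 e2 e3 e4 :: "real^4"
  assumes o: "e1 \<bullet> e2 = 0" "e1 \<bullet> e3 = 0" "e1 \<bullet> e4 = 0" "e2 \<bullet> e3 = 0" "e2 \<bullet> e4 = 0" "e3 \<bullet> e4 = 0"
    and nz: "e1 \<noteq> 0" "e2 \<noteq> 0" "e3 \<noteq> 0" "e4 \<noteq> 0"
    and y: "e1 \<bullet> y = 0" "e2 \<bullet> y = 0" "e3 \<bullet> y = 0" "e4 \<bullet> y = 0"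
  shows "y = 0"
proof -
  let ?B = "{e1, e2, e3, e4}"
  have ne: "e1 \<noteq> e2" "e1 \<noteq> e3" "e1 \<noteq> e4" "e2 \<noteq> e3" "e2 \<noteq> e4" "e3 \<noteq> e4"
    using o nz by auto
  have "independent ?B"
    by (rule pairwise_orthogonal_independent)
      (use o nz in \<open>auto simp: pairwise_def orthogonal_def inner_commute\<close>)
  moreover have "card ?B = 4" using ne by simp
  ultimately have "UNIV \<subseteq> span ?B"
    by (intro card_ge_dim_independent) auto
  then have "y \<in> span ?B" by blast
  then have "orthogonal y y"
    by (rule orthogonal_to_span) (use y in \<open>auto simp: orthogonal_def inner_commute\<close>)
  then show ?thesis by (simp add: orthogonal_def)
qed

text \<open>The determinant is linear in its first row; expand \<open>w\<close> in the standard
  basis.\<close>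

lemma inner_wedge3: "w \<bullet> wedge3 u v x = det (vector [w, u, v, x] :: real^4^4)"
proof -
  have vec: "(vector [z, u, v, x] :: real^4^4) = (\<chi> i. if i = 1 then z else vector [0, u, v, x] $ i)" for z
    by (simp add: vec_eq_iff forall_4)
  have "det (vector [w, u, v, x] :: real^4^4) = det (\<chi> i. if i = 1 then \<Sum>j\<in>UNIV. (w $ j) *s axis j 1 else vector [0, u, v, x] $ i)"
    unfolding vec[of w] basis_expansion ..
  also have "\<dots> = (\<Sum>j\<in>UNIV. det (\<chi> i. if i = 1 then (w $ j) *s axis j 1 else vector [0, u, v, x] $ i))"
    by (rule det_linear_row_sum) simp
  also have "\<dots> = (\<Sum>j\<in>UNIV. w $ j * wedge3 u v x $ j)"
  proof (rule sum.cong[OF refl])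
    fix j :: 4
    have "det (\<chi> i. if i = 1 then (w $ j) *s axis j 1 else vector [0, u, v, x] $ i)
      = w $ j * det (\<chi> i. if i = 1 then axis j 1 else vector [0, u, v, x] $ i)"
      by (rule det_row_mul)
    then show "det (\<chi> i. if i = 1 then (w $ j) *s axis j 1 else vector [0, u, v, x] $ i)
      = w $ j * wedge3 u v x $ j"
      by (simp only: wedge3_def vec_lambda_beta vec[symmetric])
  qed
  finally show ?thesis by (simp add: inner_vec_def)
qed

lemma inner_wedge3_self [simp]:
  "u \<bullet> wedge3 u v x = 0" "v \<bullet> wedge3 u v x = 0" "x \<bullet> wedge3 u v x = 0"
proof -
  show "u \<bullet> wedge3 u v x = 0"
    unfolding inner_wedge3 by (rule det_identical_rows[of 1 2]) (simp_all add: row_def)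
  show "v \<bullet> wedge3 u v x = 0"
    unfolding inner_wedge3 by (rule det_identical_rows[of 1 3]) (simp_all add: row_def)
  show "x \<bullet> wedge3 u v x = 0"
    unfolding inner_wedge3 by (rule det_identical_rows[of 1 4]) (simp_all add: row_def)
qed

text \<open>Pair it with a nonzero \<open>w\<close> orthogonal to \<open>u\<close>,
  \<open>v\<close>, \<open>x\<close>: a matrix with four nonzero orthogonal rows has trivial
  kernel.\<close>

lemma wedge3_nonzero:
  assumes o: "u \<bullet> v = 0" "u \<bullet> x = 0" "v \<bullet> x = 0" and nz: "u \<noteq> 0" "v \<noteq> 0" "x \<noteq> 0"
  shows "wedge3 u v x \<noteq> 0"
proof -
  have "dim {u, v, x} \<le> card {u, v, x}" by (rule dim_le_card') simp
  also have "\<dots> \<le> 3" by (simp add: card_insert_if)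
  finally have "dim {u, v, x} < DIM(real^4)" by simp
  then obtain w where w: "w \<noteq> 0" "\<And>y. y \<in> span {u, v, x} \<Longrightarrow> orthogonal w y"
    by (rule orthogonal_to_subspace_exists) blast
  have wo: "w \<bullet> u = 0" "w \<bullet> v = 0" "w \<bullet> x = 0"
    using w(2) by (auto simp: orthogonal_def span_base)
  let ?M = "vector [w, u, v, x] :: real^4^4"
  have "y = 0" if "?M *v y = 0" for y
  proof -
    have "?M $ i \<bullet> y = 0" for i using arg_cong[OF that, of "\<lambda>z. z $ i"] by (simp add: matrix_vector_mul_component)
    from this[of 1] this[of 2] this[of 3] this[of 4]
    show ?thesis by (intro orthogonal_four_total[OF wo o w(1) nz]) simp_all
  qed
  then have "det ?M \<noteq> 0"
    by (simp add: invertible_det_nz[symmetric] invertible_left_inverse matrix_left_invertible_ker)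
  then show ?thesis by (auto simp flip: inner_wedge3)
qed

lemma smooth_on_vec_nth: "open S \<Longrightarrow> smooth_on S f \<Longrightarrow> smooth_on S (\<lambda>x. f x $ i)"
  by (rule smooth_on_bounded_linear_comp[OF bounded_linear_vec_nth])

lemma smooth_on_wedge3:
  assumes S: "open S" and f: "smooth_on S f" "smooth_on S g" "smooth_on S h"
  shows "smooth_on S (\<lambda>x. wedge3 (f x) (g x) (h x))"
proof -
  have entry: "smooth_on S (\<lambda>x. (vector [axis i 1, f x, g x, h x] :: real^4^4) $ j $ k)" for i j k
  proof -
    consider "j = 1" | "j = 2" | "j = 3" | "j = 4" using exhaust_4[of j] by blast
    then show ?thesis
      by cases (simp_all add: smooth_on_const smooth_on_vec_nth S f)
  qed
  have "smooth_on S (\<lambda>x. wedge3 (f x) (g x) (h x) $ i)" for i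
    unfolding wedge3_def vec_lambda_beta det_def
    by (intro smooth_on_sum smooth_on_mult smooth_on_const smooth_on_prod entry S)
  then have "smooth_on S (\<lambda>x. \<Sum>i\<in>UNIV. (wedge3 (f x) (g x) (h x) $ i) *\<^sub>R axis i (1::real))"
    by (intro smooth_intros S)
  moreover have eq: "(\<Sum>i\<in>UNIV. (y $ i) *\<^sub>R axis i 1) = y" for y :: "real^4"
    using basis_expansion[of y] by (simp add: scalar_mult_eq_scaleR)
  ultimately show ?thesis by (simp only: eq)
qed

section \<open>Calculus along curves\<close>

lemma smooth_curve_has_vector_derivative:
  assumes "smooth_on I c" "t \<in> I"
  shows "(c has_vector_derivative curve_deriv c t) (at t)"
  using smooth_on_has_derivative[OF assms] differentiableI vector_derivative_works by blast

lemma smooth_on_curve_deriv: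
  assumes "open I" "smooth_on I c"
  shows "smooth_on I (curve_deriv c)"
proof (rule smooth_on_cong[OF assms(1) _ smooth_on_derivative[OF assms(2), of 1]])
  show "frechet_derivative c (at t) 1 = curve_deriv c t" if "t \<in> I" for t
    using fun_cong[OF has_derivative_unique[OF smooth_on_has_derivative[OF assms(2) that]
          smooth_curve_has_vector_derivative[OF assms(2) that, unfolded has_vector_derivative_def]], of 1]
    by simp
qed

lemma inner_curve_has_real_derivative:
  assumes "smooth_on I c" "smooth_on I d" "t \<in> I"
  shows "((\<lambda>t. c t \<bullet> d t) has_real_derivative curve_deriv c t \<bullet> d t + c t \<bullet> curve_deriv d t) (at t)"
  using bounded_bilinear.has_vector_derivative[OF bounded_bilinear_inner
      smooth_curve_has_vector_derivative[OF assms(1,3)] smooth_curve_has_vector_derivative[OF assms(2,3)]]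
  by (simp add: has_real_derivative_iff_has_vector_derivative add.commute)

lemma smooth_real_has_real_derivative:
  fixes q :: "real \<Rightarrow> real"
  assumes "smooth_on I q" "t \<in> I"
  shows "(q has_real_derivative deriv q t) (at t)"
proof -
  obtain D where "(q has_real_derivative D) (at t)"
    using differentiableI[OF smooth_on_has_derivative[OF assms]] by (rule real_differentiableE)
  then show ?thesis by (simp add: DERIV_imp_deriv)
qed

lemma hadamard_real:
  fixes q :: "real \<Rightarrow> real"
  assumes q: "smooth_on UNIV q" "q 0 = 0" and d: "(q has_real_derivative d) (at 0)"
  obtains l where "smooth_on UNIV l" "\<And>t. q t = t * l t" "l 0 = d"
proof -
  let ?K = "\<lambda>z :: real \<times> real. q (snd z)"
  have K: "smooth_on UNIV ?K" by (rule smooth_on_compose[OF q(1)]) (auto intro!: smooth_intros)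
  obtain L where L: "smooth_on UNIV L" "\<And>p t. ?K (p, t) = t * L (p, t)"
    "\<And>p. L (p, 0) = frechet_derivative ?K (at (p, 0)) (0, 1)"
    by (rule hadamard[OF K]) (use q(2) in auto)
  have "((\<lambda>t. ?K (0, t)) has_real_derivative L (0, 0)) (at 0)"
    unfolding L(3) by (rule smooth_on_imp_has_real_derivative_snd[OF K]) simp
  then have "L (0, 0) = d" using d DERIV_unique by fastforce
  moreover have "smooth_on UNIV (\<lambda>t. L (0, t))"
    by (rule smooth_on_compose[OF L(1)]) (auto intro!: smooth_intros)
  ultimately show ?thesis using that[of "\<lambda>t. L (0, t)"] L(2)[of 0] by simp
qed

section \<open>The moving frame along the director curves\<close>

locale ruled_frame =
  fixes I :: "real set" and \<gamma> X Y :: "real \<Rightarrow> real^4" and a b1 b2 b3 b4 :: "real \<Rightarrow> real"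
  assumes data: "two_ruled_data I \<gamma> X Y" and adapted: "constrictively_adapted I X Y"
    and norm: "normalised I X Y" and assoc: "associated_functions I \<gamma> X Y a b1 b2 b3 b4"
begin

abbreviation "X' \<equiv> curve_deriv X"
abbreviation "Y' \<equiv> curve_deriv Y"
abbreviation "\<gamma>' \<equiv> curve_deriv \<gamma>"
abbreviation "Z \<equiv> \<lambda>t. wedge3 (X t) (Y t) (X' t)"
abbreviation "f \<equiv> two_ruled \<gamma> X Y"

lemma I: "open I" "0 \<in> I" and smooth: "smooth_on I \<gamma>" "smooth_on I X" "smooth_on I Y" and \<gamma>0: "\<gamma> 0 = 0"
  using data by (auto simp: two_ruled_data_def)

lemma smooth': "smooth_on I \<gamma>'" "smooth_on I X'" "smooth_on I Y'" "smooth_on I Z"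
  using smooth_on_curve_deriv[OF I(1)] smooth smooth_on_wedge3[OF I(1)] by auto

lemma deriv_Y: "t \<in> I \<Longrightarrow> Y' t = a t *\<^sub>R X' t"
  and deriv_\<gamma>: "t \<in> I \<Longrightarrow> \<gamma>' t = b1 t *\<^sub>R X t + b2 t *\<^sub>R Y t + b3 t *\<^sub>R X' t + b4 t *\<^sub>R Z t"
  using assoc by (auto simp: associated_functions_def Let_def)

lemma unit: "t \<in> I \<Longrightarrow> X t \<bullet> X t = 1" "t \<in> I \<Longrightarrow> Y t \<bullet> Y t = 1" "t \<in> I \<Longrightarrow> X' t \<bullet> X' t = 1"
  using adapted norm by (auto simp: constrictively_adapted_def normalised_def norm_eq_1)

lemma XY: "t \<in> I \<Longrightarrow> X t \<bullet> Y t = 0" "t \<in> I \<Longrightarrow> Y t \<bullet> X t = 0"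
  using adapted by (auto simp: constrictively_adapted_def inner_commute)

text \<open>Source of the orthogonality relations: \<open>X \<bullet> X = 1\<close> gives
  \<open>X \<bullet> X' = 0\<close>, and \<open>X \<bullet> Y = 0\<close> together with
  \<open>X \<bullet> Y' = 0\<close> gives \<open>Y \<bullet> X' = 0\<close>.\<close>

lemma inner_constant_derivative:
  assumes "smooth_on I c" "smooth_on I d" "\<And>t. t \<in> I \<Longrightarrow> c t \<bullet> d t = k" "t \<in> I"
  shows "curve_deriv c t \<bullet> d t + c t \<bullet> curve_deriv d t = 0"
proof -
  have "((\<lambda>t. k) has_real_derivative curve_deriv c t \<bullet> d t + c t \<bullet> curve_deriv d t) (at t)"
    by (rule has_field_derivative_transform_within_open[OF
          inner_curve_has_real_derivative[OF assms(1,2,4)] I(1) assms(4)]) (rule assms(3))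
  from DERIV_unique[OF this DERIV_const] show ?thesis .
qed

lemma XX': "t \<in> I \<Longrightarrow> X t \<bullet> X' t = 0" "t \<in> I \<Longrightarrow> X' t \<bullet> X t = 0"
  using inner_constant_derivative[OF smooth(2,2) unit(1)] by (auto simp: inner_commute)

lemma YX': "t \<in> I \<Longrightarrow> Y t \<bullet> X' t = 0" "t \<in> I \<Longrightarrow> X' t \<bullet> Y t = 0"
proof -
  assume t: "t \<in> I"
  have "X t \<bullet> Y' t = 0" using adapted t by (auto simp: constrictively_adapted_def)
  then show "Y t \<bullet> X' t = 0" "X' t \<bullet> Y t = 0"
    using inner_constant_derivative[OF smooth(2,3) XY(1) t] by (auto simp: inner_commute)
qed

lemma nonzero: "t \<in> I \<Longrightarrow> X t \<noteq> 0" "t \<in> I \<Longrightarrow> Y t \<noteq> 0" "t \<in> I \<Longrightarrow> X' t \<noteq> 0"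
  using unit by fastforce+

lemma Z_nonzero: "t \<in> I \<Longrightarrow> Z t \<noteq> 0"
  by (intro wedge3_nonzero XY XX' YX' nonzero)

lemma Z_inner: "X t \<bullet> Z t = 0" "Y t \<bullet> Z t = 0" "X' t \<bullet> Z t = 0" "Z t \<bullet> X t = 0" "Z t \<bullet> Y t = 0" "Z t \<bullet> X' t = 0"
  by (simp_all add: inner_commute[of "Z t"])

lemmas frame = unit XY XX' YX' Z_inner

lemma frame_total:
  assumes "t \<in> I" "X t \<bullet> y = 0" "Y t \<bullet> y = 0" "X' t \<bullet> y = 0" "Z t \<bullet> y = 0"
  shows "y = 0"
  by (rule orthogonal_four_total[of "X t" "Y t" "X' t" "Z t"])
    (use assms in \<open>auto simp: frame nonzero Z_nonzero\<close>)

text \<open>The associated functions are given by pointwise equations; they are recovered as inner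
  products with the frame, divided by \<open>Z t \<bullet> Z t\<close> in the case of
  \<open>b4\<close>.\<close>

lemma smooth_coefficients: "smooth_on I a" "smooth_on I b1" "smooth_on I b2" "smooth_on I b3" "smooth_on I b4"
proof -
  show "smooth_on I a"
    by (rule smooth_on_cong[OF I(1), of "\<lambda>t. Y' t \<bullet> X' t"]) (auto simp: deriv_Y frame intro!: smooth_intros smooth' I)
  show "smooth_on I b1"
    by (rule smooth_on_cong[OF I(1), of "\<lambda>t. \<gamma>' t \<bullet> X t"])
      (auto simp: deriv_\<gamma> frame inner_add_left intro!: smooth_intros smooth smooth' I)
  show "smooth_on I b2"
    by (rule smooth_on_cong[OF I(1), of "\<lambda>t. \<gamma>' t \<bullet> Y t"])
      (auto simp: deriv_\<gamma> frame inner_add_left intro!: smooth_intros smooth smooth' I)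
  show "smooth_on I b3"
    by (rule smooth_on_cong[OF I(1), of "\<lambda>t. \<gamma>' t \<bullet> X' t"])
      (auto simp: deriv_\<gamma> frame inner_add_left intro!: smooth_intros smooth smooth' I)
  show "smooth_on I b4"
    by (rule smooth_on_cong[OF I(1), of "\<lambda>t. (\<gamma>' t \<bullet> Z t) / (Z t \<bullet> Z t)"])
      (auto simp: deriv_\<gamma> frame inner_add_left Z_nonzero intro!: smooth_on_divide smooth_intros smooth smooth' I)
qed

section \<open>Derivative and singular points of the hypersurface\<close>

lemma open_slab: "open J \<Longrightarrow> open (fst -` J :: (real \<times> real \<times> real) set)"
  by (intro open_vimage continuous_intros)

lemma smooth_on_slab: "open J \<Longrightarrow> smooth_on J c \<Longrightarrow> smooth_on (fst -` J) (\<lambda>x :: real \<times> real \<times> real. c (fst x))"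
  by (rule smooth_on_compose[OF _ _ open_slab]) (auto intro!: smooth_intros open_slab)

lemma f_eq: "f x = \<gamma> (fst x) + fst (snd x) *\<^sub>R X (fst x) + snd (snd x) *\<^sub>R Y (fst x)"
  by (simp add: two_ruled_def split_def)

lemma smooth_f: "smooth_on (fst -` I) f"
  unfolding f_eq[abs_def] by (intro smooth_intros smooth_on_slab smooth I open_slab)

text \<open>The partial derivative of \<open>f\<close> in \<open>t\<close>, for \<open>fst x\<close>
  in \<open>I\<close>, expanded in the frame; by \<open>Y' = a X'\<close> both rulings contribute to
  the coefficient of \<open>X'\<close>.\<close>

definition f_t :: "real \<times> real \<times> real \<Rightarrow> real^4" where
  "f_t x = b1 (fst x) *\<^sub>R X (fst x) + b2 (fst x) *\<^sub>R Y (fst x)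
    + (b3 (fst x) + fst (snd x) + a (fst x) * snd (snd x)) *\<^sub>R X' (fst x) + b4 (fst x) *\<^sub>R Z (fst x)"

lemma Df:
  assumes "fst x \<in> I"
  shows "frechet_derivative f (at x) v = fst v *\<^sub>R f_t x + fst (snd v) *\<^sub>R X (fst x) + snd (snd v) *\<^sub>R Y (fst x)"
proof -
  have c: "((\<lambda>x. c (fst x)) has_derivative (\<lambda>v. fst v *\<^sub>R curve_deriv c (fst x))) (at x)" if "smooth_on I c" for c
    by (rule has_derivative_compose[OF has_derivative_fst[OF has_derivative_ident]
          smooth_curve_has_vector_derivative[OF that assms, unfolded has_vector_derivative_def]])
  have "(f has_derivative (\<lambda>v. fst v *\<^sub>R \<gamma>' (fst x)
      + (fst (snd x) *\<^sub>R (fst v *\<^sub>R X' (fst x)) + fst (snd v) *\<^sub>R X (fst x))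
      + (snd (snd x) *\<^sub>R (fst v *\<^sub>R Y' (fst x)) + snd (snd v) *\<^sub>R Y (fst x)))) (at x)"
    unfolding f_eq[abs_def]
    by (intro has_derivative_add has_derivative_scaleR has_derivative_fst has_derivative_snd
        has_derivative_ident c smooth)
  from fun_cong[OF frechet_derivative_at[OF this], of v, symmetric]
  show ?thesis by (simp add: deriv_\<gamma>[OF assms] deriv_Y[OF assms] f_t_def algebra_simps)
qed

text \<open>The image of the derivative is spanned by \<open>X 0\<close>, \<open>Y 0\<close> and the
  part \<open>w\<close> of \<open>f_t\<close> orthogonal to them. Rank below three forces
  \<open>w = 0\<close>, and \<open>X' 0\<close>, \<open>Z 0\<close> are independent.\<close>

lemma singular_imp:
  assumes "singular_point f (0, s, r)"
  shows "b4 0 = 0" "b3 0 + s + a 0 * r = 0"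
proof -
  define c where "c = b3 0 + s + a 0 * r"
  define w where "w = c *\<^sub>R X' 0 + b4 0 *\<^sub>R Z 0"
  let ?D = "frechet_derivative f (at (0, s, r))"
  have D: "?D v = fst v *\<^sub>R (b1 0 *\<^sub>R X 0 + b2 0 *\<^sub>R Y 0 + w) + fst (snd v) *\<^sub>R X 0 + snd (snd v) *\<^sub>R Y 0" for v
    using Df[of "(0, s, r)" v] I(2) by (simp add: f_t_def w_def c_def algebra_simps)
  have "w = 0"
  proof (rule ccontr)
    assume w: "w \<noteq> 0"
    have o: "X 0 \<bullet> w = 0" "Y 0 \<bullet> w = 0" using I(2) by (simp_all add: w_def inner_add_right frame)
    \<comment> \<open>The direction \<open>(1, - b1 0, - b2 0)\<close> removes the components of
      \<open>f_t\<close> along the ruling; at a singular point it spans the kernel.\<close>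
    have "X 0 = ?D (0, 1, 0)" "Y 0 = ?D (0, 0, 1)" "w = ?D (1, - b1 0, - b2 0)" by (simp_all add: D)
    then have sub: "{X 0, Y 0, w} \<subseteq> range ?D" by blast
    have ne: "X 0 \<noteq> Y 0" "X 0 \<noteq> w" "Y 0 \<noteq> w" using o w XY[OF I(2)] nonzero[OF I(2)] by auto
    have "independent {X 0, Y 0, w}"
      by (rule pairwise_orthogonal_independent)
        (use o w XY[OF I(2)] nonzero[OF I(2)] in \<open>auto simp: pairwise_def orthogonal_def inner_commute\<close>)
    from independent_card_le_dim[OF sub this] have "3 \<le> dim (range ?D)" using ne by simp
    then show False using assms by (simp add: singular_point_def)
  qed
  then have "X' 0 \<bullet> w = 0" "Z 0 \<bullet> w = 0" by simp_all
  then show "b4 0 = 0" "b3 0 + s + a 0 * r = 0"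
    using I(2) Z_nonzero[OF I(2)] by (simp_all add: w_def c_def inner_add_right frame)
qed

text \<open>The normal component of \<open>f_t\<close> with respect to the constant vector \<open>Z 0\<close> has \<open>b4' |Z 0|\<^sup>2\<close> as its
  only first order term, since the coefficient of \<open>X'\<close> and the product \<open>Z 0 \<bullet> X'\<close> both vanish.\<close>

lemma normal_component_has_derivative:
  assumes sing: "b4 0 = 0" "b3 0 + s + a 0 * r = 0"
  shows "((\<lambda>x. Z 0 \<bullet> (f_t x - c1 *\<^sub>R X (fst x) - c2 *\<^sub>R Y (fst x))) has_derivative
    (\<lambda>v. fst v * ((b1 0 - c1) * (Z 0 \<bullet> X' 0) + (b2 0 - c2) * (Z 0 \<bullet> Y' 0) + deriv b4 0 * (Z 0 \<bullet> Z 0)))) (at (0, s, r))"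
proof -
  let ?x = "(0, s, r) :: real \<times> real \<times> real"
  have fs: "((\<lambda>x. fst x) has_derivative fst) (at ?x)" by (intro has_derivative_fst has_derivative_ident)
  have q: "((\<lambda>x. q (fst x)) has_derivative (\<lambda>v. fst v * deriv q 0)) (at ?x)" if "smooth_on I q" for q :: "real \<Rightarrow> real"
    using has_derivative_compose[OF fs, of q "\<lambda>v. v * deriv q 0"]
      smooth_real_has_real_derivative[OF that I(2)]
    by (simp add: has_field_derivative_def mult_commute_abs)
  have zc: "((\<lambda>x. Z 0 \<bullet> c (fst x)) has_derivative (\<lambda>v. fst v * (Z 0 \<bullet> curve_deriv c 0))) (at ?x)" if "smooth_on I c" for c
    using has_derivative_inner_right[OF has_derivative_compose[OF fs, of c "\<lambda>v. v *\<^sub>R curve_deriv c 0"], of "Z 0"]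
      smooth_curve_has_vector_derivative[OF that I(2)]
    by (simp add: has_vector_derivative_def)
  have lin: "((\<lambda>x. fst (snd x)) has_derivative (\<lambda>v. fst (snd v))) (at ?x)"
    "((\<lambda>x. snd (snd x)) has_derivative (\<lambda>v. snd (snd v))) (at ?x)"
    by (intro has_derivative_fst has_derivative_snd has_derivative_ident)+
  have eq: "(\<lambda>x. Z 0 \<bullet> (f_t x - c1 *\<^sub>R X (fst x) - c2 *\<^sub>R Y (fst x))) = (\<lambda>x. (b1 (fst x) - c1) * (Z 0 \<bullet> X (fst x))
    + (b2 (fst x) - c2) * (Z 0 \<bullet> Y (fst x))
    + (b3 (fst x) + fst (snd x) + a (fst x) * snd (snd x)) * (Z 0 \<bullet> X' (fst x)) + b4 (fst x) * (Z 0 \<bullet> Z (fst x)))"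
    by (simp add: f_t_def inner_add_right inner_diff_right algebra_simps)
  have der: "((\<lambda>x. (b1 (fst x) - c1) * (Z 0 \<bullet> X (fst x))
    + (b2 (fst x) - c2) * (Z 0 \<bullet> Y (fst x))
    + (b3 (fst x) + fst (snd x) + a (fst x) * snd (snd x)) * (Z 0 \<bullet> X' (fst x)) + b4 (fst x) * (Z 0 \<bullet> Z (fst x)))
    has_derivative (\<lambda>v. ((b1 0 - c1) * (fst v * (Z 0 \<bullet> X' 0)) + (fst v * deriv b1 0 - 0) * (Z 0 \<bullet> X 0))
    + ((b2 0 - c2) * (fst v * (Z 0 \<bullet> Y' 0)) + (fst v * deriv b2 0 - 0) * (Z 0 \<bullet> Y 0))
    + ((b3 0 + s + a 0 * r) * (fst v * (Z 0 \<bullet> curve_deriv X' 0))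
       + (fst v * deriv b3 0 + fst (snd v) + (a 0 * snd (snd v) + fst v * deriv a 0 * r)) * (Z 0 \<bullet> X' 0))
    + (b4 0 * (fst v * (Z 0 \<bullet> curve_deriv Z 0)) + fst v * deriv b4 0 * (Z 0 \<bullet> Z 0)))) (at ?x)"
    using has_derivative_add[OF has_derivative_add[OF has_derivative_add[OF
          has_derivative_mult[OF has_derivative_diff[OF q[OF smooth_coefficients(2)] has_derivative_const[of c1]] zc[OF smooth(2)]]
          has_derivative_mult[OF has_derivative_diff[OF q[OF smooth_coefficients(3)] has_derivative_const[of c2]] zc[OF smooth(3)]]]
          has_derivative_mult[OF has_derivative_add[OF has_derivative_add[OF q[OF smooth_coefficients(4)] lin(1)]
              has_derivative_mult[OF q[OF smooth_coefficients(1)] lin(2)]] zc[OF smooth'(2)]]]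
          has_derivative_mult[OF q[OF smooth_coefficients(5)] zc[OF smooth'(4)]]]
    unfolding fst_conv snd_conv .
  show ?thesis unfolding eq
    by (rule has_derivative_eq_rhs[OF der], rule ext)
      (use I(2) in \<open>simp add: sing frame\<close>, simp add: algebra_simps)
qed

text \<open>If \<open>b4'\<close> vanished at \<open>0\<close>, the nonzero vector
  \<open>Z 0\<close> would meet all conditions on \<open>n\<close> in the second order test, with
  \<open>\<eta>\<close> the kernel direction \<open>(1, - b1 0, - b2 0)\<close>.\<close>

lemma umbrella_imp_deriv_nonzero:
  assumes wu: "whitney_umbrella_interval f (0, s, r)" and sing: "b4 0 = 0" "b3 0 + s + a 0 * r = 0"
  shows "deriv b4 0 \<noteq> 0"
proof
  assume d0: "deriv b4 0 = 0"
  let ?x = "(0, s, r) :: real \<times> real \<times> real" and ?\<eta> = "(1 :: real, - b1 0, - b2 0)"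
  have ft: "f_t ?x = b1 0 *\<^sub>R X 0 + b2 0 *\<^sub>R Y 0" by (simp add: f_t_def sing)
  have "Z 0 = 0"
  proof (rule whitney_umbrella_interval_second_order[OF wu open_slab[OF I(1)] _ smooth_f])
    show "?x \<in> fst -` I" using I(2) by simp
    show "Z 0 \<bullet> frechet_derivative f (at ?x) v = 0" for v
      using Df[of ?x v] I(2) by (simp add: ft inner_add_right frame)
    show "frechet_derivative f (at ?x) ?\<eta> = 0"
      using Df[of ?x ?\<eta>] I(2) by (simp add: ft)
    show "?\<eta> \<noteq> 0" by (simp add: zero_prod_def)
    have "((\<lambda>x. Z 0 \<bullet> (f_t x - b1 0 *\<^sub>R X (fst x) - b2 0 *\<^sub>R Y (fst x))) has_derivative (\<lambda>v. 0)) (at ?x)"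
      using normal_component_has_derivative[OF sing, of "b1 0" "b2 0"] by (simp add: d0)
    then show "((\<lambda>x. Z 0 \<bullet> frechet_derivative f (at x) ?\<eta>) has_derivative (\<lambda>v. 0)) (at ?x)"
      by (rule has_derivative_transform_within_open[OF _ open_slab[OF I(1)]]) (use I(2) in \<open>auto simp: Df\<close>)
  qed
  then show False using Z_nonzero[OF I(2)] by simp
qed

text \<open>For small \<open>t\<close> the ruling plane projects isomorphically to the plane of
  \<open>X 0\<close> and \<open>Y 0\<close>, and \<open>n \<bullet> f\<close> is affine in the
  projected coordinates, with coefficients given by Cramer's rule. They vanish at
  \<open>t = 0\<close>, as \<open>n\<close> is orthogonal to \<open>X 0\<close>, \<open>Y 0\<close>
  and \<open>\<gamma> 0 = 0\<close>; Hadamard's lemma extracts the factor \<open>t\<close>.\<close>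

lemma affine_graph_coefficients:
  assumes n: "n \<bullet> X 0 = 0" "n \<bullet> Y 0 = 0"
  obtains l0 l1 l2 where "smooth_on UNIV l0" "smooth_on UNIV l1" "smooth_on UNIV l2"
    "l0 0 = n \<bullet> \<gamma>' 0" "l1 0 = n \<bullet> X' 0" "l2 0 = n \<bullet> Y' 0"
    "\<forall>\<^sub>F t in nhds 0. \<forall>s r. n \<bullet> f (t, s, r) =
      t * (l0 t + l1 t * (X 0 \<bullet> f (t, s, r)) + l2 t * (Y 0 \<bullet> f (t, s, r)))"
proof -
  define D where "D = (\<lambda>t. (X 0 \<bullet> X t) * (Y 0 \<bullet> Y t) - (X 0 \<bullet> Y t) * (Y 0 \<bullet> X t))"
  define N1 where "N1 = (\<lambda>t. (n \<bullet> X t) * (Y 0 \<bullet> Y t) - (n \<bullet> Y t) * (Y 0 \<bullet> X t))"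
  define N2 where "N2 = (\<lambda>t. (n \<bullet> Y t) * (X 0 \<bullet> X t) - (n \<bullet> X t) * (X 0 \<bullet> Y t))"
  define q1 where "q1 = (\<lambda>t. N1 t / D t)"
  define q2 where "q2 = (\<lambda>t. N2 t / D t)"
  define q0 where "q0 = (\<lambda>t. n \<bullet> \<gamma> t - q1 t * (X 0 \<bullet> \<gamma> t) - q2 t * (Y 0 \<bullet> \<gamma> t))"
  define J where "J = I \<inter> D -` (- {0})"
  have sD: "smooth_on I D" and sN: "smooth_on I N1" "smooth_on I N2"
    unfolding D_def N1_def N2_def by (intro smooth_intros I smooth)+
  have D0: "D 0 = 1" using I(2) by (simp add: D_def frame)
  have J: "open J" "0 \<in> J" "J \<subseteq> I"
    unfolding J_def using continuous_open_preimage[OF smooth_on_continuous_on[OF sD] I(1), of "- {0}"] I(2) D0 by auto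
  have sq: "smooth_on J q1" "smooth_on J q2"
    unfolding q1_def q2_def
    by (intro smooth_on_divide J smooth_on_subset[OF sD J(3)] smooth_on_subset[OF sN(1) J(3)]
        smooth_on_subset[OF sN(2) J(3)]; simp add: J_def)+
  have sq0: "smooth_on J q0" unfolding q0_def
    by (intro smooth_intros J sq smooth_on_subset[OF smooth(1) J(3)])
  have cramer: "n \<bullet> X t = q1 t * (X 0 \<bullet> X t) + q2 t * (Y 0 \<bullet> X t)"
    "n \<bullet> Y t = q1 t * (X 0 \<bullet> Y t) + q2 t * (Y 0 \<bullet> Y t)" if "t \<in> J" for t
  proof -
    have "D t \<noteq> 0" using that by (simp add: J_def)
    moreover have "(n \<bullet> X t) * D t = N1 t * (X 0 \<bullet> X t) + N2 t * (Y 0 \<bullet> X t)"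
      "(n \<bullet> Y t) * D t = N1 t * (X 0 \<bullet> Y t) + N2 t * (Y 0 \<bullet> Y t)"
      by (simp_all add: D_def N1_def N2_def algebra_simps)
    ultimately show "n \<bullet> X t = q1 t * (X 0 \<bullet> X t) + q2 t * (Y 0 \<bullet> X t)"
      "n \<bullet> Y t = q1 t * (X 0 \<bullet> Y t) + q2 t * (Y 0 \<bullet> Y t)"
      by (simp_all add: q1_def q2_def add_divide_distrib[symmetric] eq_divide_eq)
  qed
  have id: "n \<bullet> f (t, s, r) = q0 t + q1 t * (X 0 \<bullet> f (t, s, r)) + q2 t * (Y 0 \<bullet> f (t, s, r))"
    if "t \<in> J" for t s r
    unfolding f_eq fst_conv snd_conv inner_add_right inner_scaleR_right cramer[OF that] q0_def
    by (simp add: algebra_simps)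
  have zero: "q1 0 = 0" "q2 0 = 0" "q0 0 = 0" by (simp_all add: q1_def q2_def q0_def N1_def N2_def n \<gamma>0)
  have dc: "((\<lambda>t. m \<bullet> c t) has_real_derivative m \<bullet> curve_deriv c 0) (at 0)" if "smooth_on I c" for m c
    using has_derivative_inner_right[OF smooth_curve_has_vector_derivative[OF that I(2), unfolded has_vector_derivative_def], of m]
    by (simp add: has_field_derivative_def mult_commute_abs)
  have dq: "(q1 has_real_derivative deriv q1 0) (at 0)" "(q2 has_real_derivative deriv q2 0) (at 0)"
    using sq J(2) by (auto intro: smooth_real_has_real_derivative)
  have d1: "deriv q1 0 = n \<bullet> X' 0"
  proof -
    have "((\<lambda>t. q1 t * (X 0 \<bullet> X t) + q2 t * (Y 0 \<bullet> X t)) has_real_derivative n \<bullet> X' 0) (at 0)"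
      by (rule has_field_derivative_transform_within_open[OF dc[OF smooth(2)] J(1,2)]) (rule cramer)
    from DERIV_unique[OF this DERIV_add[OF DERIV_mult[OF dq(1) dc[OF smooth(2)]] DERIV_mult[OF dq(2) dc[OF smooth(2)]]]]
    show ?thesis using I(2) by (simp add: zero frame)
  qed
  have d2: "deriv q2 0 = n \<bullet> Y' 0"
  proof -
    have "((\<lambda>t. q1 t * (X 0 \<bullet> Y t) + q2 t * (Y 0 \<bullet> Y t)) has_real_derivative n \<bullet> Y' 0) (at 0)"
      by (rule has_field_derivative_transform_within_open[OF dc[OF smooth(3)] J(1,2)]) (rule cramer)
    from DERIV_unique[OF this DERIV_add[OF DERIV_mult[OF dq(1) dc[OF smooth(3)]] DERIV_mult[OF dq(2) dc[OF smooth(3)]]]]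
    show ?thesis using I(2) by (simp add: zero frame)
  qed
  have d0: "(q0 has_real_derivative n \<bullet> \<gamma>' 0) (at 0)"
    using DERIV_diff[OF DERIV_diff[OF dc[OF smooth(1), of n] DERIV_mult[OF dq(1) dc[OF smooth(1), of "X 0"]]]
        DERIV_mult[OF dq(2) dc[OF smooth(1), of "Y 0"]]]
    by (simp add: zero \<gamma>0 q0_def)
  have ex: "\<exists>l. smooth_on UNIV l \<and> l 0 = d \<and> (\<forall>\<^sub>F t in nhds 0. q t = t * l t)"
    if q: "smooth_on J q" "q 0 = 0" "(q has_real_derivative d) (at 0)" for q d
  proof -
    obtain F e where F: "smooth_on UNIV F" "\<forall>\<^sub>F t in nhds 0. F t = q t"
      using smooth_globalisation[OF J(1,2) q(1)] by metis
    have F0: "F 0 = 0" using eventually_nhds_x_imp_x[OF F(2)] q(2) by simp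
    have "(F has_real_derivative d) (at 0)"
      using q(3) DERIV_cong_ev[OF refl F(2) refl] by blast
    from hadamard_real[OF F(1) F0 this]
    obtain l where l: "smooth_on UNIV l" "\<And>t. F t = t * l t" "l 0 = d" by metis
    have "\<forall>\<^sub>F t in nhds 0. q t = t * l t" using F(2) by eventually_elim (simp add: l(2))
    then show ?thesis using l(1,3) by blast
  qed
  obtain l0 where l0: "smooth_on UNIV l0" "l0 0 = n \<bullet> \<gamma>' 0" "\<forall>\<^sub>F t in nhds 0. q0 t = t * l0 t"
    using ex[OF sq0 zero(3) d0] by blast
  obtain l1 where l1: "smooth_on UNIV l1" "l1 0 = n \<bullet> X' 0" "\<forall>\<^sub>F t in nhds 0. q1 t = t * l1 t"
    using ex[OF sq(1) zero(1) dq(1)[unfolded d1]] by blast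
  obtain l2 where l2: "smooth_on UNIV l2" "l2 0 = n \<bullet> Y' 0" "\<forall>\<^sub>F t in nhds 0. q2 t = t * l2 t"
    using ex[OF sq(2) zero(2) dq(2)[unfolded d2]] by blast
  have "\<forall>\<^sub>F t in nhds 0. \<forall>s r. n \<bullet> f (t, s, r) =
      t * (l0 t + l1 t * (X 0 \<bullet> f (t, s, r)) + l2 t * (Y 0 \<bullet> f (t, s, r)))"
    using l0(3) l1(3) l2(3) eventually_nhds_in_open[OF J(1,2)]
  proof eventually_elim
    case (elim t)
    show ?case using id[OF elim(4)] by (simp add: elim(1-3) distrib_left mult.assoc)
  qed
  then show ?thesis using that l0(1,2) l1(1,2) l2(1,2) by blast
qed

lemma deriv_nonzero_imp_umbrella:
  assumes sing: "b4 0 = 0" "b3 0 + s + a 0 * r = 0" and d: "deriv b4 0 \<noteq> 0"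
  shows "whitney_umbrella_interval f (0, s, r)"
proof -
  let ?x = "(0, s, r) :: real \<times> real \<times> real"
  let ?p = "\<lambda>x. (X 0 \<bullet> f x, Y 0 \<bullet> f x)"
  have f0: "f ?x = s *\<^sub>R X 0 + r *\<^sub>R Y 0" by (simp add: f_eq \<gamma>0)
  have px: "?p ?x = (s, r)" using I(2) by (simp add: f0 inner_add_right frame)
  have g0: "\<gamma>' 0 = b1 0 *\<^sub>R X 0 + b2 0 *\<^sub>R Y 0 + b3 0 *\<^sub>R X' 0" using deriv_\<gamma>[OF I(2)] by (simp add: sing)
  obtain l0 l1 l2 where l: "smooth_on UNIV l0" "smooth_on UNIV l1" "smooth_on UNIV l2"
    "l0 0 = X' 0 \<bullet> \<gamma>' 0" "l1 0 = X' 0 \<bullet> X' 0" "l2 0 = X' 0 \<bullet> Y' 0"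
    "\<forall>\<^sub>F t in nhds 0. \<forall>s r. X' 0 \<bullet> f (t, s, r) = t * (l0 t + l1 t * (X 0 \<bullet> f (t, s, r)) + l2 t * (Y 0 \<bullet> f (t, s, r)))"
    by (rule affine_graph_coefficients[of "X' 0"]) (auto simp: frame I(2))
  obtain m0 m1 m2 where m: "smooth_on UNIV m0" "smooth_on UNIV m1" "smooth_on UNIV m2"
    "m0 0 = Z 0 \<bullet> \<gamma>' 0" "m1 0 = Z 0 \<bullet> X' 0" "m2 0 = Z 0 \<bullet> Y' 0"
    "\<forall>\<^sub>F t in nhds 0. \<forall>s r. Z 0 \<bullet> f (t, s, r) = t * (m0 t + m1 t * (X 0 \<bullet> f (t, s, r)) + m2 t * (Y 0 \<bullet> f (t, s, r)))"
    by (rule affine_graph_coefficients[of "Z 0"]) (auto simp: frame I(2))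
  \<comment> \<open>Since \<open>b4 0 = 0\<close>, none of \<open>\<gamma>' 0\<close>,
    \<open>X' 0\<close>, \<open>Y' 0\<close> has a component along \<open>Z 0\<close>; a second
    factor \<open>t\<close> therefore splits off.\<close>
  have m0: "m0 0 = 0" "m1 0 = 0" "m2 0 = 0"
    using I(2) by (simp_all add: m g0 deriv_Y frame inner_add_right)
  have had: "\<exists>h. smooth_on UNIV h \<and> (\<forall>t. q t = t * h t)" if "smooth_on UNIV q" "q 0 = 0" for q :: "real \<Rightarrow> real"
    using hadamard_real[OF that smooth_real_has_real_derivative[OF that(1) UNIV_I]] by metis
  obtain h0 h1 h2 where h: "smooth_on UNIV h0" "smooth_on UNIV h1" "smooth_on UNIV h2"
    "\<And>t. m0 t = t * h0 t" "\<And>t. m1 t = t * h1 t" "\<And>t. m2 t = t * h2 t"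
    using had[OF m(1) m0(1)] had[OF m(2) m0(2)] had[OF m(3) m0(3)] by metis
  define L where "L = (\<lambda>z :: (real \<times> real) \<times> real. l0 (snd z) + l1 (snd z) * fst (fst z) + l2 (snd z) * snd (fst z))"
  define H where "H = (\<lambda>z :: (real \<times> real) \<times> real. h0 (snd z) + h1 (snd z) * fst (fst z) + h2 (snd z) * snd (fst z))"
  have sn: "smooth_on UNIV (\<lambda>z :: (real \<times> real) \<times> real. q (snd z))" if "smooth_on UNIV q" for q :: "real \<Rightarrow> real"
    by (rule smooth_on_compose[OF that]) (auto intro!: smooth_intros)
  have sL: "smooth_on UNIV L" and sH: "smooth_on UNIV H"
    unfolding L_def H_def by (intro smooth_intros sn l h open_UNIV)+
  have "\<forall>\<^sub>F t in nhds 0. t \<in> I \<and> (\<forall>s r. X' 0 \<bullet> f (t, s, r) = t * L (?p (t, s, r), t)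
      \<and> Z 0 \<bullet> f (t, s, r) = t\<^sup>2 * H (?p (t, s, r), t))"
    using l(7) m(7) eventually_nhds_in_open[OF I]
    by eventually_elim (simp add: L_def H_def h power2_eq_square algebra_simps)
  then obtain J where J: "open J" "0 \<in> J" "\<And>t. t \<in> J \<Longrightarrow> t \<in> I"
    "\<And>t s r. t \<in> J \<Longrightarrow> X' 0 \<bullet> f (t, s, r) = t * L (?p (t, s, r), t)"
    "\<And>t s r. t \<in> J \<Longrightarrow> Z 0 \<bullet> f (t, s, r) = t\<^sup>2 * H (?p (t, s, r), t)"
    unfolding eventually_nhds by blast
  have sf: "smooth_on (fst -` J) f"
    by (rule smooth_on_subset[OF smooth_f]) (use J(3) in auto)
  \<comment> \<open>The singularity condition centres this affine function at the singular point;
    its \<open>u\<close>-coefficient is \<open>X' 0 \<bullet> X' 0 = 1\<close>.\<close>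
  have L0: "L ((u, v), 0) = (u - fst (?p ?x)) + a 0 * (v - snd (?p ?x))" for u v
  proof -
    have "b3 0 = - s - a 0 * r" using sing(2) by simp
    then show ?thesis unfolding px
      using I(2) by (simp add: L_def l g0 deriv_Y frame inner_add_right algebra_simps)
  qed
  \<comment> \<open>On the line \<open>(t, s, r)\<close> the \<open>Z 0\<close>-component of
    \<open>f\<close> is \<open>t\<^sup>2 * k t\<close>, where \<open>k 0\<close> is the value in
    question. Its second derivative at \<open>0\<close> is \<open>2 * k 0\<close>; computed through
    \<open>f_t\<close> it is \<open>deriv b4 0 * (Z 0 \<bullet> Z 0)\<close>.\<close>
  have H0: "H (?p ?x, 0) \<noteq> 0"
  proof
    assume H0: "H (?p ?x, 0) = 0"
    define k where "k = (\<lambda>t. H (?p (t, s, r), t))"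
    define E where "E = (\<lambda>t. Z 0 \<bullet> f_t (t, s, r))"
    have line: "((\<lambda>t. (t, s, r)) has_derivative (\<lambda>h. (h, 0, 0))) (at t)" for t
      by (intro has_derivative_Pair has_derivative_ident has_derivative_const)
    have sl: "smooth_on J (\<lambda>t. f (t, s, r))"
      by (rule smooth_on_compose[OF sf open_slab[OF J(1)] J(1)]) (auto intro!: smooth_intros J)
    have sk: "smooth_on J k" unfolding k_def
      by (rule smooth_on_compose[OF sH open_UNIV J(1)]) (auto intro!: smooth_intros J sl)
    have sdk: "smooth_on J (deriv k)"
    proof (rule smooth_on_cong[OF J(1) _ smooth_on_derivative[OF sk, of 1]])
      show "frechet_derivative k (at t) 1 = deriv k t" if "t \<in> J" for t
        using fun_cong[OF has_derivative_unique[OF smooth_on_has_derivative[OF sk that]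
              smooth_real_has_real_derivative[OF sk that, unfolded has_field_derivative_def]], of 1] by simp
    qed
    have E: "E t = 2 * t * k t + t\<^sup>2 * deriv k t" if t: "t \<in> J" for t
    proof -
      have "(f has_derivative frechet_derivative f (at (t, s, r))) (at (t, s, r))"
        by (rule smooth_on_has_derivative[OF sf]) (use t in simp)
      from has_derivative_inner_right[OF has_derivative_compose[OF line this], of "Z 0"]
      have "((\<lambda>t. Z 0 \<bullet> f (t, s, r)) has_real_derivative E t) (at t)"
        using J(3)[OF t] by (simp add: Df E_def has_field_derivative_def mult_commute_abs)
      then have "((\<lambda>t. t\<^sup>2 * k t) has_real_derivative E t) (at t)"
        by (rule has_field_derivative_transform_within_open[OF _ J(1) t]) (simp add: J(5) k_def)
      moreover have "((\<lambda>t. t\<^sup>2 * k t) has_real_derivative 2 * t * k t + t\<^sup>2 * deriv k t) (at t)"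
        by (rule DERIV_cong[OF DERIV_mult[OF DERIV_power[OF DERIV_ident, of 2]
                smooth_real_has_real_derivative[OF sk t]]]) simp
      ultimately show ?thesis by (rule DERIV_unique)
    qed
    have "k 0 = 0" using H0 by (simp add: k_def)
    then have "((\<lambda>t. 2 * t * k t + t\<^sup>2 * deriv k t) has_real_derivative 0) (at 0)"
      using DERIV_add[OF DERIV_mult[OF DERIV_cmult[OF DERIV_ident, of 2] smooth_real_has_real_derivative[OF sk J(2)]]
          DERIV_mult[OF DERIV_power[OF DERIV_ident, of 2] smooth_real_has_real_derivative[OF sdk J(2)]]]
      by simp
    then have "(E has_real_derivative 0) (at 0)"
      by (rule has_field_derivative_transform_within_open[OF _ J(1,2)]) (simp add: E)
    moreover have "(E has_real_derivative deriv b4 0 * (Z 0 \<bullet> Z 0)) (at 0)"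
    proof -
      from has_derivative_compose[OF line normal_component_has_derivative[OF sing, of 0 0]]
      show ?thesis
        using I(2) by (simp add: E_def[abs_def] frame deriv_Y has_field_derivative_def mult_commute_abs)
    qed
    ultimately have "deriv b4 0 * (Z 0 \<bullet> Z 0) = 0" using DERIV_unique by blast
    then show False using d Z_nonzero[OF I(2)] by simp
  qed
  show ?thesis
  proof (rule whitney_umbrella_intervalI[OF open_slab[OF J(1)] _ sf _ frame_total[OF I(2)] sH H0 sL])
    show "?x \<in> fst -` J" "fst ?x = 0" using J(2) by simp_all
    show "X' 0 \<bullet> f x = fst x * L (?p x, fst x)" if "x \<in> fst -` J" for x
      using J(4)[of "fst x" "fst (snd x)" "snd (snd x)"] that by simp
    show "Z 0 \<bullet> f x = (fst x)\<^sup>2 * H (?p x, fst x)" if "x \<in> fst -` J" for x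
      using J(5)[of "fst x" "fst (snd x)" "snd (snd x)"] that by simp
    show "L ((u, v), 0) = (u - fst (?p ?x)) + a 0 * (v - snd (?p ?x))" for u v by (rule L0)
    show "(X 0 \<bullet> frechet_derivative f (at ?x) v, Y 0 \<bullet> frechet_derivative f (at ?x) v) = snd v"
      if "fst v = 0" for v
      using that I(2) by (simp add: Df inner_add_right frame)
  qed
qed

end

theorem theorem2p14:
  fixes \<gamma> X Y :: "real \<Rightarrow> real^4"
    and a b1 b2 b3 b4 :: "real \<Rightarrow> real"
    and I :: "real set"
    and s r :: real
  assumes "two_ruled_data I \<gamma> X Y"
    and "constrictively_adapted I X Y"
    and "pseudo_nondegenerate I X Y"
    and "normalised I X Y"
    and "associated_functions I \<gamma> X Y a b1 b2 b3 b4"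
    and "singular_point (two_ruled \<gamma> X Y) (0, s, r)"
  shows "whitney_umbrella_interval (two_ruled \<gamma> X Y) (0, s, r) \<longleftrightarrow>
         \<not> (\<forall>\<^sub>F t in nhds 0. b4 t = 0) \<and> deriv b4 0 \<noteq> 0"
proof -
  interpret ruled_frame I \<gamma> X Y a b1 b2 b3 b4
    using assms by unfold_locales
  note sing = singular_imp[OF assms(6)]
  have "\<not> (\<forall>\<^sub>F t in nhds 0. b4 t = 0)" if "deriv b4 0 \<noteq> 0"
    using that deriv_cong_ev[of b4 "\<lambda>t. 0" 0 0] by auto
  then show ?thesis
    using umbrella_imp_deriv_nonzero[OF _ sing] deriv_nonzero_imp_umbrella[OF sing] by blast
qed

end
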